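(* Let $\varepsilon\in(0,1)$ and $\alpha,\beta\in[0,\infty]$. Let $\mathbf{D}_\alpha$ be any quantum extension of the classical Rényi divergence $D_\alpha$, and let $D_\beta^{\varepsilon,\mathbb{M}}$ be the measured (minimal) quantum extension of the smoothed classical Rényi divergence $D_\beta^{\varepsilon}$. Define $$\mu(\varepsilon,\alpha,\beta):=\sup_A\sup_{\rho,\sigma\in\mathfrak{D}(A)}\Big\{D_\beta^{\varepsilon,\mathbb{M}}(\rho\|\sigma)-\mathbf{D}_\alpha(\rho\|\sigma)\Big\},$$ where the supremum is over all finite-dimensional systems $A$; i.e. $\mu(\varepsilon,\alpha,\beta)$ is the smallest number such that $D_\beta^{\varepsilon,\mathbb{M}}(\rho\|\sigma)\le \mathbf{D}_\alpha(\rho\|\sigma)+\mu(\varepsilon,\alpha,\beta)$ for all finite-dimensional $A$ and all $\rho,\sigma\in\mathfrak{D}(A)$ (and $\mu=\infty$ if there is no such finite number). Let $\theta\in(0,1)$ be defined by $$\theta:=\begin{cases}\frac{\beta-\alpha}{\beta(1-\alpha)}&\text{if }0<\alpha<\beta<1,\\[2pt] \frac{\beta-\alpha}{\alpha(\beta-1)}&\text{if }\beta>\alpha>1,\end{cases}$$ (with $\theta=1/\alpha$ when $\beta=\infty>\alpha>1$) and let $h_2(\theta):=-\theta\log\theta-(1-\theta)\log(1-\theta)$ be the binary Shannon entropy. Then $$\mu(\varepsilon,\alpha,\beta)=\max\{0,\tilde\mu(\varepsilon,\alpha,\beta)\},\qquad \tilde\mu(\varepsilon,\alpha,\beta):=\begin{cases}\frac{\beta}{1-\beta}\left(\theta\log\frac1\varepsilon-h_2(\theta)\right)&\text{if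 }0<\alpha<\beta<1,\\[2pt] \frac{\alpha}{\alpha-1}\left(\theta\log\frac1\varepsilon-h_2(\theta)\right)&\text{if }\beta>\alpha>1,\\[2pt] 0&\text{if }\alpha\ge\beta\ge0,\\ \infty&\text{otherwise.}\end{cases}$$
   Context: $\log$ is base 2. $\mathrm{Prob}(d)$ is the set of $d$-dimensional probability vectors. Classical Rényi divergence: for $\alpha\in(0,1)\cup(1,\infty)$ and $\mathbf p,\mathbf q\in\mathrm{Prob}(d)$, $D_\alpha(\mathbf p\|\mathbf q)=\frac1{\alpha-1}\log\sum_x p_x^\alpha q_x^{1-\alpha}$, equal to $\infty$ if $\alpha>1$ and $\mathrm{supp}(\mathbf p)\not\subseteq\mathrm{supp}(\mathbf q)$, or if $\alpha<1$ and the supports are disjoint; by continuity $D_0(\mathbf p\|\mathbf q)=-\log\sum_{x:p_x>0}q_x$ (the min-relative entropy), $D_1$ is the Kullback–Leibler divergence, and $D_\infty(\mathbf p\|\mathbf q)=\log\max_{x:p_x>0}p_x/q_x$ (the max-relative entropy). Smoothing: $\mathfrak{B}^\varepsilon(\mathbf p)=\{\mathbf p'\in\mathrm{Prob}(d):\frac12\|\mathbf p-\mathbf p'\|_1\le\varepsilon\}$ and $D_\beta^\varepsilon(\mathbf p\|\mathbf q)=\min_{\mathbf p'\in\mathfrak{B}^\varepsilon(\mathbf p)}D_\beta(\mathbf p'\|\mathbf q)$. $\mathfrak{D}(A)$ is the set of density operators on a finite-dimensional Hilbert space $A$. A quantum divergence is a function $\mathbf D$ on pairs of density operators (in all finite dimensions)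 with values in $\mathbb R\cup\{\infty\}$ such that $\mathbf D(\mathcal E(\rho)\|\mathcal E(\sigma))\le\mathbf D(\rho\|\sigma)$ for every completely positive trace-preserving map $\mathcal E$. A quantum extension of a classical divergence $D$ is a quantum divergence that coincides with $D$ on commuting (simultaneously diagonal) states. The measured extension of $D_\beta^\varepsilon$ is $D_\beta^{\varepsilon,\mathbb M}(\rho\|\sigma)=\sup_{\mathcal E}D_\beta^\varepsilon(\mathcal E(\rho)\|\mathcal E(\sigma))$, the supremum running over all POVM measurement channels $\mathcal E$ from $A$ to a finite classical system $X$ (outputs regarded as probability vectors).
   Formalization: For α = 0 < β < 1 the English table gives ∞, which is false since D_β^ε ≤ D_0 + (β/(1−β)) log(1/ε); the formal theorem instead uses the first line of the table there (θ = 1), i.e. the value (β/(1−β)) log(1/ε). *)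

theory Defs
  imports
    "HOL-Library.Extended_Real"
    "Jordan_Normal_Form.Schur_Decomposition"
begin

subsection \<open>Classical Renyi divergences\<close>

definition prob_vecs :: "nat \<Rightarrow> real vec set" where
  "prob_vecs d = {p \<in> carrier_vec d. (\<forall>i<d. 0 \<le> p $ i) \<and> (\<Sum>i<d. p $ i) = 1}"

definition supp_vec :: "real vec \<Rightarrow> nat set" where
  "supp_vec p = {x. x < dim_vec p \<and> p $ x \<noteq> 0}"

(* In HOL 0 powr r = 0 for every r, so only x in both supports contribute to the power sums. For
   \<alpha> > 1 this is harmless because the supports are then nested. *)
definition renyi_div :: "ereal \<Rightarrow> real vec \<Rightarrow> real vec \<Rightarrow> ereal" where
  "renyi_div \<alpha> p q =
    (if \<alpha> < 1 then
       (if supp_vec p \<inter> supp_vec q = {} then \<infinity>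
        else if \<alpha> = 0 then ereal (- log 2 (\<Sum>x\<in>supp_vec p. q $ x))
        else let a = real_of_ereal \<alpha> in
          ereal (1 / (a - 1) * log 2 (\<Sum>x<dim_vec p. (p $ x) powr a * (q $ x) powr (1 - a))))
     else
       (if \<not> supp_vec p \<subseteq> supp_vec q then \<infinity>
        else if \<alpha> = 1 then ereal (\<Sum>x\<in>supp_vec p. p $ x * log 2 (p $ x / q $ x))
        else if \<alpha> = \<infinity> then ereal (log 2 (Max ((\<lambda>x. p $ x / q $ x) ` supp_vec p)))
        else let a = real_of_ereal \<alpha> in
          ereal (1 / (a - 1) * log 2 (\<Sum>x<dim_vec p. (p $ x) powr a * (q $ x) powr (1 - a)))))"

definition prob_ball :: "real \<Rightarrow> real vec \<Rightarrow> real vec set" where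
  "prob_ball \<epsilon> p =
    {p' \<in> prob_vecs (dim_vec p). 1 / 2 * (\<Sum>i<dim_vec p. \<bar>p $ i - p' $ i\<bar>) \<le> \<epsilon>}"

(* For D = renyi_div \<beta> the infimum is a minimum: the ball is compact, and renyi_div \<beta> is lower
   semicontinuous in its first argument if \<beta> > 0 and takes only finitely many values if \<beta> = 0. *)
definition smoothed ::
  "real \<Rightarrow> (real vec \<Rightarrow> real vec \<Rightarrow> ereal) \<Rightarrow> real vec \<Rightarrow> real vec \<Rightarrow> ereal" where
  "smoothed \<epsilon> D p q = (INF p' \<in> prob_ball \<epsilon> p. D p' q)"


subsection \<open>States, channels and measurements\<close>

definition mat_trace :: "complex mat \<Rightarrow> complex" where
  "mat_trace A = (\<Sum>i<dim_row A. A $$ (i, i))"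

definition psd_mats :: "nat \<Rightarrow> complex mat set" where
  "psd_mats n = {A \<in> carrier_mat n n.
     \<forall>v \<in> carrier_vec n. (A *\<^sub>v v) \<bullet>c v \<in> \<real> \<and> 0 \<le> Re ((A *\<^sub>v v) \<bullet>c v)}"

definition density_ops :: "nat \<Rightarrow> complex mat set" where
  "density_ops n = {\<rho> \<in> psd_mats n. mat_trace \<rho> = 1}"

(* The map (id on k x k matrices) \<otimes> E: a matrix of size k * n is read as a k x k array of
   n x n blocks, and E is applied to every block. *)
definition ampliation ::
  "nat \<Rightarrow> nat \<Rightarrow> nat \<Rightarrow> (complex mat \<Rightarrow> complex mat) \<Rightarrow> complex mat \<Rightarrow> complex mat" where
  "ampliation k n m E X = mat (k * m) (k * m) (\<lambda>(i, j).
     E (mat n n (\<lambda>(a, b). X $$ ((i div m) * n + a, (j div m) * n + b))) $$ (i mod m, j mod m))"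

definition cptp :: "nat \<Rightarrow> nat \<Rightarrow> (complex mat \<Rightarrow> complex mat) \<Rightarrow> bool" where
  "cptp n m E \<longleftrightarrow>
     (\<forall>A \<in> carrier_mat n n. E A \<in> carrier_mat m m) \<and>
     (\<forall>A \<in> carrier_mat n n. \<forall>B \<in> carrier_mat n n. E (A + B) = E A + E B) \<and>
     (\<forall>c. \<forall>A \<in> carrier_mat n n. E (c \<cdot>\<^sub>m A) = c \<cdot>\<^sub>m E A) \<and>
     (\<forall>k. \<forall>X \<in> psd_mats (k * n). ampliation k n m E X \<in> psd_mats (k * m)) \<and>
     (\<forall>A \<in> carrier_mat n n. mat_trace (E A) = mat_trace A)"

(* Values at pairs other than two density operators of equal dimension play no role. *)
definition quantum_divergence :: "(complex mat \<Rightarrow> complex mat \<Rightarrow> ereal) \<Rightarrow> bool" where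
  "quantum_divergence D \<longleftrightarrow>
     (\<forall>n. \<forall>\<rho> \<in> density_ops n. \<forall>\<sigma> \<in> density_ops n. D \<rho> \<sigma> \<noteq> -\<infinity>) \<and>
     (\<forall>n m E. cptp n m E \<longrightarrow>
        (\<forall>\<rho> \<in> density_ops n. \<forall>\<sigma> \<in> density_ops n. D (E \<rho>) (E \<sigma>) \<le> D \<rho> \<sigma>))"

(* The matrix with eigenvalues p in the orthonormal basis formed by the columns of U. *)
definition diag_in_basis :: "complex mat \<Rightarrow> real vec \<Rightarrow> complex mat" where
  "diag_in_basis U p = U * mat_diag (dim_vec p) (\<lambda>i. complex_of_real (p $ i)) * mat_adjoint U"

definition quantum_extension ::
  "(real vec \<Rightarrow> real vec \<Rightarrow> ereal) \<Rightarrow> (complex mat \<Rightarrow> complex mat \<Rightarrow> ereal) \<Rightarrow> bool" where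
  "quantum_extension Dc D \<longleftrightarrow> quantum_divergence D \<and>
     (\<forall>n. \<forall>U \<in> carrier_mat n n. U * mat_adjoint U = 1\<^sub>m n \<longrightarrow>
        (\<forall>p \<in> prob_vecs n. \<forall>q \<in> prob_vecs n.
           D (diag_in_basis U p) (diag_in_basis U q) = Dc p q))"

definition povm :: "nat \<Rightarrow> nat \<Rightarrow> (nat \<Rightarrow> complex mat) \<Rightarrow> bool" where
  "povm n d M \<longleftrightarrow>
     (\<forall>x<d. M x \<in> psd_mats n) \<and> mat n n (\<lambda>ij. \<Sum>x<d. M x $$ ij) = 1\<^sub>m n"

definition measure_povm :: "nat \<Rightarrow> (nat \<Rightarrow> complex mat) \<Rightarrow> complex mat \<Rightarrow> real vec" where
  "measure_povm d M \<rho> = vec d (\<lambda>x. Re (mat_trace (M x * \<rho>)))"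

definition measured_ext ::
  "(real vec \<Rightarrow> real vec \<Rightarrow> ereal) \<Rightarrow> complex mat \<Rightarrow> complex mat \<Rightarrow> ereal" where
  "measured_ext Dc \<rho> \<sigma> =
     (SUP (d, M) \<in> {(d, M). povm (dim_row \<rho>) d M}. Dc (measure_povm d M \<rho>) (measure_povm d M \<sigma>))"


subsection \<open>The optimal additive constant\<close>

(* Stated through the inequality, since both divergences may be infinite and the difference is
   then undefined (in ereal it would be \<infinity>). The infimum of the empty set is \<infinity>. *)
definition opt_const :: "real \<Rightarrow> ereal \<Rightarrow> (complex mat \<Rightarrow> complex mat \<Rightarrow> ereal) \<Rightarrow> ereal" where
  "opt_const \<epsilon> \<beta> D = Inf (ereal ` {c. \<forall>n. \<forall>\<rho> \<in> density_ops n. \<forall>\<sigma> \<in> density_ops n.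
     measured_ext (smoothed \<epsilon> (renyi_div \<beta>)) \<rho> \<sigma> \<le> D \<rho> \<sigma> + ereal c})"

lemma Inf_upper_bounds_eq_SUP:
  fixes f g :: "'a \<Rightarrow> ereal"
  assumes "\<And>i. i \<in> I \<Longrightarrow> g i \<noteq> -\<infinity>"
  shows "Inf (ereal ` {c. \<forall>i\<in>I. f i \<le> g i + ereal c}) = (SUP i\<in>{i\<in>I. g i \<noteq> \<infinity>}. f i - g i)"
    (is "_ = ?S")
proof -
  have "(\<forall>i\<in>I. f i \<le> g i + ereal c) \<longleftrightarrow> ?S \<le> ereal c" for c
  proof -
    have "f i \<le> g i + ereal c \<longleftrightarrow> (g i \<noteq> \<infinity> \<longrightarrow> f i - g i \<le> ereal c)" if "i \<in> I" for i
      using assms[OF that] by (cases "f i"; cases "g i") (auto simp: algebra_simps)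
    then show ?thesis by (auto simp: SUP_le_iff)
  qed
  then have "Inf (ereal ` {c. \<forall>i\<in>I. f i \<le> g i + ereal c}) = Inf (ereal ` {c. ?S \<le> ereal c})"
    by simp
  also have "\<dots> = ?S"
  proof (rule antisym)
    show "Inf (ereal ` {c. ?S \<le> ereal c}) \<le> ?S"
    proof (rule ereal_le_real)
      fix z assume "?S \<le> ereal z"
      then show "Inf (ereal ` {c. ?S \<le> ereal c}) \<le> ereal z" by (auto intro: Inf_lower)
    qed
  qed (auto intro: Inf_greatest)
  finally show ?thesis .
qed

(* opt_const is the supremum of the differences over all pairs at which D is finite. *)
lemma opt_const_eq_SUP:
  assumes "quantum_divergence D"
  shows "opt_const \<epsilon> \<beta> D =
    (SUP (\<rho>, \<sigma>) \<in> {(\<rho>, \<sigma>). (\<exists>n. \<rho> \<in> density_ops n \<and> \<sigma> \<in> density_ops n) \<and> D \<rho> \<sigma> \<noteq> \<infinity>}.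
       measured_ext (smoothed \<epsilon> (renyi_div \<beta>)) \<rho> \<sigma> - D \<rho> \<sigma>)"
proof -
  let ?I = "{(\<rho>, \<sigma>). \<exists>n. \<rho> \<in> density_ops n \<and> \<sigma> \<in> density_ops n}"
  let ?f = "\<lambda>(\<rho>, \<sigma>). measured_ext (smoothed \<epsilon> (renyi_div \<beta>)) \<rho> \<sigma>"
  have "opt_const \<epsilon> \<beta> D = Inf (ereal ` {c. \<forall>i\<in>?I. ?f i \<le> case_prod D i + ereal c})"
    unfolding opt_const_def by (rule arg_cong[where f = "\<lambda>A. Inf (ereal ` A)"]) auto
  also have "\<dots> = (SUP i\<in>{i\<in>?I. case_prod D i \<noteq> \<infinity>}. ?f i - case_prod D i)"
    using assms by (intro Inf_upper_bounds_eq_SUP) (auto simp: quantum_divergence_def)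
  also have "\<dots> = (SUP (\<rho>, \<sigma>) \<in> {(\<rho>, \<sigma>). (\<exists>n. \<rho> \<in> density_ops n \<and> \<sigma> \<in> density_ops n) \<and> D \<rho> \<sigma> \<noteq> \<infinity>}.
       measured_ext (smoothed \<epsilon> (renyi_div \<beta>)) \<rho> \<sigma> - D \<rho> \<sigma>)"
    by (rule SUP_cong) auto
  finally show ?thesis .
qed

definition binary_entropy :: "real \<Rightarrow> real" where
  "binary_entropy t = - t * log 2 t - (1 - t) * log 2 (1 - t)"

definition theta :: "ereal \<Rightarrow> ereal \<Rightarrow> real" where
  "theta \<alpha> \<beta> = (let a = real_of_ereal \<alpha>; b = real_of_ereal \<beta> in
     if \<beta> = \<infinity> then 1 / a
     else if \<beta> < 1 then (b - a) / (b * (1 - a))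
     else (b - a) / (a * (b - 1)))"

(* The first case includes \<alpha> = 0 < \<beta> < 1. There theta = 1 and the value is
   b / (1 - b) * log 2 (1 / \<epsilon>), the limit \<alpha> \<rightarrow> 0; it is finite because p' = (1 - \<epsilon>) p + \<epsilon> q_S,
   with q_S the normalised restriction of q to S = supp p, is within distance \<epsilon> of p and satisfies
   D_\<beta>(p' || q) \<le> D_0(p || q) + b / (1 - b) * log 2 (1 / \<epsilon>). *)
definition mu_tilde :: "real \<Rightarrow> ereal \<Rightarrow> ereal \<Rightarrow> ereal" where
  "mu_tilde \<epsilon> \<alpha> \<beta> = (let a = real_of_ereal \<alpha>; b = real_of_ereal \<beta>; t = theta \<alpha> \<beta> in
     if 0 \<le> \<alpha> \<and> \<alpha> < \<beta> \<and> \<beta> < 1 then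
       ereal (b / (1 - b) * (t * log 2 (1 / \<epsilon>) - binary_entropy t))
     else if 1 < \<alpha> \<and> \<alpha> < \<beta> then
       ereal (a / (a - 1) * (t * log 2 (1 / \<epsilon>) - binary_entropy t))
     else if \<beta> \<le> \<alpha> \<and> 0 \<le> \<beta> then 0
     else \<infinity>)"

end

theory Submission
  imports Defs
begin

text \<open>A measurement is a channel, so data processing reduces the claim to probability vectors, and
  diagonal states show that nothing is lost.

  For the upper bound, move mass \<open>\<epsilon>\<close> from the largest to the smallest likelihood ratios, clamping
  \<open>p / q\<close> to \<open>f = p' / q \<in> [t', t]\<close>. For \<open>\<alpha> > 1\<close> write \<open>f\<^sup>a = t'\<^sup>a + \<zeta> (t\<^sup>a - t'\<^sup>a)\<close> with \<open>a = \<alpha> - 1\<close>,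
  \<open>w = \<Sum> \<zeta> p'\<close> and \<open>s = \<Sum> \<zeta> p = w + \<epsilon>\<close>. Hoelder's inequality applied to
  \<open>\<Sum> p\<^sup>\<alpha> q\<^sup>1\<^sup>-\<^sup>\<alpha> = \<Sum> p (p / p')\<^sup>a f\<^sup>a\<close> bounds this sum from below by
  \<open>t'\<^sup>a + (t\<^sup>a - t'\<^sup>a) s\<^sup>\<alpha> / w\<^sup>a\<close>, and by convexity the \<open>b / a\<close>-th root of \<open>\<Sum> p' f\<^sup>b\<close> for
  \<open>b = \<beta> - 1\<close> is at most \<open>t'\<^sup>a\<close> plus \<open>t\<^sup>a - t'\<^sup>a\<close> times the \<open>b / a\<close>-th root of \<open>w\<close>. Comparing the two
  summands separately gives the constants \<open>1\<close> and the supremum of \<open>w\<^sup>\<beta>\<^sup>/\<^sup>b / (w + \<epsilon>)\<^sup>\<alpha>\<^sup>/\<^sup>a\<close>, which is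
  attained at \<open>w + \<epsilon> = \<epsilon> / \<theta>\<close>. The case \<open>\<beta> < 1\<close> is dual. Two-point distributions with one
  probability of \<open>q\<close> tending to \<open>0\<close> show that the constant is optimal.\<close>

section \<open>Power inequalities and clamped likelihood ratios\<close>

text \<open>If \<open>q\<close> lies within distance \<open>\<epsilon>\<close> of \<open>p\<close>,
  smoothing to \<open>q\<close> itself gives divergence 0. So only larger distances matter; there
  the two thresholds of the clamp lie on opposite sides of 1 and the lowered and raised entries are
  disjoint. The weight \<open>\<zeta>\<close> is then exactly 1 on one of these sets and 0 on the
  other, so the \<open>\<zeta>\<close>-masses of \<open>p\<close> and \<open>p'\<close> differ by
  exactly \<open>\<epsilon>\<close>. Interpolating the power with the smaller exponent makes one
  power sum linear in \<open>\<zeta>\<close>; the other is bounded by convexity. The maximum with 0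
  has its origin in the summand free of \<open>\<zeta>\<close>, whose comparison allows no constant
  below 1, and the pair \<open>p = q\<close> shows that it cannot be avoided. The parameter
  \<open>\<theta>\<close> makes the exponent of the smaller mass \<open>1 - \<theta>\<close> times
  that of the larger one. The entropy then comes from the nonnegativity of the relative entropy of
  \<open>(\<theta>, 1 - \<theta>)\<close> to the pair of masses \<open>\<epsilon>\<close> and
  \<open>w\<close>, normalised by \<open>w + \<epsilon>\<close>. For
  \<open>\<theta> \<le> \<epsilon>\<close> the maximiser leaves the range
  \<open>w + \<epsilon> < 1\<close>, but the constant is then at most 0.\<close>

lemma weighted_am_gm:
  fixes x y \<theta> :: real
  assumes "0 \<le> x" "0 \<le> y" "0 \<le> \<theta>" "\<theta> \<le> 1"
  shows "x powr \<theta> * y powr (1 - \<theta>) \<le> \<theta> * x + (1 - \<theta>) * y"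
proof (cases "x = 0 \<or> y = 0")
  case True
  then show ?thesis using assms by auto
next
  case False
  with assms have pos: "0 < x" "0 < y" by auto
  define m where "m = \<theta> * x + (1 - \<theta>) * y"
  have m: "0 < m"
    unfolding m_def using pos assms
    by (cases "\<theta> = 0") (auto intro!: add_pos_nonneg)
  \<comment> \<open>The tangent of \<open>ln\<close> at 1 is used at \<open>x / m\<close> and
    \<open>y / m\<close>; the two linear bounds cancel because \<open>m\<close> is the weighted
    mean.\<close>
  have "\<theta> * ln (x / m) + (1 - \<theta>) * ln (y / m) \<le> \<theta> * (x / m - 1) + (1 - \<theta>) * (y / m - 1)"
    using assms pos m by (intro add_mono mult_left_mono ln_le_minus_one) auto
  also have "\<dots> = (\<theta> * x + (1 - \<theta>) * y) / m - 1"
    using m by (simp add: algebra_simps add_divide_distrib diff_divide_distrib)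
  also have "\<dots> = 0" using m by (simp flip: m_def)
  finally have "\<theta> * ln x + (1 - \<theta>) * ln y \<le> ln m"
    using pos m by (simp add: ln_div algebra_simps)
  then have "exp (\<theta> * ln x + (1 - \<theta>) * ln y) \<le> m" using m by (metis exp_le_cancel_iff exp_ln)
  then show ?thesis using pos by (simp add: powr_def exp_add flip: m_def)
qed

text \<open>After normalising both sums to 1 this is the weighted mean inequality in every term. The
  endpoint \<open>\<theta> = 0\<close> is included because order 0 uses it; since
  \<open>0 powr 0 = 0\<close>, the left side then sums \<open>v\<close> only over the support of
  \<open>u\<close>.\<close>

lemma Hoelder_sum:
  fixes u v :: "'i \<Rightarrow> real"
  assumes "finite I" and u: "\<And>i. i \<in> I \<Longrightarrow> 0 \<le> u i" and v: "\<And>i. i \<in> I \<Longrightarrow> 0 \<le> v i"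
    and \<theta>: "0 \<le> \<theta>" "\<theta> \<le> 1"
  shows "(\<Sum>i\<in>I. u i powr \<theta> * v i powr (1 - \<theta>)) \<le> (\<Sum>i\<in>I. u i) powr \<theta> * (\<Sum>i\<in>I. v i) powr (1 - \<theta>)"
proof (cases "sum u I = 0 \<or> sum v I = 0")
  case True
  then have "u i powr \<theta> * v i powr (1 - \<theta>) = 0" if "i \<in> I" for i
    using that assms by (auto simp: sum_nonneg_eq_0_iff)
  then have "(\<Sum>i\<in>I. u i powr \<theta> * v i powr (1 - \<theta>)) = 0" by (rule sum.neutral[OF ballI])
  then show ?thesis by simp
next
  case False
  define U where "U = sum u I"
  define V where "V = sum v I"
  have pos: "0 < U" "0 < V"
    using False sum_nonneg[of I u] sum_nonneg[of I v] u v by (force simp: U_def V_def)+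
  have "(\<Sum>i\<in>I. u i powr \<theta> * v i powr (1 - \<theta>))
      = U powr \<theta> * V powr (1 - \<theta>) * (\<Sum>i\<in>I. (u i / U) powr \<theta> * (v i / V) powr (1 - \<theta>))"
    unfolding sum_distrib_left using pos u v
    by (intro sum.cong refl) (simp add: powr_divide)
  also have "\<dots> \<le> U powr \<theta> * V powr (1 - \<theta>) * (\<Sum>i\<in>I. \<theta> * (u i / U) + (1 - \<theta>) * (v i / V))"
    using pos u v \<theta> by (intro mult_left_mono sum_mono weighted_am_gm) auto
  also have "(\<Sum>i\<in>I. \<theta> * (u i / U) + (1 - \<theta>) * (v i / V)) = 1"
    using pos by (simp add: sum.distrib flip: sum_distrib_left sum_divide_distrib U_def V_def)
  finally show ?thesis by (simp flip: U_def V_def)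
qed

text \<open>Hoelder's inequality with exponent \<open>1 / k\<close>, after splitting the weight as
  \<open>p = p powr (1 / k) * p powr (1 - 1 / k)\<close>.\<close>

lemma Jensen_powr_sum:
  fixes p y :: "'i \<Rightarrow> real"
  assumes "finite I" and p: "\<And>i. i \<in> I \<Longrightarrow> 0 \<le> p i" and y: "\<And>i. i \<in> I \<Longrightarrow> 0 \<le> y i"
    and p1: "sum p I \<le> 1" and k: "1 \<le> k"
  shows "(\<Sum>i\<in>I. p i * y i) powr k \<le> (\<Sum>i\<in>I. p i * y i powr k)"
proof -
  have "(\<Sum>i\<in>I. p i * y i) = (\<Sum>i\<in>I. (p i * y i powr k) powr (1 / k) * p i powr (1 - 1 / k))"
  proof (intro sum.cong refl)
    fix i assume i: "i \<in> I"
    have "p i powr (1 / k) * p i powr (1 - 1 / k) = p i"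
      using p[OF i] by (cases "p i = 0") (auto simp flip: powr_add)
    then show "p i * y i = (p i * y i powr k) powr (1 / k) * p i powr (1 - 1 / k)"
      using p[OF i] y[OF i] k by (simp add: powr_mult powr_powr mult.assoc mult.left_commute)
  qed
  also have "\<dots> \<le> (\<Sum>i\<in>I. p i * y i powr k) powr (1 / k) * sum p I powr (1 - 1 / k)"
    using assms by (intro Hoelder_sum) auto
  also have "\<dots> \<le> (\<Sum>i\<in>I. p i * y i powr k) powr (1 / k) * 1"
    using p1 k p sum_nonneg[of I p] by (intro mult_left_mono powr_le1) auto
  finally have "(\<Sum>i\<in>I. p i * y i) powr k \<le> ((\<Sum>i\<in>I. p i * y i powr k) powr (1 / k)) powr k"
    using k p y by (intro powr_mono2 sum_nonneg) auto
  also have "\<dots> = (\<Sum>i\<in>I. p i * y i powr k)"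
    using k p y by (simp add: powr_powr sum_nonneg)
  finally show ?thesis .
qed

lemma powr_convex_comb:
  fixes u v \<zeta> k :: real
  assumes "0 \<le> u" "0 \<le> v" "0 \<le> \<zeta>" "\<zeta> \<le> 1" "1 \<le> k"
  shows "((1 - \<zeta>) * u + \<zeta> * v) powr k \<le> (1 - \<zeta>) * u powr k + \<zeta> * v powr k"
  using Jensen_powr_sum[of UNIV "\<lambda>b. if b then \<zeta> else 1 - \<zeta>" "\<lambda>b. if b then v else u" k] assms
  by (auto simp: UNIV_bool algebra_simps)

text \<open>Increments of the convex function \<open>x powr k\<close> over intervals of equal length grow.\<close>
lemma powr_interpolation:
  fixes u v \<nu> k :: real
  assumes u: "0 \<le> u" "u \<le> v" and \<nu>: "0 \<le> \<nu>" "\<nu> \<le> 1" and k: "1 \<le> k"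
  shows "((1 - \<nu>) * u powr k + \<nu> * v powr k) powr (1 / k) \<le> u + \<nu> powr (1 / k) * (v - u)"
proof (cases "v = 0")
  case True
  then show ?thesis using assms by auto
next
  case False
  with assms have v: "0 < v" by auto
  define h where "h = \<nu> powr (1 / k)"
  have h: "0 \<le> h" "h \<le> 1" and \<nu>h: "\<nu> = h powr k"
    using \<nu> k by (auto simp: h_def powr_le1 powr_powr)
  \<comment> \<open>The intervals from \<open>h * u\<close> to \<open>u\<close> and from
    \<open>h * v\<close> to \<open>u + h * (v - u)\<close> both have length
    \<open>(1 - h) * u\<close>, and the second starts no lower. As \<open>h powr k = \<nu>\<close>,
    the comparison of their increments is the claim raised to the power \<open>k\<close>.\<close>
  have *: "u powr k + (h * v) powr k \<le> (h * u) powr k + (u + h * (v - u)) powr k"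
  proof (cases "h = 1 \<or> h * u = u + h * (v - u)")
    case True
    then show ?thesis
    proof
      assume eq: "h * u = u + h * (v - u)"
      then have "(1 - h) * u + h * (v - u) = 0" by (simp add: algebra_simps)
      moreover have "0 \<le> (1 - h) * u" "0 \<le> h * (v - u)" using h u by auto
      ultimately have "(1 - h) * u = 0" "h * (v - u) = 0" by linarith+
      then have "u + h * (v - u) = u" "h * v = h * u" by (auto simp: algebra_simps)
      then show ?thesis by auto
    qed simp
  next
    case False
    define e where "e = u + h * (v - u)"
    have le: "h * u \<le> u" "u \<le> e" using h u by (auto simp: e_def mult_left_le_one_le)
    with False have lt: "h * u < e" by (auto simp: e_def)
    \<comment> \<open>\<open>u\<close> and \<open>h * v\<close> have the same sum as the endpoints
      \<open>h * u\<close> and \<open>e\<close>, so they are convex combinations of them with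
      exchanged weights; adding the two convexity bounds removes \<open>\<zeta>\<close>.\<close>
    define \<zeta> where "\<zeta> = (u - h * u) / (e - h * u)"
    have \<zeta>: "0 \<le> \<zeta>" "\<zeta> \<le> 1" using le lt by (auto simp: \<zeta>_def)
    have \<zeta>e: "\<zeta> * (e - h * u) = u - h * u" using lt by (simp add: \<zeta>_def)
    have u1: "u = (1 - \<zeta>) * (h * u) + \<zeta> * e" using \<zeta>e by (simp add: algebra_simps)
    have u2: "h * v = (1 - (1 - \<zeta>)) * (h * u) + (1 - \<zeta>) * e"
      using \<zeta>e by (simp add: algebra_simps e_def)
    have 0: "0 \<le> h * u" "0 \<le> e" using h u le by auto
    have "u powr k \<le> (1 - \<zeta>) * (h * u) powr k + \<zeta> * e powr k"
      using powr_convex_comb[of "h * u" e \<zeta> k] 0 \<zeta> k u1 by simp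
    moreover have "(h * v) powr k \<le> (1 - (1 - \<zeta>)) * (h * u) powr k + (1 - \<zeta>) * e powr k"
      using powr_convex_comb[of "h * u" e "1 - \<zeta>" k] 0 \<zeta> k u2 by simp
    ultimately have "u powr k + (h * v) powr k \<le> (h * u) powr k + e powr k"
      by (simp add: algebra_simps)
    then show ?thesis by (simp only: e_def)
  qed
  then have "(1 - \<nu>) * u powr k + \<nu> * v powr k \<le> (u + h * (v - u)) powr k"
    using u v h by (simp add: \<nu>h powr_mult algebra_simps)
  then have "((1 - \<nu>) * u powr k + \<nu> * v powr k) powr (1 / k) \<le> ((u + h * (v - u)) powr k) powr (1 / k)"
    using \<nu> k by (intro powr_mono2) auto
  also have "\<dots> = u + h * (v - u)" using u h k by (simp add: powr_powr)
  finally show ?thesis by (simp flip: h_def)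
qed

text \<open>Hoelder's inequality with exponent \<open>1 / \<alpha>\<close>, solved for the sum of
  mixed powers. The factorisation of \<open>u i\<close> behind it fails where \<open>v i = 0\<close>
  unless \<open>u i = 0\<close> as well, hence the support hypothesis.\<close>

lemma Hoelder_sum_gt1:
  fixes u v :: "'i \<Rightarrow> real"
  assumes "finite I" and u: "\<And>i. i \<in> I \<Longrightarrow> 0 \<le> u i" and v: "\<And>i. i \<in> I \<Longrightarrow> 0 \<le> v i"
    and uv: "\<And>i. i \<in> I \<Longrightarrow> v i = 0 \<Longrightarrow> u i = 0" and \<alpha>: "1 < \<alpha>"
  shows "sum u I powr \<alpha> * sum v I powr (1 - \<alpha>) \<le> (\<Sum>i\<in>I. u i powr \<alpha> * v i powr (1 - \<alpha>))" (is "_ \<le> ?X")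
proof (cases "sum v I = 0")
  case True
  then show ?thesis by (simp add: sum_nonneg)
next
  case False
  then have V: "0 < sum v I" using sum_nonneg[of I v] v by force
  have "sum u I = (\<Sum>i\<in>I. (u i powr \<alpha> * v i powr (1 - \<alpha>)) powr (1 / \<alpha>) * v i powr (1 - 1 / \<alpha>))"
  proof (intro sum.cong refl)
    fix i assume i: "i \<in> I"
    have "v i powr ((1 - \<alpha>) / \<alpha>) * v i powr (1 - 1 / \<alpha>) = (if v i = 0 then 0 else 1)"
      using v[OF i] \<alpha> by (auto simp: divide_simps simp flip: powr_add)
    then show "u i = (u i powr \<alpha> * v i powr (1 - \<alpha>)) powr (1 / \<alpha>) * v i powr (1 - 1 / \<alpha>)"
      using u[OF i] v[OF i] uv[OF i] \<alpha> by (auto simp: powr_mult powr_powr mult.assoc)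
  qed
  also have "\<dots> \<le> ?X powr (1 / \<alpha>) * sum v I powr (1 - 1 / \<alpha>)"
    using assms by (intro Hoelder_sum) auto
  finally have "sum u I powr \<alpha> \<le> (?X powr (1 / \<alpha>) * sum v I powr (1 - 1 / \<alpha>)) powr \<alpha>"
    using \<alpha> u by (intro powr_mono2 sum_nonneg) auto
  also have "\<dots> = ?X * sum v I powr (\<alpha> - 1)"
    using \<alpha> by (simp add: powr_mult powr_powr sum_nonneg left_diff_distrib)
  finally have "sum u I powr \<alpha> * sum v I powr (1 - \<alpha>) \<le> ?X * sum v I powr (\<alpha> - 1) * sum v I powr (1 - \<alpha>)"
    by (intro mult_right_mono) auto
  also have "\<dots> = ?X" using V by (simp add: mult.assoc flip: powr_add)
  finally show ?thesis .
qed

section \<open>Clamping the likelihood ratio\<close>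

text \<open>The mass \<open>\<epsilon>\<close> is removed by truncating \<open>p\<close> at
  \<open>t * q\<close>, where \<open>t > 1\<close> comes from the intermediate value theorem and
  \<open>\<tau> = 1 / t\<close>. The value \<open>\<tau> = 0\<close> stands for an infinite
  threshold. That \<open>q \<le> p\<close> on the truncated entries is what later keeps them apart
  from the raised ones.\<close>

lemma cut_large_ratios:
  fixes p q :: "'i \<Rightarrow> real"
  assumes fin: "finite I" and p: "\<And>i. i \<in> I \<Longrightarrow> 0 \<le> p i" and q: "\<And>i. i \<in> I \<Longrightarrow> 0 \<le> q i"
    and \<epsilon>: "0 < \<epsilon>" "\<epsilon> < (\<Sum>i\<in>I. max (p i - q i) 0)"
  obtains r \<tau> where "0 \<le> \<tau>" "\<tau> < 1" "(\<Sum>i\<in>I. p i - r i) = \<epsilon>"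
    "\<And>i. i \<in> I \<Longrightarrow> 0 \<le> r i \<and> r i \<le> p i \<and> \<tau> * r i \<le> q i"
    "\<And>i. i \<in> I \<Longrightarrow> r i < p i \<Longrightarrow> q i = \<tau> * r i \<and> q i \<le> p i"
proof -
  \<comment> \<open>The mass of \<open>p\<close> outside the support of \<open>q\<close>, which no
    finite threshold can remove completely. If it exceeds \<open>\<epsilon>\<close>, scaling this
    part down by \<open>1 - \<epsilon> / \<delta>\<close> suffices.\<close>
  define \<delta> where "\<delta> = (\<Sum>i\<in>I. if q i = 0 then p i else 0)"
  show thesis
  proof (cases "\<epsilon> < \<delta>")
    case True
    define r where "r i = (if q i = 0 then p i * (1 - \<epsilon> / \<delta>) else p i)" for i
    have fr: "0 \<le> \<epsilon> / \<delta>" "\<epsilon> / \<delta> \<le> 1" using True \<epsilon> by auto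
    have "(\<Sum>i\<in>I. p i - r i) = (\<Sum>i\<in>I. \<epsilon> / \<delta> * (if q i = 0 then p i else 0))"
      by (intro sum.cong) (auto simp: r_def algebra_simps)
    also have "\<dots> = \<epsilon>" unfolding sum_distrib_left[symmetric] \<delta>_def[symmetric] using True \<epsilon> by simp
    finally show thesis
    proof (intro that[of 0 r])
      fix i assume i: "i \<in> I"
      have "p i * (1 - \<epsilon> / \<delta>) \<le> p i * 1" using p[OF i] fr by (intro mult_left_mono) auto
      then show "0 \<le> r i \<and> r i \<le> p i \<and> 0 * r i \<le> q i"
        using p[OF i] q[OF i] fr by (auto simp: r_def)
    qed (auto simp: r_def p split: if_splits)
  next
    case False
    define h where "h t = (\<Sum>i\<in>I. max (p i - t * q i) 0)" for t
    \<comment> \<open>At least as large as every ratio with nonzero denominator (the others count as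
      0), so truncation at \<open>T * q\<close> removes exactly
      \<open>\<delta> \<le> \<epsilon>\<close>, whereas truncation at \<open>q\<close> removes more
      than \<open>\<epsilon>\<close>.\<close>
    define T where "T = 1 + (\<Sum>i\<in>I. p i / q i)"
    have T1: "1 \<le> T" unfolding T_def using p q by (auto intro!: sum_nonneg)
    have "max (p i - T * q i) 0 = (if q i = 0 then p i else 0)" if i: "i \<in> I" for i
    proof (cases "q i = 0")
      case False
      with q[OF i] have qi: "0 < q i" by simp
      have "p i / q i \<le> T"
        unfolding T_def using fin i p q by (auto intro!: add_increasing member_le_sum)
      then show ?thesis using qi by (simp add: field_simps)
    qed (use p[OF i] in auto)
    then have "h T = \<delta>" unfolding h_def \<delta>_def by (intro sum.cong) auto
    moreover have "h 1 > \<epsilon>" using \<epsilon> by (simp add: h_def)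
    moreover have "continuous_on {1..T} h" unfolding h_def by (intro continuous_intros)
    ultimately obtain t where t: "1 \<le> t" "t \<le> T" "h t = \<epsilon>"
      using IVT2'[of h T \<epsilon> 1] T1 False by auto
    with \<open>h 1 > \<epsilon>\<close> have t1: "1 < t" by (cases "t = 1") auto
    define r where "r i = min (p i) (t * q i)" for i
    have "(\<Sum>i\<in>I. p i - r i) = h t" unfolding h_def r_def by (intro sum.cong) auto
    then show thesis
    proof (intro that[of "1 / t" r])
      fix i assume i: "i \<in> I"
      show "0 \<le> r i \<and> r i \<le> p i \<and> 1 / t * r i \<le> q i"
        using p[OF i] q[OF i] t1 by (auto simp: r_def field_simps)
      have "q i \<le> t * q i" using q[OF i] t1 by (simp add: mult_le_cancel_right1)
      then show "r i < p i \<Longrightarrow> q i = 1 / t * r i \<and> q i \<le> p i"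
        using t1 by (auto simp: r_def min_def split: if_splits)
    qed (use t t1 in auto)
  qed
qed

text \<open>Raising \<open>p\<close> to at least \<open>t * q\<close> adds nothing at
  \<open>t = 0\<close> and more than \<open>\<epsilon>\<close> at \<open>t = 1\<close>; the mass
  added depends continuously on \<open>t\<close>.\<close>

lemma fill_small_ratios:
  fixes p q :: "'i \<Rightarrow> real"
  assumes p: "\<And>i. i \<in> I \<Longrightarrow> 0 \<le> p i"
    and \<epsilon>: "0 < \<epsilon>" "\<epsilon> < (\<Sum>i\<in>I. max (q i - p i) 0)"
  obtains t where "0 < t" "t < 1" "(\<Sum>i\<in>I. max (t * q i - p i) 0) = \<epsilon>"
proof -
  define h where "h t = (\<Sum>i\<in>I. max (t * q i - p i) 0)" for t
  have "h 0 = (\<Sum>i\<in>I. 0)" unfolding h_def using p by (intro sum.cong) auto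
  then have h0: "h 0 = 0" by simp
  have h1: "h 1 > \<epsilon>" using \<epsilon> by (simp add: h_def)
  have "continuous_on {0..1} h" unfolding h_def by (intro continuous_intros)
  then obtain t where t: "0 \<le> t" "t \<le> 1" "h t = \<epsilon>"
    using IVT'[of h 0 \<epsilon> 1] h0 h1 \<epsilon> by auto
  with h0 h1 \<epsilon> have "t \<noteq> 0" "t \<noteq> 1" by auto
  with t show thesis by (intro that[of t]) (auto simp: h_def)
qed

text \<open>The optimal smoothing clamps the likelihood ratio. It is recorded through \<open>q = g * r\<close> with
  \<open>\<tau> \<le> g \<le> \<tau>'\<close>, so that the part of \<open>p\<close> outside the support of \<open>q\<close> corresponds to \<open>g = 0\<close>.\<close>
lemma clamped_smoothing:
  fixes p q :: "'i \<Rightarrow> real"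
  assumes fin: "finite I" and p: "\<And>i. i \<in> I \<Longrightarrow> 0 \<le> p i" and q: "\<And>i. i \<in> I \<Longrightarrow> 0 \<le> q i"
    and sums: "sum p I = 1" "sum q I = 1"
    and \<epsilon>: "0 < \<epsilon>" "\<epsilon> < (\<Sum>i\<in>I. max (p i - q i) 0)"
  obtains r \<tau> \<tau>' where "0 \<le> \<tau>" "\<tau> < \<tau>'" "\<And>i. i \<in> I \<Longrightarrow> 0 \<le> r i" "sum r I = 1"
    "\<And>i. i \<in> I \<Longrightarrow> \<tau> * r i \<le> q i \<and> q i \<le> \<tau>' * r i"
    "\<And>i. i \<in> I \<Longrightarrow> r i < p i \<Longrightarrow> q i = \<tau> * r i"
    "\<And>i. i \<in> I \<Longrightarrow> p i < r i \<Longrightarrow> q i = \<tau>' * r i"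
    "(\<Sum>i\<in>I. max (p i - r i) 0) = \<epsilon>" "(\<Sum>i\<in>I. max (r i - p i) 0) = \<epsilon>"
    "(\<Sum>i\<in>I. \<bar>p i - r i\<bar>) = 2 * \<epsilon>"
proof -
  obtain c \<tau> where \<tau>: "0 \<le> \<tau>" "\<tau> < 1" and csum: "(\<Sum>i\<in>I. p i - c i) = \<epsilon>"
    and c: "\<And>i. i \<in> I \<Longrightarrow> 0 \<le> c i \<and> c i \<le> p i \<and> \<tau> * c i \<le> q i"
    and cut: "\<And>i. i \<in> I \<Longrightarrow> c i < p i \<Longrightarrow> q i = \<tau> * c i \<and> q i \<le> p i"
    by (rule cut_large_ratios[OF fin p q \<epsilon>]) blast+
  \<comment> \<open>Equal totals make the positive and negative parts of \<open>p - q\<close>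
    equally heavy, so one distance hypothesis serves both the cutting and the filling.\<close>
  have "(\<Sum>i\<in>I. max (q i - p i) 0) = (\<Sum>i\<in>I. max (p i - q i) 0 - p i + q i)"
    by (intro sum.cong) auto
  also have "\<dots> = (\<Sum>i\<in>I. max (p i - q i) 0)" by (simp add: sum.distrib sum_subtractf sums)
  finally have lt: "\<epsilon> < (\<Sum>i\<in>I. max (q i - p i) 0)" using \<epsilon> by simp
  obtain t where t: "0 < t" "t < 1" and tsum: "(\<Sum>i\<in>I. max (t * q i - p i) 0) = \<epsilon>"
    by (rule fill_small_ratios[of I p \<epsilon> q, OF p \<epsilon>(1) lt])
  define r where "r i = (if p i < t * q i then t * q i else c i)" for i
  \<comment> \<open>No entry is both cut and filled: a cut entry has \<open>q \<le> p\<close>, a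
    filled one has \<open>p < t * q \<le> q\<close>.\<close>
  have low: "c i = p i" if "i \<in> I" "p i < t * q i" for i
  proof (rule ccontr)
    assume "c i \<noteq> p i"
    with c[OF that(1)] have "c i < p i" by auto
    from cut[OF that(1) this] have "q i \<le> p i" by simp
    moreover have "t * q i \<le> q i" using t q[OF that(1)] by (simp add: mult_left_le_one_le)
    ultimately show False using that by simp
  qed
  have up: "max (r i - p i) 0 = max (t * q i - p i) 0" if "i \<in> I" for i
    using c[OF that] by (auto simp: r_def)
  have down: "max (p i - r i) 0 = p i - c i" if "i \<in> I" for i
    using c[OF that] low[OF that] by (auto simp: r_def)
  have S1: "(\<Sum>i\<in>I. max (r i - p i) 0) = \<epsilon>"
    unfolding tsum[symmetric] by (intro sum.cong up refl)
  have S2: "(\<Sum>i\<in>I. max (p i - r i) 0) = \<epsilon>"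
    unfolding csum[symmetric] by (intro sum.cong down refl)
  have "sum r I = (\<Sum>i\<in>I. p i + max (r i - p i) 0 - max (p i - r i) 0)" by (intro sum.cong) auto
  also have "\<dots> = 1" by (simp add: sum.distrib sum_subtractf sums S1 S2)
  finally have S3: "sum r I = 1" .
  have "(\<Sum>i\<in>I. \<bar>p i - r i\<bar>) = (\<Sum>i\<in>I. max (p i - r i) 0 + max (r i - p i) 0)"
    by (intro sum.cong) auto
  also have "\<dots> = 2 * \<epsilon>" by (simp add: sum.distrib S1 S2)
  finally have S4: "(\<Sum>i\<in>I. \<bar>p i - r i\<bar>) = 2 * \<epsilon>" .
  have \<tau>t: "\<tau> < 1 / t" using \<tau> t by (simp add: field_simps) (smt (verit) mult_left_le)
  show thesis
  proof (rule that[of \<tau> "1 / t" r])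
    fix i assume i: "i \<in> I"
    show "0 \<le> r i" using c[OF i] q[OF i] t by (auto simp: r_def)
    have "\<tau> * (t * q i) \<le> 1 * (1 * q i)" using \<tau> t q[OF i] by (intro mult_mono) auto
    moreover have "q i \<le> 1 / t * c i" if "\<not> p i < t * q i"
    proof (cases "c i < p i")
      case True
      have "\<tau> * c i \<le> 1 / t * c i" using c[OF i] \<tau>t by (intro mult_right_mono) auto
      then show ?thesis using cut[OF i True] by simp
    next
      case False
      then have "t * q i \<le> c i" using c[OF i] that by simp
      then show ?thesis using t by (simp add: field_simps)
    qed
    ultimately show "\<tau> * r i \<le> q i \<and> q i \<le> 1 / t * r i" using c[OF i] t by (auto simp: r_def)
    show "r i < p i \<Longrightarrow> q i = \<tau> * r i" using cut[OF i] by (auto simp: r_def split: if_splits)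
    show "p i < r i \<Longrightarrow> q i = 1 / t * r i" using c[OF i] t by (auto simp: r_def split: if_splits)
  qed (use \<tau> \<tau>t S1 S2 S3 S4 in auto)
qed

text \<open>The weight sees all of the mass that was lowered and none of the mass that was raised.
  For orders below 1 it is applied with \<open>p\<close> and \<open>r\<close> exchanged.\<close>

lemma weighted_mass_shift:
  fixes p r \<zeta> :: "'i \<Rightarrow> real"
  assumes "\<And>i. i \<in> I \<Longrightarrow> r i < p i \<Longrightarrow> \<zeta> i = 1" "\<And>i. i \<in> I \<Longrightarrow> p i < r i \<Longrightarrow> \<zeta> i = 0"
  shows "(\<Sum>i\<in>I. \<zeta> i * p i) = (\<Sum>i\<in>I. \<zeta> i * r i) + (\<Sum>i\<in>I. max (p i - r i) 0)"
  unfolding sum.distrib[symmetric]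
proof (intro sum.cong refl)
  fix i assume "i \<in> I"
  with assms[of i] show "\<zeta> i * p i = \<zeta> i * r i + max (p i - r i) 0"
    by (cases "p i" "r i" rule: linorder_cases) auto
qed

section \<open>Power sums before and after smoothing\<close>

text \<open>The result is expressed through \<open>t\<close>, \<open>t'\<close> and
  \<open>w\<close>, none of which depends on \<open>\<beta>\<close>, so that one smoothing serves
  all \<open>\<beta>\<close>: the last bound is for finite orders, while order
  \<open>\<infinity>\<close> needs only \<open>r \<le> t * q\<close>.\<close>

lemma power_sum_smoothing_gt1:
  fixes p q :: "'i \<Rightarrow> real"
  assumes fin: "finite I" and p: "\<And>i. i \<in> I \<Longrightarrow> 0 \<le> p i" and q: "\<And>i. i \<in> I \<Longrightarrow> 0 \<le> q i"
    and sums: "sum p I = 1" "sum q I = 1" and supp: "\<And>i. i \<in> I \<Longrightarrow> q i = 0 \<Longrightarrow> p i = 0"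
    and \<epsilon>: "0 < \<epsilon>" "\<epsilon> < (\<Sum>i\<in>I. max (p i - q i) 0)" and \<alpha>: "1 < \<alpha>"
  obtains r t t' w where "0 < t'" "t' < t" "0 < w" "w + \<epsilon> \<le> 1"
    "\<And>i. i \<in> I \<Longrightarrow> 0 \<le> r i" "sum r I = 1" "(\<Sum>i\<in>I. \<bar>p i - r i\<bar>) = 2 * \<epsilon>"
    "\<And>i. i \<in> I \<Longrightarrow> r i \<le> t * q i"
    "(t powr (\<alpha> - 1) - t' powr (\<alpha> - 1)) * ((w + \<epsilon>) powr \<alpha> * w powr (1 - \<alpha>)) + t' powr (\<alpha> - 1)
      \<le> (\<Sum>i\<in>I. p i powr \<alpha> * q i powr (1 - \<alpha>))"
    "\<And>\<beta>. \<alpha> \<le> \<beta> \<Longrightarrow>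
      (\<Sum>i\<in>I. r i powr \<beta> * q i powr (1 - \<beta>)) \<le> (1 - w) * t' powr (\<beta> - 1) + w * t powr (\<beta> - 1)"
proof -
  obtain r \<tau> \<tau>' where \<tau>: "0 \<le> \<tau>" "\<tau> < \<tau>'" and r: "\<And>i. i \<in> I \<Longrightarrow> 0 \<le> r i" and r1: "sum r I = 1"
    and bnd: "\<And>i. i \<in> I \<Longrightarrow> \<tau> * r i \<le> q i \<and> q i \<le> \<tau>' * r i"
    and top: "\<And>i. i \<in> I \<Longrightarrow> r i < p i \<Longrightarrow> q i = \<tau> * r i"
    and bot: "\<And>i. i \<in> I \<Longrightarrow> p i < r i \<Longrightarrow> q i = \<tau>' * r i"
    and mass: "(\<Sum>i\<in>I. max (p i - r i) 0) = \<epsilon>" and dist: "(\<Sum>i\<in>I. \<bar>p i - r i\<bar>) = 2 * \<epsilon>"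
    by (rule clamped_smoothing[OF fin p q sums \<epsilon>]) blast+
  \<comment> \<open>An infinite threshold would cut only entries with \<open>q = 0\<close>, where
    \<open>p\<close> vanishes too, so no mass \<open>\<epsilon>\<close> could be removed.\<close>
  have "\<tau> \<noteq> 0"
  proof
    assume "\<tau> = 0"
    then have "max (p i - r i) 0 = 0" if "i \<in> I" for i
      using top[OF that] supp[OF that] r[OF that] by force
    then have "(\<Sum>i\<in>I. max (p i - r i) 0) = 0" by (rule sum.neutral[OF ballI])
    with mass \<epsilon> show False by simp
  qed
  with \<tau> have \<tau>pos: "0 < \<tau>" "0 < \<tau>'" by auto
  have q0: "p i = 0" "r i = 0" if "i \<in> I" "q i = 0" for i
  proof -
    have "\<tau> * r i \<le> 0" using bnd[OF that(1)] that(2) by simp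
    then show "r i = 0" using r[OF that(1)] \<tau>pos by (simp add: mult_le_0_iff)
  qed (use supp that in auto)
  have rpos: "0 < r i" if "i \<in> I" "q i \<noteq> 0" for i
    using bnd[OF that(1)] r[OF that(1)] q[OF that(1)] that(2) by (cases "r i = 0") auto
  define t t' where "t = 1 / \<tau>" and "t' = 1 / \<tau>'"
  have t: "0 < t'" "t' < t" using \<tau> \<tau>pos by (auto simp: t_def t'_def frac_less2)
  define f where "f i = r i / q i" for i
  have f: "t' \<le> f i" "f i \<le> t" if "i \<in> I" "q i \<noteq> 0" for i
    using bnd[OF that(1)] q[OF that(1)] that(2) \<tau>pos by (auto simp: f_def t_def t'_def field_simps)
  define a where "a = \<alpha> - 1"
  have a: "0 < a" using \<alpha> by (simp add: a_def)
  define \<Delta> where "\<Delta> = t powr a - t' powr a"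
  have \<Delta>: "0 < \<Delta>" using t a by (simp add: \<Delta>_def powr_less_mono2)
  \<comment> \<open>The position of \<open>f powr a\<close> between its extremes
    \<open>t' powr a\<close> and \<open>t powr a\<close>. Where \<open>q\<close> vanishes, so do
    \<open>p\<close> and \<open>r\<close>.\<close>
  define \<zeta> where "\<zeta> i = (if q i = 0 then 0 else (f i powr a - t' powr a) / \<Delta>)" for i
  have \<zeta>01: "0 \<le> \<zeta> i" "\<zeta> i \<le> 1" if i: "i \<in> I" for i
    using f[OF i] t a \<Delta> by (auto simp: \<zeta>_def \<Delta>_def intro!: powr_mono2 divide_nonneg_pos divide_le_eq_1_pos[THEN iffD2])
  have fa: "f i powr a = t' powr a + \<zeta> i * \<Delta>" if "q i \<noteq> 0" for i
    using that \<Delta> by (simp add: \<zeta>_def)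
  have fpow: "x powr \<gamma> * q i powr (1 - \<gamma>) = x powr \<gamma> * r i powr (1 - \<gamma>) * f i powr (\<gamma> - 1)"
    if i: "i \<in> I" "q i \<noteq> 0" for i x \<gamma>
  proof -
    have "q i powr (1 - \<gamma>) = r i powr (1 - \<gamma>) * f i powr (\<gamma> - 1)"
      using rpos[OF i] q[OF i(1)] i(2) powr_add[of "q i" "1 - \<gamma>" "\<gamma> - 1"] powr_add[of "r i" "1 - \<gamma>" "\<gamma> - 1"]
      by (simp add: f_def powr_divide field_simps)
    then show ?thesis by simp
  qed
  define w where "w = (\<Sum>i\<in>I. \<zeta> i * r i)"
  define A where "A = (\<Sum>i\<in>I. p i powr \<alpha> * q i powr (1 - \<alpha>))"
  have \<zeta>top: "\<zeta> i = 1" if "i \<in> I" "r i < p i" for i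
  proof -
    have qi: "q i \<noteq> 0" using that q0[of i] by auto
    with top[OF that] have "f i = t" using rpos[OF that(1)] by (auto simp: f_def t_def)
    then show ?thesis using qi \<Delta> by (simp add: \<zeta>_def \<Delta>_def)
  qed
  have \<zeta>bot: "\<zeta> i = 0" if "i \<in> I" "p i < r i" for i
    using bot[OF that] rpos[OF that(1)] by (auto simp: \<zeta>_def f_def t'_def)
  have s: "(\<Sum>i\<in>I. \<zeta> i * p i) = w + \<epsilon>"
    unfolding w_def mass[symmetric] by (intro weighted_mass_shift \<zeta>top \<zeta>bot)
  have w0: "0 \<le> w" unfolding w_def using \<zeta>01 r by (intro sum_nonneg) auto
  \<comment> \<open>\<open>w\<close> will occur with the negative exponent
    \<open>1 - \<alpha>\<close>. If it were 0, then \<open>\<zeta>\<close> would vanish everywhere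
    and \<open>s = w + \<epsilon>\<close> could not hold.\<close>
  have "w \<noteq> 0"
  proof
    assume "w = 0"
    then have z: "\<zeta> i * r i = 0" if "i \<in> I" for i
      using that fin \<zeta>01 r by (auto simp: w_def sum_nonneg_eq_0_iff)
    have "\<zeta> i = 0" if "i \<in> I" for i using z[OF that] rpos[OF that] by (auto simp: \<zeta>_def)
    then have "(\<Sum>i\<in>I. \<zeta> i * p i) = 0" by simp
    with s \<epsilon> \<open>w = 0\<close> show False by simp
  qed
  with w0 have w: "0 < w" by simp
  have "(\<Sum>i\<in>I. \<zeta> i * p i) \<le> (\<Sum>i\<in>I. 1 * p i)"
    using \<zeta>01 p by (intro sum_mono mult_right_mono) auto
  with s sums have s1: "w + \<epsilon> \<le> 1" by simp
  have "A = (\<Sum>i\<in>I. t' powr a * (p i powr \<alpha> * r i powr (1 - \<alpha>)) + \<Delta> * (\<zeta> i * (p i powr \<alpha> * r i powr (1 - \<alpha>))))"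
    unfolding A_def
  proof (intro sum.cong refl)
    fix i assume i: "i \<in> I"
    show "p i powr \<alpha> * q i powr (1 - \<alpha>)
      = t' powr a * (p i powr \<alpha> * r i powr (1 - \<alpha>)) + \<Delta> * (\<zeta> i * (p i powr \<alpha> * r i powr (1 - \<alpha>)))"
    proof (cases "q i = 0")
      case False
      have "p i powr \<alpha> * q i powr (1 - \<alpha>) = p i powr \<alpha> * r i powr (1 - \<alpha>) * (t' powr a + \<zeta> i * \<Delta>)"
        by (simp add: fpow[OF i False] flip: fa[OF False] a_def)
      then show ?thesis by (simp add: algebra_simps)
    qed (use q0[OF i] in auto)
  qed
  also have "\<dots> = t' powr a * (\<Sum>i\<in>I. p i powr \<alpha> * r i powr (1 - \<alpha>))
      + \<Delta> * (\<Sum>i\<in>I. \<zeta> i * (p i powr \<alpha> * r i powr (1 - \<alpha>)))"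
    by (simp add: sum.distrib sum_distrib_left)
  \<comment> \<open>Since the exponents \<open>\<alpha>\<close> and \<open>1 - \<alpha>\<close> add
    to 1, the weight can be absorbed into both factors; Hoelder's inequality then involves the
    masses \<open>s = w + \<epsilon>\<close> and \<open>w\<close>.\<close>
  also have "(\<Sum>i\<in>I. \<zeta> i * (p i powr \<alpha> * r i powr (1 - \<alpha>)))
      = (\<Sum>i\<in>I. (\<zeta> i * p i) powr \<alpha> * (\<zeta> i * r i) powr (1 - \<alpha>))"
  proof (intro sum.cong refl)
    fix i assume i: "i \<in> I"
    have "\<zeta> i = \<zeta> i powr \<alpha> * \<zeta> i powr (1 - \<alpha>)"
      using \<zeta>01[OF i] by (cases "\<zeta> i = 0") (auto simp flip: powr_add)
    then show "\<zeta> i * (p i powr \<alpha> * r i powr (1 - \<alpha>)) = (\<zeta> i * p i) powr \<alpha> * (\<zeta> i * r i) powr (1 - \<alpha>)"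
      using \<zeta>01[OF i] p[OF i] r[OF i] by (simp add: powr_mult)
  qed
  finally have A: "A = t' powr a * (\<Sum>i\<in>I. p i powr \<alpha> * r i powr (1 - \<alpha>))
      + \<Delta> * (\<Sum>i\<in>I. (\<zeta> i * p i) powr \<alpha> * (\<zeta> i * r i) powr (1 - \<alpha>))" .
  \<comment> \<open>Hoelder's inequality for the totals 1 and 1; this is the nonnegativity of the
    divergence of \<open>p\<close> from \<open>r\<close>.\<close>
  have "1 \<le> (\<Sum>i\<in>I. p i powr \<alpha> * r i powr (1 - \<alpha>))"
    using Hoelder_sum_gt1[of I p r \<alpha>] fin p r q0 rpos \<alpha> sums r1 by force
  moreover have "(w + \<epsilon>) powr \<alpha> * w powr (1 - \<alpha>)
      \<le> (\<Sum>i\<in>I. (\<zeta> i * p i) powr \<alpha> * (\<zeta> i * r i) powr (1 - \<alpha>))"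
    unfolding s[symmetric] unfolding w_def
  proof (rule Hoelder_sum_gt1[OF fin _ _ _ \<alpha>])
    fix i assume i: "i \<in> I"
    show "0 \<le> \<zeta> i * p i" "0 \<le> \<zeta> i * r i" using \<zeta>01[OF i] p[OF i] r[OF i] by auto
    show "\<zeta> i * r i = 0 \<Longrightarrow> \<zeta> i * p i = 0" using q0[OF i] rpos[OF i] by (cases "q i = 0") auto
  qed
  ultimately have "t' powr a * 1 + \<Delta> * ((w + \<epsilon>) powr \<alpha> * w powr (1 - \<alpha>)) \<le> A"
    unfolding A using \<Delta> by (intro add_mono mult_left_mono) auto
  then have Alow: "(t powr (\<alpha> - 1) - t' powr (\<alpha> - 1)) * ((w + \<epsilon>) powr \<alpha> * w powr (1 - \<alpha>)) + t' powr (\<alpha> - 1) \<le> A"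
    by (simp add: \<Delta>_def a_def)
  have Qup: "(\<Sum>i\<in>I. r i powr \<beta> * q i powr (1 - \<beta>)) \<le> (1 - w) * t' powr (\<beta> - 1) + w * t powr (\<beta> - 1)"
    if \<beta>: "\<alpha> \<le> \<beta>" for \<beta>
  proof -
    define b where "b = \<beta> - 1"
    have b: "0 < b" "1 \<le> b / a" using \<beta> \<alpha> by (auto simp: b_def a_def)
    have "(\<Sum>i\<in>I. r i powr \<beta> * q i powr (1 - \<beta>))
        \<le> (\<Sum>i\<in>I. t' powr b * (r i - \<zeta> i * r i) + t powr b * (\<zeta> i * r i))"
    proof (rule sum_mono)
      fix i assume i: "i \<in> I"
      show "r i powr \<beta> * q i powr (1 - \<beta>) \<le> t' powr b * (r i - \<zeta> i * r i) + t powr b * (\<zeta> i * r i)"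
      proof (cases "q i = 0")
        case False
        \<comment> \<open>\<open>f powr a\<close> is linear in \<open>\<zeta>\<close>, so the larger
          power \<open>f powr b\<close> is a convex function of \<open>\<zeta>\<close> and lies
          below its chord.\<close>
        have "f i powr b = (f i powr a) powr (b / a)" using a by (simp add: powr_powr)
        also have "f i powr a = (1 - \<zeta> i) * t' powr a + \<zeta> i * t powr a"
          unfolding fa[OF False] by (simp add: \<Delta>_def algebra_simps)
        also have "\<dots> powr (b / a) \<le> (1 - \<zeta> i) * (t' powr a) powr (b / a) + \<zeta> i * (t powr a) powr (b / a)"
          using \<zeta>01[OF i] b by (intro powr_convex_comb) auto
        also have "\<dots> = (1 - \<zeta> i) * t' powr b + \<zeta> i * t powr b" using a by (simp add: powr_powr)
        finally have "r i * f i powr b \<le> r i * ((1 - \<zeta> i) * t' powr b + \<zeta> i * t powr b)"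
          using r[OF i] by (intro mult_left_mono)
        moreover have "r i powr \<beta> * q i powr (1 - \<beta>) = r i * f i powr b"
          using fpow[OF i False, of "r i" \<beta>] rpos[OF i False] by (simp add: b_def flip: powr_add)
        ultimately show ?thesis by (simp add: algebra_simps)
      qed (use q0[OF i] in auto)
    qed
    also have "\<dots> = t' powr b * (sum r I - w) + t powr b * w"
      by (simp add: sum.distrib sum_subtractf w_def flip: sum_distrib_left)
    finally show ?thesis by (simp add: r1 b_def algebra_simps)
  qed
  show thesis
    by (rule that[of t' t w r]) (use t w s1 r r1 dist Alow Qup bnd \<tau>pos in \<open>auto simp: A_def t_def field_simps\<close>)
qed

text \<open>The ratio is read upside down as \<open>g = q / r\<close>, because the exponents of
  \<open>q\<close> are now positive and \<open>g\<close> may be 0. The smaller exponent is now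
  \<open>1 - \<beta>\<close>: the smoothed sum is linear in the weight and the original sum is
  bounded by convexity, the reverse of the case above 1. Taking logarithms and dividing by
  \<open>1 - \<beta>\<close> turns the last bound into an additive error
  \<open>log 2 C\<close>.\<close>

lemma power_sum_smoothing_lt1:
  fixes p q :: "'i \<Rightarrow> real"
  assumes fin: "finite I" and p: "\<And>i. i \<in> I \<Longrightarrow> 0 \<le> p i" and q: "\<And>i. i \<in> I \<Longrightarrow> 0 \<le> q i"
    and sums: "sum p I = 1" "sum q I = 1"
    and \<epsilon>: "0 < \<epsilon>" "\<epsilon> < (\<Sum>i\<in>I. max (p i - q i) 0)" and \<alpha>\<beta>: "0 \<le> \<alpha>" "\<alpha> < \<beta>" "\<beta> < 1"
    and C: "1 \<le> C" "\<And>s. 0 < s \<Longrightarrow> s + \<epsilon> \<le> 1 \<Longrightarrow>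
      s powr (\<alpha> / (1 - \<alpha>)) \<le> C * (s + \<epsilon>) powr (\<beta> / (1 - \<beta>))"
  obtains r where "\<And>i. i \<in> I \<Longrightarrow> 0 \<le> r i" "sum r I = 1" "(\<Sum>i\<in>I. \<bar>p i - r i\<bar>) = 2 * \<epsilon>"
    "(\<Sum>i\<in>I. p i powr \<alpha> * q i powr (1 - \<alpha>)) powr ((1 - \<beta>) / (1 - \<alpha>))
      \<le> C powr (1 - \<beta>) * (\<Sum>i\<in>I. r i powr \<beta> * q i powr (1 - \<beta>))"
proof -
  obtain r \<tau> \<tau>' where \<tau>: "0 \<le> \<tau>" "\<tau> < \<tau>'" and r: "\<And>i. i \<in> I \<Longrightarrow> 0 \<le> r i" and r1: "sum r I = 1"
    and bnd: "\<And>i. i \<in> I \<Longrightarrow> \<tau> * r i \<le> q i \<and> q i \<le> \<tau>' * r i"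
    and top: "\<And>i. i \<in> I \<Longrightarrow> r i < p i \<Longrightarrow> q i = \<tau> * r i"
    and bot: "\<And>i. i \<in> I \<Longrightarrow> p i < r i \<Longrightarrow> q i = \<tau>' * r i"
    and mass: "(\<Sum>i\<in>I. max (r i - p i) 0) = \<epsilon>" and dist: "(\<Sum>i\<in>I. \<bar>p i - r i\<bar>) = 2 * \<epsilon>"
    by (rule clamped_smoothing[OF fin p q sums \<epsilon>]) blast+
  have r0: "q i = 0" if "i \<in> I" "r i = 0" for i using bnd[OF that(1)] q[OF that(1)] that(2) by simp
  define g where "g i = q i / r i" for i
  have g: "\<tau> \<le> g i" "g i \<le> \<tau>'" if "i \<in> I" "r i \<noteq> 0" for i
    using bnd[OF that(1)] r[OF that(1)] that(2) by (auto simp: g_def field_simps)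
  define a b where "a = 1 - \<alpha>" and "b = 1 - \<beta>"
  have ab: "0 < b" "b < a" "a \<le> 1" "0 < a" "1 \<le> a / b" using \<alpha>\<beta> by (auto simp: a_def b_def)
  define \<Delta> where "\<Delta> = \<tau>' powr b - \<tau> powr b"
  have \<Delta>: "0 < \<Delta>" using \<tau> ab by (simp add: \<Delta>_def powr_less_mono2)
  \<comment> \<open>Now 1 on the raised entries and 0 on the lowered ones, so it is the smoothed
    mass \<open>w\<close> that exceeds \<open>s\<close> by \<open>\<epsilon>\<close>.\<close>
  define \<zeta> where "\<zeta> i = (if r i = 0 then 0 else (g i powr b - \<tau> powr b) / \<Delta>)" for i
  have \<zeta>01: "0 \<le> \<zeta> i" "\<zeta> i \<le> 1" if i: "i \<in> I" for i
    using g[OF i] \<tau> ab \<Delta> by (auto simp: \<zeta>_def \<Delta>_def intro!: powr_mono2 divide_nonneg_pos divide_le_eq_1_pos[THEN iffD2])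
  have gb: "g i powr b = \<tau> powr b + \<zeta> i * \<Delta>" if "r i \<noteq> 0" for i
    using that \<Delta> by (simp add: \<zeta>_def)
  have q_g: "q i powr c = r i powr c * g i powr c" if "i \<in> I" for i c
    using r0[OF that] r[OF that] q[OF that] by (cases "r i = 0") (auto simp: g_def powr_divide)
  define w where "w = (\<Sum>i\<in>I. \<zeta> i * r i)"
  define s where "s = (\<Sum>i\<in>I. \<zeta> i * p i)"
  have \<zeta>bot: "\<zeta> i = 1" if "i \<in> I" "p i < r i" for i
    using bot[OF that] p[OF that(1)] that(2) \<Delta> by (auto simp: \<zeta>_def g_def \<Delta>_def)
  have \<zeta>top: "\<zeta> i = 0" if "i \<in> I" "r i < p i" for i
    using top[OF that] by (auto simp: \<zeta>_def g_def)
  have ws: "w = s + \<epsilon>"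
    unfolding w_def s_def mass[symmetric] by (intro weighted_mass_shift \<zeta>top \<zeta>bot)
  have s0: "0 \<le> s" unfolding s_def using \<zeta>01 p by (intro sum_nonneg) auto
  have "w \<le> (\<Sum>i\<in>I. 1 * r i)" unfolding w_def using \<zeta>01 r by (intro sum_mono mult_right_mono) auto
  with r1 have w1: "w \<le> 1" by simp
  have w: "0 < w" using ws s0 \<epsilon> by simp
  define Q where "Q = (\<Sum>i\<in>I. r i powr \<beta> * q i powr b)"
  have "Q = (\<Sum>i\<in>I. \<tau> powr b * r i + \<Delta> * (\<zeta> i * r i))"
    unfolding Q_def
  proof (intro sum.cong refl)
    fix i assume i: "i \<in> I"
    show "r i powr \<beta> * q i powr b = \<tau> powr b * r i + \<Delta> * (\<zeta> i * r i)"
    proof (cases "r i = 0")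
      case False
      have "r i powr \<beta> * r i powr b = r i" using r[OF i] False by (simp add: b_def flip: powr_add)
      then have "r i powr \<beta> * q i powr b = r i * (\<tau> powr b + \<zeta> i * \<Delta>)"
        by (simp add: q_g[OF i] flip: gb[OF False] mult.assoc)
      then show ?thesis by (simp add: algebra_simps)
    qed simp
  qed
  also have "\<dots> = \<tau> powr b + \<Delta> * w" by (simp add: sum.distrib w_def r1 flip: sum_distrib_left)
  finally have Q: "Q = \<tau> powr b + \<Delta> * w" .
  define A where "A = (\<Sum>i\<in>I. p i powr \<alpha> * q i powr a)"
  \<comment> \<open>The weight of the upper threshold \<open>\<tau>'\<close> in the bound for
    \<open>A\<close>; Hoelder's inequality bounds it through the masses \<open>s\<close> and
    \<open>w\<close>.\<close>
  define \<nu> where "\<nu> = (\<Sum>i\<in>I. \<zeta> i * (p i powr \<alpha> * r i powr a))"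
  have "A \<le> (\<Sum>i\<in>I. \<tau> powr a * (p i powr \<alpha> * r i powr a - \<zeta> i * (p i powr \<alpha> * r i powr a))
      + \<tau>' powr a * (\<zeta> i * (p i powr \<alpha> * r i powr a)))"
    unfolding A_def
  proof (rule sum_mono)
    fix i assume i: "i \<in> I"
    show "p i powr \<alpha> * q i powr a \<le> \<tau> powr a * (p i powr \<alpha> * r i powr a - \<zeta> i * (p i powr \<alpha> * r i powr a))
      + \<tau>' powr a * (\<zeta> i * (p i powr \<alpha> * r i powr a))"
    proof (cases "r i = 0")
      case False
      have "g i powr a = (g i powr b) powr (a / b)" using ab by (simp add: powr_powr)
      also have "g i powr b = (1 - \<zeta> i) * \<tau> powr b + \<zeta> i * \<tau>' powr b"
        unfolding gb[OF False] by (simp add: \<Delta>_def algebra_simps)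
      also have "\<dots> powr (a / b) \<le> (1 - \<zeta> i) * (\<tau> powr b) powr (a / b) + \<zeta> i * (\<tau>' powr b) powr (a / b)"
        using \<zeta>01[OF i] ab by (intro powr_convex_comb) auto
      also have "\<dots> = (1 - \<zeta> i) * \<tau> powr a + \<zeta> i * \<tau>' powr a" using ab by (simp add: powr_powr)
      finally have "p i powr \<alpha> * r i powr a * g i powr a
          \<le> p i powr \<alpha> * r i powr a * ((1 - \<zeta> i) * \<tau> powr a + \<zeta> i * \<tau>' powr a)"
        by (intro mult_left_mono) auto
      then show ?thesis by (simp add: q_g[OF i] algebra_simps)
    qed (use r0[OF i] in auto)
  qed
  also have "\<dots> = \<tau> powr a * ((\<Sum>i\<in>I. p i powr \<alpha> * r i powr a) - \<nu>) + \<tau>' powr a * \<nu>"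
    by (simp add: sum.distrib sum_subtractf \<nu>_def flip: sum_distrib_left)
  also have "\<dots> \<le> \<tau> powr a * (1 - \<nu>) + \<tau>' powr a * \<nu>"
    using Hoelder_sum[of I p r \<alpha>] fin p r \<alpha>\<beta> sums r1
    by (intro add_right_mono mult_left_mono diff_right_mono) (auto simp: a_def)
  finally have A: "A \<le> (1 - \<nu>) * \<tau> powr a + \<nu> * \<tau>' powr a"
    by (simp add: mult.commute)
  have \<nu>0: "0 \<le> \<nu>" unfolding \<nu>_def using \<zeta>01 by (intro sum_nonneg) auto
  have "\<nu> = (\<Sum>i\<in>I. (\<zeta> i * p i) powr \<alpha> * (\<zeta> i * r i) powr (1 - \<alpha>))"
    unfolding \<nu>_def
  proof (intro sum.cong refl)
    fix i assume i: "i \<in> I"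
    have "\<zeta> i = \<zeta> i powr \<alpha> * \<zeta> i powr (1 - \<alpha>)"
      using \<zeta>01[OF i] by (cases "\<zeta> i = 0") (auto simp flip: powr_add)
    then show "\<zeta> i * (p i powr \<alpha> * r i powr a) = (\<zeta> i * p i) powr \<alpha> * (\<zeta> i * r i) powr (1 - \<alpha>)"
      using \<zeta>01[OF i] p[OF i] r[OF i] by (simp add: powr_mult a_def)
  qed
  also have "\<dots> \<le> s powr \<alpha> * w powr (1 - \<alpha>)"
    unfolding s_def w_def using \<zeta>01 p r fin \<alpha>\<beta> by (intro Hoelder_sum) auto
  finally have \<nu>: "\<nu> \<le> s powr \<alpha> * w powr a" by (simp add: a_def)
  have "s powr \<alpha> * w powr a \<le> 1 * 1"
    using s0 w w1 ws \<epsilon> \<alpha>\<beta> ab by (intro mult_mono powr_le1) auto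
  with \<nu> have \<nu>1: "\<nu> \<le> 1" by simp
  \<comment> \<open>The hypothesis on \<open>C\<close> covers only \<open>s > 0\<close>. At
    \<open>s = 0\<close> the left side is 0, even for \<open>\<alpha> = 0\<close>, since
    \<open>0 powr 0 = 0\<close>.\<close>
  have "s powr (\<alpha> / a) \<le> C * w powr (\<beta> / b)"
    using C(2)[of s] C(1) s0 ws w1 by (cases "s = 0") (auto simp: a_def b_def)
  then have "(s powr (\<alpha> / a)) powr b \<le> (C * w powr (\<beta> / b)) powr b"
    using ab by (intro powr_mono2) auto
  then have sw: "s powr (\<alpha> * b / a) \<le> C powr b * w powr \<beta>"
    using ab C(1) by (simp add: powr_powr powr_mult)
  \<comment> \<open>Hoelder's bound turns into a power of \<open>s\<close> times
    \<open>w powr b\<close>. The hypothesis on \<open>C\<close> trades the power of \<open>s\<close>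
    for \<open>w powr \<beta>\<close>, and \<open>\<beta> + b = 1\<close> leaves \<open>w\<close>,
    the coefficient of \<open>\<Delta>\<close> in \<open>Q\<close>.\<close>
  have "\<nu> powr (b / a) \<le> (s powr \<alpha> * w powr a) powr (b / a)"
    using \<nu> \<nu>0 ab by (intro powr_mono2) auto
  also have "\<dots> = s powr (\<alpha> * b / a) * w powr b" using ab by (simp add: powr_mult powr_powr)
  also have "\<dots> \<le> C powr b * w powr \<beta> * w powr b" using sw by (intro mult_right_mono) auto
  also have "\<dots> = C powr b * w" using w by (simp add: b_def mult.assoc flip: powr_add)
  finally have \<nu>w: "\<nu> powr (b / a) \<le> C powr b * w" .
  have Cb: "1 \<le> C powr b" using C(1) ab by (simp add: ge_one_powr_ge_zero)
  have A0: "0 \<le> A" by (simp add: A_def sum_nonneg)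
  have "A powr (b / a) \<le> ((1 - \<nu>) * \<tau> powr a + \<nu> * \<tau>' powr a) powr (b / a)"
    using A A0 ab by (intro powr_mono2) auto
  also have "\<dots> = ((1 - \<nu>) * (\<tau> powr b) powr (a / b) + \<nu> * (\<tau>' powr b) powr (a / b)) powr (1 / (a / b))"
    using ab by (simp add: powr_powr)
  also have "\<dots> \<le> \<tau> powr b + \<nu> powr (1 / (a / b)) * (\<tau>' powr b - \<tau> powr b)"
    using \<tau> \<nu>0 \<nu>1 ab by (intro powr_interpolation) (auto intro: powr_mono2)
  also have "\<dots> = \<tau> powr b + \<nu> powr (b / a) * \<Delta>" by (simp add: \<Delta>_def)
  also have "\<dots> \<le> C powr b * \<tau> powr b + (C powr b * w) * \<Delta>"
    using Cb \<nu>w \<Delta> mult_right_mono[OF Cb, of "\<tau> powr b"] by (intro add_mono mult_right_mono) auto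
  also have "\<dots> = C powr b * Q" by (simp add: Q algebra_simps)
  finally show thesis
    by (intro that[of r]) (use r r1 dist in \<open>auto simp: A_def Q_def a_def b_def\<close>)
qed

section \<open>Classical Renyi divergences\<close>

text \<open>Since \<open>0 powr 0 = 0\<close>, for \<open>a = 0\<close> this is the \<open>q\<close>-mass of the support of \<open>p\<close>, so order \<open>0\<close> needs
  no separate treatment.\<close>
definition power_sum :: "real \<Rightarrow> real vec \<Rightarrow> real vec \<Rightarrow> real" where
  "power_sum a p q = (\<Sum>x<dim_vec p. (p $ x) powr a * (q $ x) powr (1 - a))"

lemma prob_vecsD:
  assumes "p \<in> prob_vecs d"
  shows "dim_vec p = d" "\<And>x. x < d \<Longrightarrow> 0 \<le> p $ x" "(\<Sum>x<d. p $ x) = 1"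
  using assms by (auto simp: prob_vecs_def)

lemma mem_supp_vec:
  assumes "p \<in> prob_vecs d"
  shows "x \<in> supp_vec p \<longleftrightarrow> x < d \<and> 0 < p $ x"
  using prob_vecsD[OF assms] by (force simp: supp_vec_def)

lemma sum_supp_vec:
  assumes "p \<in> prob_vecs d" and "\<And>x. x < d \<Longrightarrow> p $ x = 0 \<Longrightarrow> f x = 0"
  shows "(\<Sum>x\<in>supp_vec p. f x) = (\<Sum>x<d. f x)"
  using assms(2) prob_vecsD(1)[OF assms(1)]
  by (intro sum.mono_neutral_left) (auto simp: supp_vec_def)

lemma finite_supp_vec [simp]: "finite (supp_vec p)"
  by (simp add: supp_vec_def)

lemma sum_supp_vec_1:
  assumes "p \<in> prob_vecs d"
  shows "(\<Sum>x\<in>supp_vec p. p $ x) = 1"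
  using sum_supp_vec[OF assms, of "\<lambda>x. p $ x"] prob_vecsD(3)[OF assms] by simp

lemma supp_vec_nonempty:
  assumes "p \<in> prob_vecs d"
  shows "supp_vec p \<noteq> {}"
  using sum_supp_vec_1[OF assms] by auto

lemma renyi_div_lt1:
  assumes "p \<in> prob_vecs d" "q \<in> prob_vecs d" "a < 1"
  shows "renyi_div (ereal a) p q =
    (if supp_vec p \<inter> supp_vec q = {} then \<infinity> else ereal (1 / (a - 1) * log 2 (power_sum a p q)))"
proof (cases "a = 0")
  case True
  have "(\<Sum>x\<in>supp_vec p. q $ x) = (\<Sum>x\<in>supp_vec p. (p $ x) powr 0 * (q $ x) powr 1)"
    using mem_supp_vec[OF assms(1)] prob_vecsD(2)[OF assms(2)] by (intro sum.cong) auto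
  also have "\<dots> = power_sum 0 p q"
    using prob_vecsD(1)[OF assms(1)] by (simp add: power_sum_def sum_supp_vec[OF assms(1)])
  finally show ?thesis using True by (simp add: renyi_div_def flip: zero_ereal_def)
next
  case False
  with assms show ?thesis by (simp add: renyi_div_def power_sum_def)
qed

lemma renyi_div_gt1:
  assumes "1 < a"
  shows "renyi_div (ereal a) p q =
    (if supp_vec p \<subseteq> supp_vec q then ereal (1 / (a - 1) * log 2 (power_sum a p q)) else \<infinity>)"
  using assms by (simp add: renyi_div_def power_sum_def)

lemma power_sum_pos:
  assumes "p \<in> prob_vecs d" "q \<in> prob_vecs d" "supp_vec p \<inter> supp_vec q \<noteq> {}"
  shows "0 < power_sum a p q"
proof -
  obtain x where x: "x < d" "0 < p $ x" "0 < q $ x"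
    using assms(3) mem_supp_vec[OF assms(1)] mem_supp_vec[OF assms(2)] by blast
  then show ?thesis
    unfolding power_sum_def prob_vecsD(1)[OF assms(1)]
    by (intro sum_pos2[of _ x]) auto
qed

lemma supp_subset_imp_Int:
  assumes "p \<in> prob_vecs d" "supp_vec p \<subseteq> supp_vec q"
  shows "supp_vec p \<inter> supp_vec q \<noteq> {}"
  using assms(2) supp_vec_nonempty[OF assms(1)] by blast

text \<open>An expectation under \<open>p\<close> of a power of the likelihood ratio, the form to
  which Jensen's inequality applies.\<close>

lemma power_sum_eq_ratio:
  assumes p: "p \<in> prob_vecs d" and q: "q \<in> prob_vecs d" and supp: "supp_vec p \<subseteq> supp_vec q"
  shows "power_sum a p q = (\<Sum>x\<in>supp_vec p. p $ x * (p $ x / q $ x) powr (a - 1))"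
proof -
  have "power_sum a p q = (\<Sum>x\<in>supp_vec p. (p $ x) powr a * (q $ x) powr (1 - a))"
    unfolding power_sum_def prob_vecsD(1)[OF p] by (intro sum_supp_vec[OF p, symmetric]) auto
  also have "\<dots> = (\<Sum>x\<in>supp_vec p. p $ x * (p $ x / q $ x) powr (a - 1))"
  proof (intro sum.cong refl)
    fix x assume "x \<in> supp_vec p"
    with supp have x: "0 < p $ x" "0 < q $ x" using mem_supp_vec[OF p] mem_supp_vec[OF q] by auto
    then have "(p $ x) powr a = p $ x * (p $ x) powr (a - 1)" by (simp add: powr_diff)
    moreover have "(q $ x) powr (1 - a) = 1 / (q $ x) powr (a - 1)"
      using powr_minus_divide[of "q $ x" "a - 1"] by simp
    ultimately show "(p $ x) powr a * (q $ x) powr (1 - a) = p $ x * (p $ x / q $ x) powr (a - 1)"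
      using x by (simp add: powr_divide)
  qed
  finally show ?thesis .
qed

text \<open>Jensen's inequality for the logarithm, from its tangent at the mean
  \<open>Y\<close>.\<close>

lemma sum_log_le_log_sum:
  fixes p y :: "'i \<Rightarrow> real"
  assumes "finite S" "\<And>i. i \<in> S \<Longrightarrow> 0 < p i" "\<And>i. i \<in> S \<Longrightarrow> 0 < y i" "sum p S = 1"
  shows "(\<Sum>i\<in>S. p i * log 2 (y i)) \<le> log 2 (\<Sum>i\<in>S. p i * y i)"
proof -
  define Y where "Y = (\<Sum>i\<in>S. p i * y i)"
  have "S \<noteq> {}" using assms(4) by auto
  then have Y: "0 < Y" unfolding Y_def using assms by (intro sum_pos) auto
  have "(\<Sum>i\<in>S. p i * ln (y i / Y)) \<le> (\<Sum>i\<in>S. p i * (y i / Y - 1))"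
    using assms Y by (intro sum_mono mult_left_mono ln_le_minus_one) (auto intro: less_imp_le)
  also have "\<dots> = (\<Sum>i\<in>S. p i * y i) / Y - sum p S"
    by (simp add: right_diff_distrib sum_subtractf sum_divide_distrib)
  also have "\<dots> = 0" using Y assms(4) by (simp flip: Y_def)
  finally have "(\<Sum>i\<in>S. p i * ln (y i / Y)) \<le> 0" .
  moreover have "(\<Sum>i\<in>S. p i * ln (y i / Y)) = (\<Sum>i\<in>S. p i * ln (y i) - ln Y * p i)"
  proof (intro sum.cong refl)
    fix i assume "i \<in> S"
    with assms(3) have "0 < y i" by blast
    then show "p i * ln (y i / Y) = p i * ln (y i) - ln Y * p i"
      using Y by (simp add: ln_div algebra_simps)
  qed
  moreover have "\<dots> = (\<Sum>i\<in>S. p i * ln (y i)) - ln Y"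
    using assms(4) by (simp add: sum_subtractf flip: sum_distrib_left)
  ultimately have "(\<Sum>i\<in>S. p i * ln (y i)) / ln 2 \<le> ln Y / ln 2"
    by (intro divide_right_mono) auto
  then show ?thesis by (simp add: log_def sum_divide_distrib Y_def)
qed

section \<open>Monotonicity in the order\<close>

text \<open>Jensen's inequality with exponent \<open>(1 - b) / (1 - a)\<close>. The ratio is taken
  as \<open>q / p\<close>, since \<open>q\<close> may vanish on the support of \<open>p\<close> when
  the order is below 1.\<close>

lemma renyi_div_mono_lt1:
  assumes p: "p \<in> prob_vecs d" and q: "q \<in> prob_vecs d" and ba: "0 \<le> b" "b < a" "a < 1"
  shows "renyi_div (ereal b) p q \<le> renyi_div (ereal a) p q"
proof (cases "supp_vec p \<inter> supp_vec q = {}")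
  case True
  then show ?thesis using assms by (simp add: renyi_div_lt1)
next
  case False
  define k where "k = (1 - b) / (1 - a)"
  have k: "1 \<le> k" using ba by (simp add: k_def field_simps)
  have pos: "0 < power_sum a p q" "0 < power_sum b p q" using power_sum_pos[OF p q False] by auto
  let ?y = "\<lambda>x. (q $ x / p $ x) powr (1 - a)"
  have rew: "(p $ x) powr c * (q $ x) powr (1 - c) = p $ x * (q $ x / p $ x) powr (1 - c)" if "x < d" for x c
    using prob_vecsD(2)[OF p that] prob_vecsD(2)[OF q that] powr_add[of "p $ x" c "1 - c"]
    by (cases "p $ x = 0") (auto simp: powr_divide field_simps)
  have "power_sum a p q powr k = (\<Sum>x<d. p $ x * ?y x) powr k"
    unfolding power_sum_def prob_vecsD(1)[OF p] by (intro arg_cong2[where f = "(powr)"] sum.cong rew) auto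
  also have "\<dots> \<le> (\<Sum>x<d. p $ x * ?y x powr k)"
    using prob_vecsD[OF p] k by (intro Jensen_powr_sum) auto
  also have "\<dots> = power_sum b p q"
    unfolding power_sum_def prob_vecsD(1)[OF p] using ba
    by (intro sum.cong refl, subst rew) (auto simp: powr_powr k_def)
  finally have "log 2 (power_sum a p q powr k) \<le> log 2 (power_sum b p q)"
    using pos by simp
  then have "k * log 2 (power_sum a p q) \<le> log 2 (power_sum b p q)"
    using pos by (simp add: log_powr)
  then show ?thesis
    using False ba by (simp add: renyi_div_lt1[OF p q] k_def field_simps)
qed

text \<open>Jensen's inequality for the logarithm bounds \<open>(b - 1)\<close> times the
  Kullback-Leibler divergence by the logarithm of the power sum; division by the negative
  \<open>b - 1\<close> reverses it. The positive factor \<open>a - 1\<close> gives the opposite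
  comparison above order 1.\<close>

lemma renyi_div_lt1_le_KL:
  assumes p: "p \<in> prob_vecs d" and q: "q \<in> prob_vecs d" and b: "0 \<le> b" "b < 1"
  shows "renyi_div (ereal b) p q \<le> renyi_div 1 p q"
proof (cases "supp_vec p \<subseteq> supp_vec q")
  case True
  note pos = power_sum_pos[OF p q supp_subset_imp_Int[OF p True], of b]
  have r: "0 < p $ x" "0 < q $ x" if "x \<in> supp_vec p" for x
    using that True mem_supp_vec[OF p] mem_supp_vec[OF q] by auto
  have "(\<Sum>x\<in>supp_vec p. p $ x * log 2 ((p $ x / q $ x) powr (b - 1))) \<le> log 2 (power_sum b p q)"
    unfolding power_sum_eq_ratio[OF p q True]
    using sum_supp_vec_1[OF p] r by (intro sum_log_le_log_sum) (force simp: divide_eq_0_iff)+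
  also have "(\<Sum>x\<in>supp_vec p. p $ x * log 2 ((p $ x / q $ x) powr (b - 1)))
      = (b - 1) * (\<Sum>x\<in>supp_vec p. p $ x * log 2 (p $ x / q $ x))"
    unfolding sum_distrib_left using r by (intro sum.cong refl) (force simp: log_powr)
  finally show ?thesis
    using True b supp_subset_imp_Int[OF p True]
    by (simp add: renyi_div_lt1[OF p q] renyi_div_def[of 1] field_simps)
qed (simp add: renyi_div_def[of 1])

lemma KL_le_renyi_div_gt1:
  assumes p: "p \<in> prob_vecs d" and q: "q \<in> prob_vecs d" and a: "1 < a"
  shows "renyi_div 1 p q \<le> renyi_div (ereal a) p q"
proof (cases "supp_vec p \<subseteq> supp_vec q")
  case True
  have r: "0 < p $ x" "0 < q $ x" if "x \<in> supp_vec p" for x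
    using that True mem_supp_vec[OF p] mem_supp_vec[OF q] by auto
  have "(\<Sum>x\<in>supp_vec p. p $ x * log 2 ((p $ x / q $ x) powr (a - 1))) \<le> log 2 (power_sum a p q)"
    unfolding power_sum_eq_ratio[OF p q True]
    using sum_supp_vec_1[OF p] r by (intro sum_log_le_log_sum) (force simp: divide_eq_0_iff)+
  also have "(\<Sum>x\<in>supp_vec p. p $ x * log 2 ((p $ x / q $ x) powr (a - 1)))
      = (a - 1) * (\<Sum>x\<in>supp_vec p. p $ x * log 2 (p $ x / q $ x))"
    unfolding sum_distrib_left using r by (intro sum.cong refl) (force simp: log_powr)
  finally show ?thesis
    using True a by (simp add: renyi_div_gt1 renyi_div_def[of 1] field_simps)
qed (use a in \<open>simp add: renyi_div_gt1\<close>)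

lemma renyi_div_mono_gt1:
  assumes p: "p \<in> prob_vecs d" and q: "q \<in> prob_vecs d" and ba: "1 < b" "b < a"
  shows "renyi_div (ereal b) p q \<le> renyi_div (ereal a) p q"
proof (cases "supp_vec p \<subseteq> supp_vec q")
  case True
  define k where "k = (a - 1) / (b - 1)"
  have k: "1 \<le> k" using ba by (simp add: k_def field_simps)
  note pos = power_sum_pos[OF p q supp_subset_imp_Int[OF p True]]
  have "power_sum b p q powr k \<le> (\<Sum>x\<in>supp_vec p. p $ x * ((p $ x / q $ x) powr (b - 1)) powr k)"
    unfolding power_sum_eq_ratio[OF p q True]
    using sum_supp_vec_1[OF p] mem_supp_vec[OF p] k by (intro Jensen_powr_sum) auto
  also have "\<dots> = power_sum a p q"
    unfolding power_sum_eq_ratio[OF p q True] using ba by (simp add: powr_powr k_def)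
  finally have "log 2 (power_sum b p q powr k) \<le> log 2 (power_sum a p q)"
    using pos[of a] pos[of b] by simp
  then have "k * log 2 (power_sum b p q) \<le> log 2 (power_sum a p q)"
    using pos[of b] by (simp add: log_powr)
  then show ?thesis
    using True ba by (simp add: renyi_div_gt1 k_def field_simps)
qed (use ba in \<open>simp add: renyi_div_gt1\<close>)

lemma renyi_div_le_Dmax:
  assumes p: "p \<in> prob_vecs d" and q: "q \<in> prob_vecs d" and b: "1 \<le> b"
  shows "renyi_div (ereal b) p q \<le> renyi_div \<infinity> p q"
proof (cases "supp_vec p \<subseteq> supp_vec q")
  case True
  define M where "M = Max ((\<lambda>x. p $ x / q $ x) ` supp_vec p)"
  have r: "0 < p $ x / q $ x" "p $ x / q $ x \<le> M" "0 < p $ x" if "x \<in> supp_vec p" for x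
    using that True mem_supp_vec[OF p] mem_supp_vec[OF q] by (auto simp: M_def)
  obtain x where "x \<in> supp_vec p" using supp_vec_nonempty[OF p] by auto
  with r[of x] have M: "0 < M" by auto
  show ?thesis
  proof (cases "b = 1")
    case True
    have "(\<Sum>x\<in>supp_vec p. p $ x * log 2 (p $ x / q $ x)) \<le> (\<Sum>x\<in>supp_vec p. p $ x * log 2 M)"
      using r M by (intro sum_mono mult_left_mono) (auto intro!: less_imp_le)
    also have "\<dots> = log 2 M" using sum_supp_vec_1[OF p] by (simp flip: sum_distrib_right)
    finally show ?thesis
      using True \<open>supp_vec p \<subseteq> supp_vec q\<close> by (simp add: renyi_div_def M_def flip: one_ereal_def)
  next
    case False
    with b have b: "1 < b" by simp
    note pos = power_sum_pos[OF p q supp_subset_imp_Int[OF p True], of b]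
    have "power_sum b p q \<le> (\<Sum>x\<in>supp_vec p. p $ x * M powr (b - 1))"
      unfolding power_sum_eq_ratio[OF p q True]
      using r b by (intro sum_mono mult_left_mono powr_mono2) (auto intro!: less_imp_le)
    also have "\<dots> = M powr (b - 1)" using sum_supp_vec_1[OF p] by (simp flip: sum_distrib_right)
    finally have "log 2 (power_sum b p q) \<le> log 2 (M powr (b - 1))" using pos M by simp
    then have "log 2 (power_sum b p q) \<le> (b - 1) * log 2 M" using M by (simp add: log_powr)
    then show ?thesis using True b by (simp add: renyi_div_gt1 renyi_div_def[of \<infinity>] M_def field_simps)
  qed
qed (simp add: renyi_div_def[of \<infinity>])

lemma renyi_div_mono:
  assumes p: "p \<in> prob_vecs d" and q: "q \<in> prob_vecs d" and "0 \<le> \<beta>" "\<beta> \<le> \<alpha>"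
  shows "renyi_div \<beta> p q \<le> renyi_div \<alpha> p q"
proof -
  have fin: "renyi_div (ereal b) p q \<le> renyi_div (ereal a) p q" if ba: "0 \<le> b" "b < a" for a b
  proof -
    consider "a < 1" | "b < 1" "a = 1" | "b < 1" "1 < a" | "b = 1" | "1 < b" using ba by linarith
    then show ?thesis
    proof cases
      case 1 then show ?thesis using renyi_div_mono_lt1[OF p q] ba by blast
    next
      case 2 then show ?thesis using renyi_div_lt1_le_KL[OF p q] ba by (simp flip: one_ereal_def)
    next
      case 3 then show ?thesis
        using renyi_div_lt1_le_KL[OF p q ba(1)] KL_le_renyi_div_gt1[OF p q] order_trans by blast
    next
      case 4 then show ?thesis using KL_le_renyi_div_gt1[OF p q] ba by (simp flip: one_ereal_def)
    next
      case 5 then show ?thesis using renyi_div_mono_gt1[OF p q] ba by blast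
    qed
  qed
  have inf: "renyi_div (ereal b) p q \<le> renyi_div \<infinity> p q" if "0 \<le> b" for b
  proof (cases "1 \<le> b")
    case True then show ?thesis by (rule renyi_div_le_Dmax[OF p q])
  next
    case False
    then show ?thesis
      using renyi_div_lt1_le_KL[OF p q that] renyi_div_le_Dmax[OF p q order_refl] order_trans
      by (fastforce simp flip: one_ereal_def)
  qed
  show ?thesis
    using assms(3,4) fin inf
    by (cases "\<beta> = \<alpha>"; cases \<beta>; cases \<alpha>) (auto simp: order_le_less)
qed

text \<open>By monotonicity order 0 is enough, where the claim is that the \<open>q\<close>-mass of
  the support of \<open>p\<close> is at most 1.\<close>

lemma renyi_div_nonneg:
  assumes p: "p \<in> prob_vecs d" and q: "q \<in> prob_vecs d" and "0 \<le> \<alpha>"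
  shows "0 \<le> renyi_div \<alpha> p q"
proof -
  have "0 \<le> renyi_div 0 p q"
  proof (cases "supp_vec p \<inter> supp_vec q = {}")
    case False
    then obtain x where x: "x \<in> supp_vec p" "x \<in> supp_vec q" by auto
    have q0: "0 \<le> q $ x" if "x \<in> supp_vec p" for x
      using that mem_supp_vec[OF p] prob_vecsD(2)[OF q] by auto
    have "0 < (\<Sum>x\<in>supp_vec p. q $ x)"
      using x q0 mem_supp_vec[OF q] by (intro sum_pos2[of _ x]) auto
    moreover have "(\<Sum>x\<in>supp_vec p. q $ x) \<le> (\<Sum>x<d. q $ x)"
      using mem_supp_vec[OF p] prob_vecsD[OF q] by (intro sum_mono2) auto
    ultimately have "log 2 (\<Sum>x\<in>supp_vec p. q $ x) \<le> 0" using prob_vecsD(3)[OF q] by simp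
    then show ?thesis using False by (simp add: renyi_div_def)
  qed (simp add: renyi_div_def)
  also have "\<dots> \<le> renyi_div \<alpha> p q" using assms by (intro renyi_div_mono) auto
  finally show ?thesis .
qed

lemma renyi_div_self:
  assumes q: "q \<in> prob_vecs d" and "0 \<le> \<alpha>"
  shows "renyi_div \<alpha> q q = 0"
proof (rule antisym)
  have "renyi_div \<alpha> q q \<le> renyi_div \<infinity> q q" using assms by (intro renyi_div_mono) auto
  also have "(\<lambda>x. q $ x / q $ x) ` supp_vec q = {1}"
    using supp_vec_nonempty[OF q] by (auto simp: supp_vec_def)
  then have "renyi_div \<infinity> q q = 0" by (simp add: renyi_div_def zero_ereal_def)
  finally show "renyi_div \<alpha> q q \<le> 0" .
qed (use assms in \<open>simp add: renyi_div_nonneg\<close>)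

section \<open>Upper bounds for the smoothed divergence\<close>

lemma smoothed_leI:
  assumes "r \<in> prob_ball \<epsilon> p" "D r q \<le> X"
  shows "smoothed \<epsilon> D p q \<le> X"
  using assms unfolding smoothed_def by (rule INF_lower2)

lemma vec_mem_prob_ball:
  assumes p: "p \<in> prob_vecs d" and r: "\<And>i. i < d \<Longrightarrow> 0 \<le> r i" "(\<Sum>i<d. r i) = 1"
    and dist: "(\<Sum>i<d. \<bar>p $ i - r i\<bar>) \<le> 2 * \<epsilon>"
  shows "vec d r \<in> prob_vecs d" "vec d r \<in> prob_ball \<epsilon> p"
  using assms by (auto simp: prob_ball_def prob_vecs_def)

lemma self_mem_prob_ball:
  assumes "p \<in> prob_vecs d" "0 \<le> \<epsilon>"
  shows "p \<in> prob_ball \<epsilon> p"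
  using assms by (auto simp: prob_ball_def prob_vecs_def)

text \<open>Here \<open>q\<close> belongs to the ball and has divergence 0 from itself. This leaves
  the distances above \<open>\<epsilon>\<close> that the clamping requires.\<close>

lemma smoothed_le_of_close:
  assumes p: "p \<in> prob_vecs d" and q: "q \<in> prob_vecs d" and "0 \<le> \<alpha>" "0 \<le> \<beta>" "0 \<le> c"
    and tv: "(\<Sum>i<d. max (p $ i - q $ i) 0) \<le> \<epsilon>"
  shows "smoothed \<epsilon> (renyi_div \<beta>) p q \<le> renyi_div \<alpha> p q + ereal c"
proof (rule smoothed_leI)
  have "(\<Sum>i<d. \<bar>p $ i - q $ i\<bar>) = (\<Sum>i<d. 2 * max (p $ i - q $ i) 0 - p $ i + q $ i)"
    by (intro sum.cong) (auto simp: max_def)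
  also have "\<dots> \<le> 2 * \<epsilon>"
    using tv prob_vecsD[OF p] prob_vecsD[OF q]
    by (simp add: sum.distrib sum_subtractf flip: sum_distrib_left)
  finally show "q \<in> prob_ball \<epsilon> p" using p q by (auto simp: prob_ball_def prob_vecs_def)
  have "(0 :: ereal) \<le> ereal c" using assms by simp
  then show "renyi_div \<beta> q q \<le> renyi_div \<alpha> p q + ereal c"
    using renyi_div_self[OF q] renyi_div_nonneg[OF p q] assms by (simp add: add_nonneg_nonneg)
qed

lemma smoothed_renyi_div_lt1_le:
  assumes p: "p \<in> prob_vecs d" and q: "q \<in> prob_vecs d" and ab: "0 \<le> a" "a < b" "b < 1"
    and \<epsilon>: "0 < \<epsilon>" and c: "0 \<le> c" "\<And>s. 0 < s \<Longrightarrow> s + \<epsilon> \<le> 1 \<Longrightarrow>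
      s powr (a / (1 - a)) \<le> 2 powr c * (s + \<epsilon>) powr (b / (1 - b))"
  shows "smoothed \<epsilon> (renyi_div (ereal b)) p q \<le> renyi_div (ereal a) p q + ereal c"
proof -
  consider "supp_vec p \<inter> supp_vec q = {}" | "(\<Sum>i<d. max (p $ i - q $ i) 0) \<le> \<epsilon>"
    | "supp_vec p \<inter> supp_vec q \<noteq> {}" "\<epsilon> < (\<Sum>i<d. max (p $ i - q $ i) 0)"
    by linarith
  then show ?thesis
  proof cases
    case 1
    then show ?thesis using ab by (simp add: renyi_div_lt1[OF p q])
  next
    case 2
    then show ?thesis using assms by (intro smoothed_le_of_close) auto
  next
    case 3
    have C: "1 \<le> 2 powr c" using c by (simp add: ge_one_powr_ge_zero)
    obtain r where r: "\<And>i. i \<in> {..<d} \<Longrightarrow> 0 \<le> r i" "sum r {..<d} = 1"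
      "(\<Sum>i<d. \<bar>p $ i - r i\<bar>) = 2 * \<epsilon>"
      and le: "(\<Sum>i<d. p $ i powr a * q $ i powr (1 - a)) powr ((1 - b) / (1 - a))
        \<le> (2 powr c) powr (1 - b) * (\<Sum>i<d. r i powr b * q $ i powr (1 - b))"
      by (rule power_sum_smoothing_lt1[of "{..<d}" "\<lambda>i. p $ i" "\<lambda>i. q $ i" \<epsilon> a b "2 powr c"])
        (use prob_vecsD[OF p] prob_vecsD[OF q] 3 \<epsilon> ab C c in \<open>auto\<close>)
    define R where "R = vec d r"
    have R: "R \<in> prob_vecs d" "R \<in> prob_ball \<epsilon> p"
      unfolding R_def using r by (auto intro!: vec_mem_prob_ball[OF p])
    have A: "0 < power_sum a p q" using power_sum_pos[OF p q 3(1)] .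
    have le: "power_sum a p q powr ((1 - b) / (1 - a)) \<le> 2 powr (c * (1 - b)) * power_sum b R q"
      using le by (simp add: power_sum_def R_def prob_vecsD(1)[OF p] powr_powr)
    have "0 < 2 powr (c * (1 - b)) * power_sum b R q"
      by (rule less_le_trans[OF _ le]) (use A in auto)
    then have Q: "0 < power_sum b R q" by (simp add: zero_less_mult_iff)
    \<comment> \<open>Below order 1 disjoint supports would give \<open>\<infinity>\<close>; the
      positivity of the power sum, forced by \<open>le\<close>, excludes them.\<close>
    have int: "supp_vec R \<inter> supp_vec q \<noteq> {}"
    proof
      assume "supp_vec R \<inter> supp_vec q = {}"
      then have "R $ x powr b * q $ x powr (1 - b) = 0" if "x < d" for x
        using that prob_vecsD(1)[OF R(1)] prob_vecsD(1)[OF q] by (auto simp: supp_vec_def)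
      then have "power_sum b R q = 0"
        unfolding power_sum_def prob_vecsD(1)[OF R(1)] by (intro sum.neutral) auto
      with Q show False by simp
    qed
    have "log 2 (power_sum a p q powr ((1 - b) / (1 - a))) \<le> log 2 (2 powr (c * (1 - b)) * power_sum b R q)"
      using le A Q by simp
    then have "(1 - b) / (1 - a) * log 2 (power_sum a p q) \<le> c * (1 - b) + log 2 (power_sum b R q)"
      using A Q by (simp add: log_powr log_mult)
    then have "((1 - b) / (1 - a) * log 2 (power_sum a p q)) / (1 - b)
        \<le> (c * (1 - b) + log 2 (power_sum b R q)) / (1 - b)"
      using ab by (intro divide_right_mono) auto
    then have "1 / (b - 1) * log 2 (power_sum b R q) \<le> 1 / (a - 1) * log 2 (power_sum a p q) + c"
      using ab minus_divide_right[of "log 2 (power_sum b R q)" "1 - b"]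
        minus_divide_right[of "log 2 (power_sum a p q)" "1 - a"]
      by (simp add: add_divide_distrib)
    then show ?thesis
      using 3 ab int by (intro smoothed_leI[OF R(2)]) (simp add: renyi_div_lt1[OF p q] renyi_div_lt1[OF R(1) q])
  qed
qed

text \<open>\<open>B\<close> is chosen so that \<open>(B - 1) * (a - 1)\<close> is the exponent
  \<open>(a - 1) / (b - 1)\<close> of the root taken of the order-\<open>b\<close> sum. Its limit 1
  makes this exponent 0 at order \<open>\<infinity>\<close>.\<close>

lemma smoothed_renyi_div_gt1_le:
  assumes p: "p \<in> prob_vecs d" and q: "q \<in> prob_vecs d" and a: "1 < a" "ereal a < \<beta>"
    and \<epsilon>: "0 < \<epsilon>" and c: "0 \<le> c"
    and B: "B = (if \<beta> = \<infinity> then 1 else real_of_ereal \<beta> / (real_of_ereal \<beta> - 1))"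
    and hyp: "\<And>w. 0 < w \<Longrightarrow> w + \<epsilon> \<le> 1 \<Longrightarrow> w powr B \<le> 2 powr c * (w + \<epsilon>) powr (a / (a - 1))"
  shows "smoothed \<epsilon> (renyi_div \<beta>) p q \<le> renyi_div (ereal a) p q + ereal c"
proof -
  consider "\<not> supp_vec p \<subseteq> supp_vec q" | "(\<Sum>i<d. max (p $ i - q $ i) 0) \<le> \<epsilon>"
    | "supp_vec p \<subseteq> supp_vec q" "\<epsilon> < (\<Sum>i<d. max (p $ i - q $ i) 0)"
    by linarith
  then show ?thesis
  proof cases
    case 1
    then show ?thesis using a by (simp add: renyi_div_gt1)
  next
    case 2
    have "0 \<le> \<beta>" using a by (cases \<beta>) auto
    then show ?thesis using 2 assms by (intro smoothed_le_of_close) auto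
  next
    case 3
    have supp: "p $ i = 0" if "i < d" "q $ i = 0" for i
      using 3(1) that prob_vecsD(1)[OF p] by (auto simp: supp_vec_def)
    obtain r t t' w where t: "0 < t'" "t' < t" and w: "0 < w" "w + \<epsilon> \<le> 1"
      and r: "\<And>i. i \<in> {..<d} \<Longrightarrow> 0 \<le> r i" "sum r {..<d} = 1"
        "(\<Sum>i<d. \<bar>p $ i - r i\<bar>) = 2 * \<epsilon>"
      and rt: "\<And>i. i \<in> {..<d} \<Longrightarrow> r i \<le> t * q $ i"
      and A: "(t powr (a - 1) - t' powr (a - 1)) * ((w + \<epsilon>) powr a * w powr (1 - a)) + t' powr (a - 1)
        \<le> (\<Sum>i<d. p $ i powr a * q $ i powr (1 - a))"
      and Q: "\<And>b. a \<le> b \<Longrightarrow>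
        (\<Sum>i<d. r i powr b * q $ i powr (1 - b)) \<le> (1 - w) * t' powr (b - 1) + w * t powr (b - 1)"
      by (rule power_sum_smoothing_gt1[of "{..<d}" "\<lambda>i. p $ i" "\<lambda>i. q $ i" \<epsilon> a])
        (use prob_vecsD[OF p] prob_vecsD[OF q] supp 3 \<epsilon> a in \<open>auto\<close>)
    define R where "R = vec d r"
    have R: "R \<in> prob_vecs d" "R \<in> prob_ball \<epsilon> p"
      unfolding R_def using r by (auto intro!: vec_mem_prob_ball[OF p])
    have suppR: "supp_vec R \<subseteq> supp_vec q"
      using r(1) rt prob_vecsD(1)[OF q] by (force simp: supp_vec_def R_def)
    have Apos: "0 < power_sum a p q" using power_sum_pos[OF p q supp_subset_imp_Int[OF p 3(1)]] .
    define K where "K = 2 powr (c * (a - 1))"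
    define S where "S = (w + \<epsilon>) powr a * w powr (1 - a)"
    define \<Delta> where "\<Delta> = t powr (a - 1) - t' powr (a - 1)"
    have \<Delta>: "0 \<le> \<Delta>" using t a by (auto simp: \<Delta>_def intro!: powr_mono2)
    have K: "1 \<le> K" using c a by (simp add: K_def ge_one_powr_ge_zero)
    have "(w powr B) powr (a - 1) \<le> (2 powr c * (w + \<epsilon>) powr (a / (a - 1))) powr (a - 1)"
      using a by (intro powr_mono2 hyp w) auto
    then have "w powr (B * (a - 1)) \<le> K * (w + \<epsilon>) powr a"
      using a by (simp add: K_def powr_powr powr_mult)
    then have "w powr (B * (a - 1)) * w powr (1 - a) \<le> K * (w + \<epsilon>) powr a * w powr (1 - a)"
      by (intro mult_right_mono) auto
    then have wB: "w powr ((B - 1) * (a - 1)) \<le> K * S"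
      by (simp add: S_def algebra_simps flip: powr_add)
    \<comment> \<open>This serves both cases: for finite \<open>\<beta>\<close> the left side is the
      interpolation bound for the root of the smoothed power sum, and for
      \<open>\<beta> = \<infinity>\<close> it equals \<open>t powr (a - 1)\<close>.\<close>
    have KA: "t' powr (a - 1) + w powr ((B - 1) * (a - 1)) * \<Delta> \<le> K * power_sum a p q"
    proof -
      have "1 * t' powr (a - 1) + w powr ((B - 1) * (a - 1)) * \<Delta> \<le> K * t' powr (a - 1) + (K * S) * \<Delta>"
        using K wB \<Delta> by (intro add_mono mult_right_mono) auto
      also have "\<dots> = K * (\<Delta> * S + t' powr (a - 1))" by (simp add: algebra_simps)
      also have "\<dots> \<le> K * power_sum a p q"
        using K A by (intro mult_left_mono) (auto simp: \<Delta>_def S_def power_sum_def prob_vecsD(1)[OF p])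
      finally show ?thesis by simp
    qed
    have "renyi_div \<beta> R q \<le> ereal (1 / (a - 1) * log 2 (power_sum a p q) + c)"
    proof (cases "\<beta> = \<infinity>")
      case True
      have "t powr (a - 1) \<le> K * power_sum a p q"
        using KA True w by (simp add: B \<Delta>_def)
      then have "log 2 (t powr (a - 1)) \<le> log 2 (K * power_sum a p q)"
        using t Apos K by simp
      then have "(a - 1) * log 2 t \<le> c * (a - 1) + log 2 (power_sum a p q)"
        using t Apos K by (simp add: log_powr log_mult K_def)
      then have logt: "log 2 t \<le> 1 / (a - 1) * log 2 (power_sum a p q) + c"
        using a by (simp add: field_simps)
      define M where "M = Max ((\<lambda>x. R $ x / q $ x) ` supp_vec R)"
      have rat: "0 < R $ x / q $ x \<and> R $ x / q $ x \<le> t" if "x \<in> supp_vec R" for x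
      proof -
        have "0 < R $ x" "0 < q $ x" "x < d"
          using that suppR mem_supp_vec[OF R(1)] mem_supp_vec[OF q] by auto
        then show ?thesis using rt[of x] by (simp add: R_def pos_divide_le_eq)
      qed
      have "M \<in> (\<lambda>x. R $ x / q $ x) ` supp_vec R"
        unfolding M_def using supp_vec_nonempty[OF R(1)] by (intro Max_in) auto
      with rat have "0 < M" "M \<le> t" by auto
      then have "log 2 M \<le> log 2 t" by simp
      then show ?thesis using True logt suppR by (simp add: renyi_div_def M_def)
    next
      case False
      then obtain b where b: "\<beta> = ereal b" "a < b" using a by (cases \<beta>) auto
      have Qpos: "0 < power_sum b R q"
        by (rule power_sum_pos[OF R(1) q supp_subset_imp_Int[OF R(1) suppR]])
      have ex: "(B - 1) * (a - 1) = (a - 1) / (b - 1)"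
        using b a by (simp add: B field_simps)
      have "power_sum b R q \<le> (1 - w) * t' powr (b - 1) + w * t powr (b - 1)"
        using Q[of b] b prob_vecsD(1)[OF R(1)] by (simp add: power_sum_def R_def)
      then have "power_sum b R q powr ((a - 1) / (b - 1))
          \<le> ((1 - w) * t' powr (b - 1) + w * t powr (b - 1)) powr ((a - 1) / (b - 1))"
        using Qpos a b by (intro powr_mono2) auto
      also have "\<dots> = ((1 - w) * (t' powr (a - 1)) powr ((b - 1) / (a - 1))
          + w * (t powr (a - 1)) powr ((b - 1) / (a - 1))) powr (1 / ((b - 1) / (a - 1)))"
        using a b by (simp add: powr_powr)
      also have "\<dots> \<le> t' powr (a - 1) + w powr (1 / ((b - 1) / (a - 1))) * (t powr (a - 1) - t' powr (a - 1))"
        using t w a b \<epsilon> by (intro powr_interpolation) (auto intro!: powr_mono2)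
      also have "\<dots> \<le> K * power_sum a p q"
        using KA by (simp add: ex \<Delta>_def)
      finally have "log 2 (power_sum b R q powr ((a - 1) / (b - 1))) \<le> log 2 (K * power_sum a p q)"
        using Qpos Apos K by simp
      then have "(a - 1) / (b - 1) * log 2 (power_sum b R q) \<le> c * (a - 1) + log 2 (power_sum a p q)"
        using Qpos Apos by (simp add: log_powr log_mult K_def)
      then have "((a - 1) / (b - 1) * log 2 (power_sum b R q)) / (a - 1)
          \<le> (c * (a - 1) + log 2 (power_sum a p q)) / (a - 1)"
        using a by (intro divide_right_mono) auto
      then show ?thesis
        using a b suppR by (simp add: renyi_div_gt1 add_divide_distrib)
    qed
    then show ?thesis
      using 3 a by (intro smoothed_leI[OF R(2)]) (simp add: renyi_div_gt1)
  qed
qed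

section \<open>The extremal constant and binary entropy\<close>

text \<open>The difference of the two sides is the relative entropy of \<open>(t, 1 - t)\<close> to
  the pair \<open>\<epsilon>\<close>, \<open>u\<close> divided by \<open>u + \<epsilon>\<close>.
  Equality therefore means \<open>\<epsilon> / (u + \<epsilon>) = t\<close>, which gives the
  \<open>u\<close> of the next lemma.\<close>

lemma log_binary_entropy_bound:
  fixes u \<epsilon> t :: real
  assumes \<epsilon>: "0 < \<epsilon>" and u: "0 < u" and t: "0 < t" "t \<le> 1"
  shows "(1 - t) * log 2 u - log 2 (u + \<epsilon>)
      \<le> t * log 2 (1 / \<epsilon>) - binary_entropy t"
proof (cases "t = 1")
  case True
  then show ?thesis using assms by (simp add: log_divide binary_entropy_def)
next
  case False
  with t have t1: "t < 1" by simp
  define s where "s = u + \<epsilon>"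
  have s: "0 < s" using assms by (simp add: s_def)
  have "t * ln (\<epsilon> / (s * t)) + (1 - t) * ln (u / (s * (1 - t)))
      \<le> t * (\<epsilon> / (s * t) - 1) + (1 - t) * (u / (s * (1 - t)) - 1)"
    using assms t1 s by (intro add_mono mult_left_mono ln_le_minus_one) auto
  also have "\<dots> = (\<epsilon> + u) / s - 1" using t t1 s by (simp add: field_simps)
  also have "\<dots> = 0" using s by (simp add: s_def)
  finally have "t * (ln \<epsilon> - (ln s + ln t)) + (1 - t) * (ln u - (ln s + ln (1 - t))) \<le> 0"
    using assms t1 s by (simp add: ln_div ln_mult)
  then have "((1 - t) * ln u - ln s) \<le> (t * (- ln \<epsilon>) - (- t * ln t - (1 - t) * ln (1 - t)))"
    by (simp add: algebra_simps)
  then have "((1 - t) * ln u - ln s) / ln 2 \<le> (t * (- ln \<epsilon>) - (- t * ln t - (1 - t) * ln (1 - t))) / ln 2"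
    by (rule divide_right_mono) simp
  then show ?thesis using \<epsilon> by (simp add: binary_entropy_def log_def ln_div diff_divide_distrib add_divide_distrib s_def)
qed

lemma log_binary_entropy_attained:
  fixes \<epsilon> t :: real
  assumes \<epsilon>: "0 < \<epsilon>" and t: "0 < t" "t < 1"
  defines "u \<equiv> \<epsilon> * (1 - t) / t"
  shows "(1 - t) * log 2 u - log 2 (u + \<epsilon>)
      = t * log 2 (1 / \<epsilon>) - binary_entropy t"
proof -
  have "u + \<epsilon> = \<epsilon> / t" using t by (simp add: u_def field_simps)
  moreover have "log 2 u = log 2 \<epsilon> + log 2 (1 - t) - log 2 t"
    using assms by (simp add: u_def log_divide log_mult del: right_diff_distrib)
  ultimately show ?thesis using assms by (simp add: binary_entropy_def log_divide algebra_simps)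
qed

text \<open>In this range the maximiser satisfies
  \<open>u + \<epsilon> = \<epsilon> / t \<ge> 1\<close>, out of reach of the two-point
  distributions; the bound 0 takes its place. Already the term \<open>- t * log 2 t\<close> of the
  entropy outweighs \<open>t * log 2 (1 / \<epsilon>)\<close>.\<close>

lemma log_binary_entropy_le_0:
  fixes \<epsilon> t :: real
  assumes "t \<le> \<epsilon>" "0 < t" "t < 1"
  shows "t * log 2 (1 / \<epsilon>) - binary_entropy t \<le> 0"
proof -
  have "t * log 2 t \<le> t * log 2 \<epsilon>" using assms by (intro mult_left_mono) auto
  moreover have "(1 - t) * log 2 (1 - t) \<le> 0" using assms by (intro mult_nonneg_nonpos) auto
  moreover have "t * log 2 (1 / \<epsilon>) = - (t * log 2 \<epsilon>)" using assms by (simp add: log_divide)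
  ultimately show ?thesis unfolding binary_entropy_def by linarith
qed

lemma mu_tilde_lt1:
  assumes "0 \<le> a" "a < b" "b < 1"
  shows "mu_tilde \<epsilon> (ereal a) (ereal b) = ereal (b / (1 - b) *
    (theta (ereal a) (ereal b) * log 2 (1 / \<epsilon>) - binary_entropy (theta (ereal a) (ereal b))))"
  using assms by (simp add: mu_tilde_def Let_def)

lemma mu_tilde_gt1:
  assumes "1 < a" "ereal a < \<beta>"
  shows "mu_tilde \<epsilon> (ereal a) \<beta> = ereal (a / (a - 1) *
    (theta (ereal a) \<beta> * log 2 (1 / \<epsilon>) - binary_entropy (theta (ereal a) \<beta>)))"
proof -
  have "1 < \<beta>" using assms by (cases \<beta>) auto
  then have "\<not> \<beta> < 1" by simp
  with assms show ?thesis by (simp add: mu_tilde_def Let_def)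
qed

text \<open>The last identity is the origin of \<open>theta\<close>: it makes the logarithm of
  \<open>s powr (a / (1 - a))\<close> over \<open>(s + \<epsilon>) powr (b / (1 - b))\<close> equal
  to \<open>b / (1 - b)\<close> times the expression bounded by the entropy.\<close>

lemma theta_lt1:
  fixes a b :: real
  assumes "0 \<le> a" "a < b" "b < 1"
  defines "t \<equiv> theta (ereal a) (ereal b)"
  shows "0 < t" "t \<le> 1" "b / (1 - b) * (1 - t) = a / (1 - a)"
proof -
  have t: "t = (b - a) / (b * (1 - a))" using assms(1-3) by (simp add: t_def theta_def)
  have nz: "b \<noteq> 0" "1 - a \<noteq> 0" "1 - b \<noteq> 0" using assms(1-3) by auto
  then have t1: "1 - t = a * (1 - b) / (b * (1 - a))"
    unfolding t by (simp add: divide_simps) (simp add: algebra_simps)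
  show "0 < t" unfolding t using assms(1-3) by (intro divide_pos_pos) auto
  have "0 \<le> 1 - t" unfolding t1 using assms(1-3) by (intro divide_nonneg_nonneg mult_nonneg_nonneg) auto
  then show "t \<le> 1" by simp
  show "b / (1 - b) * (1 - t) = a / (1 - a)" unfolding t1 using nz by simp
qed

text \<open>As below order 1, the last identity turns the exponents of \<open>w\<close> and
  \<open>w + \<epsilon>\<close> into a common factor times \<open>1 - t\<close> and 1.\<close>

lemma theta_gt1:
  fixes a :: real
  assumes "1 < a" "ereal a < \<beta>"
  defines "t \<equiv> theta (ereal a) \<beta>"
  shows "0 < t" "t < 1"
    "a / (a - 1) * (1 - t) = (if \<beta> = \<infinity> then 1 else real_of_ereal \<beta> / (real_of_ereal \<beta> - 1))"
proof -
  have "0 < t \<and> t < 1 \<and>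
    a / (a - 1) * (1 - t) = (if \<beta> = \<infinity> then 1 else real_of_ereal \<beta> / (real_of_ereal \<beta> - 1))"
  proof (cases "\<beta> = \<infinity>")
    case True
    then have t: "t = 1 / a" by (simp add: t_def theta_def)
    show ?thesis unfolding t using assms(1) True by (simp add: field_simps)
  next
    case False
    then obtain b where b: "\<beta> = ereal b" "a < b" using assms by (cases \<beta>) auto
    then have t: "t = (b - a) / (a * (b - 1))" using assms(1) by (simp add: t_def theta_def)
    have nz: "a \<noteq> 0" "a - 1 \<noteq> 0" "b - 1 \<noteq> 0" using assms(1) b by auto
    then have t1: "1 - t = b * (a - 1) / (a * (b - 1))"
      unfolding t by (simp add: divide_simps) (simp add: algebra_simps)
    have "0 < t" unfolding t using assms(1) b by (intro divide_pos_pos) auto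
    moreover have "0 < 1 - t" unfolding t1 using assms(1) b by (intro divide_pos_pos) auto
    moreover have "a / (a - 1) * (1 - t) = b / (b - 1)" unfolding t1 using nz by simp
    ultimately show ?thesis using b by simp
  qed
  then show "0 < t" "t < 1"
    "a / (a - 1) * (1 - t) = (if \<beta> = \<infinity> then 1 else real_of_ereal \<beta> / (real_of_ereal \<beta> - 1))"
    by auto
qed

lemma powr_le_of_log_le:
  fixes s w :: real
  assumes "0 < s" "0 < w" "x * log 2 s \<le> c + y * log 2 w"
  shows "s powr x \<le> 2 powr c * w powr y"
proof -
  have "2 powr (x * log 2 s) \<le> 2 powr (c + y * log 2 w)" using assms by simp
  then show ?thesis using assms by (simp add: powr_add powr_powr[symmetric] mult.commute[of _ "log 2 _"])
qed

lemma smoothed_renyi_div_le: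
  assumes p: "p \<in> prob_vecs d" and q: "q \<in> prob_vecs d" and \<epsilon>: "0 < \<epsilon>" and \<alpha>\<beta>: "0 \<le> \<alpha>" "0 \<le> \<beta>"
  shows "smoothed \<epsilon> (renyi_div \<beta>) p q \<le> renyi_div \<alpha> p q + max 0 (mu_tilde \<epsilon> \<alpha> \<beta>)"
proof -
  consider (mono) "\<beta> \<le> \<alpha>" | (lt1) "\<alpha> < \<beta>" "\<beta> < 1" | (gt1) "1 < \<alpha>" "\<alpha> < \<beta>"
    | (inf) "\<alpha> < \<beta>" "\<not> \<beta> < 1" "\<not> 1 < \<alpha>"
    by fastforce
  then show ?thesis
  proof cases
    case mono
    have "smoothed \<epsilon> (renyi_div \<beta>) p q \<le> renyi_div \<beta> p q"
      using self_mem_prob_ball[OF p, of \<epsilon>] \<epsilon> by (intro smoothed_leI) auto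
    also have "\<dots> \<le> renyi_div \<alpha> p q + 0" using renyi_div_mono[OF p q \<alpha>\<beta>(2) mono] by simp
    also have "\<dots> \<le> renyi_div \<alpha> p q + max 0 (mu_tilde \<epsilon> \<alpha> \<beta>)" by (intro add_left_mono) auto
    finally show ?thesis .
  next
    case lt1
    obtain a b where ab: "\<alpha> = ereal a" "\<beta> = ereal b" "0 \<le> a" "a < b" "b < 1"
      using lt1 \<alpha>\<beta> by (cases \<alpha>; cases \<beta>) auto
    define t where "t = theta \<alpha> \<beta>"
    note th = theta_lt1[OF ab(3-5), folded ab(1,2), folded t_def]
    define m where "m = b / (1 - b) * (t * log 2 (1 / \<epsilon>) - binary_entropy t)"
    have mu: "max 0 (mu_tilde \<epsilon> \<alpha> \<beta>) = ereal (max 0 m)"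
      using mu_tilde_lt1[OF ab(3-5), of \<epsilon>] by (simp add: ab(1,2) m_def t_def zero_ereal_def max_def)
    have "s powr (a / (1 - a)) \<le> 2 powr max 0 m * (s + \<epsilon>) powr (b / (1 - b))" if "0 < s" for s
    proof (rule powr_le_of_log_le)
      have "b / (1 - b) * ((1 - t) * log 2 s - log 2 (s + \<epsilon>)) \<le> m"
        unfolding m_def using ab th \<epsilon> that
        by (intro mult_left_mono log_binary_entropy_bound) auto
      moreover have "b / (1 - b) * ((1 - t) * log 2 s - log 2 (s + \<epsilon>))
          = a / (1 - a) * log 2 s - b / (1 - b) * log 2 (s + \<epsilon>)"
        by (simp only: right_diff_distrib mult.assoc[symmetric] th(3)[symmetric])
      ultimately show "a / (1 - a) * log 2 s \<le> max 0 m + b / (1 - b) * log 2 (s + \<epsilon>)" by linarith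
    qed (use that \<epsilon> in auto)
    then show ?thesis
      unfolding mu unfolding ab(1,2) using ab \<epsilon> by (intro smoothed_renyi_div_lt1_le[OF p q]) auto
  next
    case gt1
    obtain a where a: "\<alpha> = ereal a" "1 < a" using gt1 by (cases \<alpha>) auto
    with gt1 have a\<beta>: "ereal a < \<beta>" by simp
    define t where "t = theta \<alpha> \<beta>"
    define B where "B = (if \<beta> = \<infinity> then 1 else real_of_ereal \<beta> / (real_of_ereal \<beta> - 1))"
    note th = theta_gt1[OF a(2) a\<beta>, folded a(1), folded t_def, folded B_def]
    define m where "m = a / (a - 1) * (t * log 2 (1 / \<epsilon>) - binary_entropy t)"
    have mu: "max 0 (mu_tilde \<epsilon> \<alpha> \<beta>) = ereal (max 0 m)"
      using mu_tilde_gt1[OF a(2) a\<beta>, of \<epsilon>] by (simp add: a(1) m_def t_def zero_ereal_def max_def)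
    have "w powr B \<le> 2 powr max 0 m * (w + \<epsilon>) powr (a / (a - 1))" if "0 < w" for w
    proof (rule powr_le_of_log_le)
      have "a / (a - 1) * ((1 - t) * log 2 w - log 2 (w + \<epsilon>)) \<le> m"
        unfolding m_def using a th \<epsilon> that
        by (intro mult_left_mono log_binary_entropy_bound) auto
      moreover have "a / (a - 1) * ((1 - t) * log 2 w - log 2 (w + \<epsilon>))
          = B * log 2 w - a / (a - 1) * log 2 (w + \<epsilon>)"
        by (simp only: right_diff_distrib mult.assoc[symmetric] th(3)[symmetric])
      ultimately show "B * log 2 w \<le> max 0 m + a / (a - 1) * log 2 (w + \<epsilon>)" by linarith
    qed (use that \<epsilon> in auto)
    then show ?thesis
      unfolding mu unfolding a(1) by (intro smoothed_renyi_div_gt1_le[OF p q a(2) a\<beta> \<epsilon> _ B_def]) auto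
  next
    \<comment> \<open>The constant is infinite and \<open>renyi_div\<close> is never
      \<open>-\<infinity>\<close>, so the right side is \<open>\<infinity>\<close>.\<close>
    case inf
    then have "\<not> \<beta> \<le> \<alpha>" "\<not> 1 < \<alpha>" "\<not> \<beta> < 1" by auto
    then have "mu_tilde \<epsilon> \<alpha> \<beta> = \<infinity>" by (auto simp: mu_tilde_def Let_def)
    moreover have "renyi_div \<alpha> p q \<noteq> -\<infinity>" using renyi_div_nonneg[OF p q \<alpha>\<beta>(1)] by auto
    ultimately show ?thesis by simp
  qed
qed

section \<open>Two-point distributions and lower bounds\<close>

definition two_point :: "real \<Rightarrow> real vec" where
  "two_point s = vec 2 (\<lambda>i. if i = 0 then s else 1 - s)"

lemma two_point_simps [simp]:
  "dim_vec (two_point s) = 2" "two_point s $ 0 = s" "two_point s $ 1 = 1 - s" "two_point s $ Suc 0 = 1 - s"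
  by (auto simp: two_point_def)

lemma lessThan_2: "{..<2::nat} = {0, 1}" by auto

lemma two_point_prob_vecs:
  assumes "0 \<le> s" "s \<le> 1"
  shows "two_point s \<in> prob_vecs 2"
proof -
  have "0 \<le> two_point s $ i" if "i < 2" for i
    using less_2_cases[OF that] assms by auto
  moreover have "(\<Sum>i<2. two_point s $ i) = 1" by (simp add: lessThan_2)
  ultimately show ?thesis unfolding prob_vecs_def carrier_vec_def by simp
qed

lemma supp_two_point:
  assumes "0 < s" "s < 1"
  shows "supp_vec (two_point s) = {..<2}"
proof -
  have "two_point s $ i \<noteq> 0" if "i < 2" for i
    using less_2_cases[OF that] assms by auto
  then show ?thesis unfolding supp_vec_def by auto
qed

text \<open>On two points both coordinates change by the same amount, so the distance is the change
  of the first one.\<close>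

lemma prob_ball_two_point:
  assumes "r \<in> prob_ball \<epsilon> (two_point s)"
  shows "r \<in> prob_vecs 2" "s - \<epsilon> \<le> r $ 0" "r $ 0 \<le> s + \<epsilon>"
proof -
  show r: "r \<in> prob_vecs 2" using assms by (simp add: prob_ball_def)
  have "r $ 0 + r $ 1 = 1" using prob_vecsD(3)[OF r] by (simp add: lessThan_2)
  moreover have "\<bar>s - r $ 0\<bar> + \<bar>1 - s - r $ 1\<bar> \<le> 2 * \<epsilon>"
    using assms by (simp add: prob_ball_def lessThan_2)
  ultimately show "s - \<epsilon> \<le> r $ 0" "r $ 0 \<le> s + \<epsilon>" by linarith+
qed

lemma smoothed_geI:
  assumes "\<And>r. r \<in> prob_ball \<epsilon> p \<Longrightarrow> X \<le> D r q"
  shows "X \<le> smoothed \<epsilon> D p q"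
  unfolding smoothed_def using assms by (intro INF_greatest)

text \<open>Only the contribution of the first point is kept, in the power sum or in the
  maximum.\<close>

lemma renyi_div_two_point_ge:
  assumes r: "r \<in> prob_vecs 2" and v: "0 < v" "v \<le> r $ 0" and x: "0 < x" "x < 1" and \<beta>: "1 < \<beta>"
    and B: "B = (if \<beta> = \<infinity> then 1 else real_of_ereal \<beta> / (real_of_ereal \<beta> - 1))"
  shows "ereal (B * log 2 v - log 2 x) \<le> renyi_div \<beta> r (two_point x)"
proof -
  have q: "two_point x \<in> prob_vecs 2" using x by (intro two_point_prob_vecs) auto
  have sub: "supp_vec r \<subseteq> supp_vec (two_point x)"
    unfolding supp_two_point[OF x] using prob_vecsD(1)[OF r] by (auto simp: supp_vec_def)
  show ?thesis
  proof (cases "\<beta> = \<infinity>")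
    case True
    have "0 \<in> supp_vec r" using v mem_supp_vec[OF r] by auto
    then have "r $ 0 / two_point x $ 0 \<le> Max ((\<lambda>i. r $ i / two_point x $ i) ` supp_vec r)"
      by (intro Max_ge finite_imageI finite_supp_vec image_eqI[of _ _ 0]) simp_all
    moreover have "v / x \<le> r $ 0 / two_point x $ 0" using v x by (simp add: divide_right_mono)
    ultimately have le: "v / x \<le> Max ((\<lambda>i. r $ i / two_point x $ i) ` supp_vec r)" by simp
    moreover have "0 < v / x" using v x by simp
    ultimately have "log 2 (v / x) \<le> log 2 (Max ((\<lambda>i. r $ i / two_point x $ i) ` supp_vec r))"
      by simp
    then show ?thesis using True sub v x by (simp add: B renyi_div_def log_divide)
  next
    case False
    then obtain b where b: "\<beta> = ereal b" "1 < b" using \<beta> by (cases \<beta>) auto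
    have "v powr b * x powr (1 - b) \<le> r $ 0 powr b * x powr (1 - b)"
      using v b by (intro mult_right_mono powr_mono2) auto
    also have "\<dots> \<le> power_sum b r (two_point x)"
      using prob_vecsD(1)[OF r] by (simp add: power_sum_def lessThan_2)
    finally have "log 2 (v powr b * x powr (1 - b)) \<le> log 2 (power_sum b r (two_point x))"
      using v x power_sum_pos[OF r q supp_subset_imp_Int[OF r sub], of b] by simp
    then have "(b * log 2 v - (b - 1) * log 2 x) / (b - 1) \<le> log 2 (power_sum b r (two_point x)) / (b - 1)"
      using v x b by (intro divide_right_mono) (auto simp: log_mult log_powr algebra_simps)
    then show ?thesis using b sub by (simp add: B renyi_div_gt1 diff_divide_distrib)
  qed
qed

text \<open>At \<open>p = q\<close> the unsmoothed divergence is 0, and smoothing cannot make a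
  divergence negative.\<close>

lemma additive_constant_nonneg:
  assumes c: "\<And>p q. p \<in> prob_vecs 2 \<Longrightarrow> q \<in> prob_vecs 2 \<Longrightarrow>
      smoothed \<epsilon> (renyi_div \<beta>) p q \<le> renyi_div \<alpha> p q + ereal c"
    and \<alpha>\<beta>: "0 \<le> \<alpha>" "0 \<le> \<beta>"
  shows "0 \<le> c"
proof -
  have p: "two_point 0 \<in> prob_vecs 2" by (intro two_point_prob_vecs) auto
  have "0 \<le> smoothed \<epsilon> (renyi_div \<beta>) (two_point 0) (two_point 0)"
    using prob_ball_two_point(1) p \<alpha>\<beta> by (intro smoothed_geI renyi_div_nonneg) auto
  also have "\<dots> \<le> ereal c" using c[OF p p] renyi_div_self[OF p \<alpha>\<beta>(1)] by simp
  finally show ?thesis by simp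
qed

text \<open>With more than \<open>\<epsilon>\<close> of the mass of \<open>p\<close> on a point
  where \<open>q\<close> vanishes, every smoothing keeps some of it there and has infinite
  divergence of order at least 1. Below order 1 overlapping supports already keep the divergence
  finite.\<close>

lemma no_additive_constant_lt1:
  assumes \<epsilon>: "0 < \<epsilon>" "\<epsilon> < 1" and \<alpha>: "0 \<le> \<alpha>" "\<alpha> < 1" and \<beta>: "1 \<le> \<beta>"
    and c: "\<And>p q. p \<in> prob_vecs 2 \<Longrightarrow> q \<in> prob_vecs 2 \<Longrightarrow>
      smoothed \<epsilon> (renyi_div \<beta>) p q \<le> renyi_div \<alpha> p q + ereal c"
  shows False
proof -
  define \<delta> where "\<delta> = (1 + \<epsilon>) / 2"
  have \<delta>: "\<epsilon> < \<delta>" "\<delta> < 1" "0 < \<delta>" using \<epsilon> by (auto simp: \<delta>_def)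
  have p: "two_point \<delta> \<in> prob_vecs 2" and q: "two_point 0 \<in> prob_vecs 2"
    using \<delta> by (auto intro!: two_point_prob_vecs)
  obtain a where a: "\<alpha> = ereal a" "a < 1" using \<alpha> by (cases \<alpha>) auto
  have "1 \<in> supp_vec (two_point \<delta>) \<inter> supp_vec (two_point 0)"
    using \<delta> by (simp add: supp_vec_def)
  then have fin: "renyi_div \<alpha> (two_point \<delta>) (two_point 0) \<noteq> \<infinity>"
    using a by (auto simp: renyi_div_lt1[OF p q])
  have "\<infinity> \<le> smoothed \<epsilon> (renyi_div \<beta>) (two_point \<delta>) (two_point 0)"
  proof (rule smoothed_geI)
    fix r assume r: "r \<in> prob_ball \<epsilon> (two_point \<delta>)"
    then have "0 \<in> supp_vec r"
      using prob_ball_two_point[OF r] \<delta> mem_supp_vec[of r 2 0] by auto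
    moreover have "0 \<notin> supp_vec (two_point 0)" by (simp add: supp_vec_def)
    ultimately have "\<not> supp_vec r \<subseteq> supp_vec (two_point 0)" by blast
    moreover have "\<not> \<beta> < 1" using \<beta> by simp
    ultimately show "\<infinity> \<le> renyi_div \<beta> r (two_point 0)" by (simp add: renyi_div_def)
  qed
  with c[OF p q] fin show False by (cases "renyi_div \<alpha> (two_point \<delta>) (two_point 0)") auto
qed

text \<open>Let \<open>q\<close> give mass \<open>2 powr (- y)\<close> to a point of
  \<open>p\<close>-mass \<open>\<delta> > \<epsilon>\<close>. The smoothed divergence grows like
  \<open>y\<close>, but the Kullback-Leibler divergence only like \<open>\<delta> * y\<close>, so
  the gap grows like \<open>(1 - \<delta>) * y\<close>.\<close>

lemma no_additive_constant_KL:
  assumes \<epsilon>: "0 < \<epsilon>" "\<epsilon> < 1" and \<beta>: "1 < \<beta>"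
    and c: "\<And>p q. p \<in> prob_vecs 2 \<Longrightarrow> q \<in> prob_vecs 2 \<Longrightarrow>
      smoothed \<epsilon> (renyi_div \<beta>) p q \<le> renyi_div 1 p q + ereal c"
  shows False
proof -
  define \<delta> where "\<delta> = (1 + \<epsilon>) / 2"
  have \<delta>: "\<epsilon> < \<delta>" "\<delta> < 1" "0 < \<delta>" using \<epsilon> by (auto simp: \<delta>_def)
  have p: "two_point \<delta> \<in> prob_vecs 2" using \<delta> by (auto intro!: two_point_prob_vecs)
  define B where "B = (if \<beta> = \<infinity> then 1 else real_of_ereal \<beta> / (real_of_ereal \<beta> - 1))"
  have bound: "(1 - \<delta>) * y \<le> 1 + c - B * log 2 (\<delta> - \<epsilon>)" if y: "1 \<le> y" for y
  proof -
    define x :: real where "x = 2 powr (- y)"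
    have "x \<le> 2 powr (-1)" unfolding x_def using y by (intro powr_mono) auto
    then have x: "0 < x" "x \<le> 1 / 2" by (auto simp: x_def powr_minus_divide)
    have logx: "log 2 x = - y" unfolding x_def by (rule log_powr_cancel) auto
    from x have x1: "x < 1" by simp
    have q: "two_point x \<in> prob_vecs 2" using x by (intro two_point_prob_vecs) auto
    have "ereal (B * log 2 (\<delta> - \<epsilon>) - log 2 x) \<le> smoothed \<epsilon> (renyi_div \<beta>) (two_point \<delta>) (two_point x)"
    proof (rule smoothed_geI)
      fix r assume r: "r \<in> prob_ball \<epsilon> (two_point \<delta>)"
      show "ereal (B * log 2 (\<delta> - \<epsilon>) - log 2 x) \<le> renyi_div \<beta> r (two_point x)"
        using prob_ball_two_point[OF r] \<delta> x x1 by (intro renyi_div_two_point_ge \<beta> B_def) auto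
    qed
    also have "\<dots> \<le> renyi_div 1 (two_point \<delta>) (two_point x) + ereal c" by (rule c[OF p q])
    also have "renyi_div 1 (two_point \<delta>) (two_point x)
        = ereal (\<delta> * log 2 (\<delta> / x) + (1 - \<delta>) * log 2 ((1 - \<delta>) / (1 - x)))"
      using \<delta> x x1 by (simp add: renyi_div_def supp_two_point lessThan_2)
    finally have "B * log 2 (\<delta> - \<epsilon>) + y
        \<le> \<delta> * log 2 (\<delta> / x) + (1 - \<delta>) * log 2 ((1 - \<delta>) / (1 - x)) + c"
      using logx by simp
    also have "\<delta> * log 2 (\<delta> / x) = \<delta> * log 2 \<delta> + \<delta> * y"
      using \<delta> x logx by (simp add: log_divide algebra_simps)
    finally have 1: "B * log 2 (\<delta> - \<epsilon>) + y
        \<le> \<delta> * log 2 \<delta> + \<delta> * y + (1 - \<delta>) * log 2 ((1 - \<delta>) / (1 - x)) + c" .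
    have 2: "\<delta> * log 2 \<delta> \<le> 0" using \<delta> by (intro mult_nonneg_nonpos) auto
    \<comment> \<open>The second point contributes at most a constant: \<open>y \<ge> 1\<close> was
      imposed so that \<open>1 - x \<ge> 1 / 2\<close>.\<close>
    have "(1 - \<delta>) * (1 / 2) \<le> (1 - \<delta>) * (1 - x)" using \<delta> x by (intro mult_left_mono) auto
    then have "(1 - \<delta>) / (1 - x) \<le> 2" using \<delta> x x1 by (simp add: field_simps)
    then have "log 2 ((1 - \<delta>) / (1 - x)) \<le> log 2 2" using \<delta> x x1 by (subst log_le_cancel_iff) auto
    then have "(1 - \<delta>) * log 2 ((1 - \<delta>) / (1 - x)) \<le> (1 - \<delta>) * 1"
      using \<delta> by (intro mult_left_mono) auto
    with 1 2 \<delta> show ?thesis by (simp add: algebra_simps)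
  qed
  define y where "y = max 1 ((2 + c - B * log 2 (\<delta> - \<epsilon>)) / (1 - \<delta>))"
  have "2 + c - B * log 2 (\<delta> - \<epsilon>) \<le> (1 - \<delta>) * y"
    using \<delta> mult_left_mono[of "(2 + c - B * log 2 (\<delta> - \<epsilon>)) / (1 - \<delta>)" y "1 - \<delta>"]
    by (simp add: y_def)
  moreover have "(1 - \<delta>) * y \<le> 1 + c - B * log 2 (\<delta> - \<epsilon>)" by (rule bound) (simp add: y_def)
  ultimately show False by linarith
qed

text \<open>As the \<open>q\<close>-mass \<open>x\<close> of the first point tends to 0, both
  divergences diverge like \<open>- log 2 x\<close>; this term cancels and the limit leaves the
  masses \<open>s - \<epsilon>\<close> and \<open>s\<close> of that point.\<close>

lemma additive_constant_gt1_ge: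
  assumes s: "\<epsilon> < s" "s < 1" "0 < \<epsilon>" and a: "1 < a" "ereal a < \<beta>"
    and B: "B = (if \<beta> = \<infinity> then 1 else real_of_ereal \<beta> / (real_of_ereal \<beta> - 1))"
    and c: "\<And>p q. p \<in> prob_vecs 2 \<Longrightarrow> q \<in> prob_vecs 2 \<Longrightarrow>
      smoothed \<epsilon> (renyi_div \<beta>) p q \<le> renyi_div (ereal a) p q + ereal c"
  shows "B * log 2 (s - \<epsilon>) - a / (a - 1) * log 2 s \<le> c"
proof -
  have \<beta>: "1 < \<beta>" using a by (cases \<beta>) auto
  have p: "two_point s \<in> prob_vecs 2" using s by (intro two_point_prob_vecs) auto
  define h where "h x = 1 / (a - 1) * log 2 (s powr a + (1 - s) powr a * (1 - x) powr (1 - a) * x powr (a - 1)) + c"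
    for x
  have "B * log 2 (s - \<epsilon>) \<le> h x" if x: "0 < x" "x < 1" for x
  proof -
    have q: "two_point x \<in> prob_vecs 2" using x by (intro two_point_prob_vecs) auto
    have "ereal (B * log 2 (s - \<epsilon>) - log 2 x) \<le> smoothed \<epsilon> (renyi_div \<beta>) (two_point s) (two_point x)"
    proof (rule smoothed_geI)
      fix r assume r: "r \<in> prob_ball \<epsilon> (two_point s)"
      show "ereal (B * log 2 (s - \<epsilon>) - log 2 x) \<le> renyi_div \<beta> r (two_point x)"
        using prob_ball_two_point[OF r] s x by (intro renyi_div_two_point_ge \<beta> B) auto
    qed
    also have "\<dots> \<le> renyi_div (ereal a) (two_point s) (two_point x) + ereal c" by (rule c[OF p q])
    also have "renyi_div (ereal a) (two_point s) (two_point x)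
        = ereal (1 / (a - 1) * log 2 (s powr a * x powr (1 - a) + (1 - s) powr a * (1 - x) powr (1 - a)))"
      using s x a by (simp add: renyi_div_gt1 supp_two_point power_sum_def lessThan_2)
    finally have le: "B * log 2 (s - \<epsilon>) - log 2 x
        \<le> 1 / (a - 1) * log 2 (s powr a * x powr (1 - a) + (1 - s) powr a * (1 - x) powr (1 - a)) + c"
      by simp
    have "s powr a * x powr (1 - a) + (1 - s) powr a * (1 - x) powr (1 - a)
        = x powr (1 - a) * (s powr a + (1 - s) powr a * (1 - x) powr (1 - a) * x powr (a - 1))"
      using x by (simp add: distrib_left mult.left_commute flip: powr_add)
    moreover have "0 < s powr a + (1 - s) powr a * (1 - x) powr (1 - a) * x powr (a - 1)"
      using s by (intro add_pos_nonneg) auto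
    ultimately have "log 2 (s powr a * x powr (1 - a) + (1 - s) powr a * (1 - x) powr (1 - a))
        = (1 - a) * log 2 x + log 2 (s powr a + (1 - s) powr a * (1 - x) powr (1 - a) * x powr (a - 1))"
      using x by (simp add: log_mult log_powr)
    then have "1 / (a - 1) * log 2 (s powr a * x powr (1 - a) + (1 - s) powr a * (1 - x) powr (1 - a))
        = - log 2 x + 1 / (a - 1) * log 2 (s powr a + (1 - s) powr a * (1 - x) powr (1 - a) * x powr (a - 1))"
      using a by (simp add: field_simps)
    with le show ?thesis by (simp add: h_def)
  qed
  then have "\<forall>\<^sub>F x in at_right 0. B * log 2 (s - \<epsilon>) \<le> h x"
    by (intro eventually_at_rightI[of 0 1]) auto
  moreover have "(h \<longlongrightarrow> 1 / (a - 1) * log 2 (s powr a + (1 - s) powr a * (1 - 0) powr (1 - a) * 0) + c) (at_right 0)"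
  proof -
    have "((\<lambda>x::real. x powr (a - 1)) \<longlongrightarrow> 0) (at_right 0)"
      using a by (intro tendsto_zero_powrI[of _ _ _ "a - 1"]) (auto intro!: tendsto_ident_at eventually_at_rightI[of 0 1])
    then show ?thesis unfolding h_def using s
      by (intro tendsto_intros) auto
  qed
  ultimately have "B * log 2 (s - \<epsilon>) \<le> 1 / (a - 1) * log 2 (s powr a + (1 - s) powr a * (1 - 0) powr (1 - a) * 0) + c"
    by (intro tendsto_lowerbound) auto
  then show ?thesis using s by (simp add: log_powr)
qed

text \<open>Here \<open>q\<close> concentrates on the first point, where smoothing can raise the
  mass \<open>s\<close> to at most \<open>s + \<epsilon>\<close>; in the limit only the terms of
  this point remain.\<close>

lemma additive_constant_lt1_ge:
  assumes s: "0 < s" "s + \<epsilon> < 1" "0 < \<epsilon>" and ab: "0 \<le> a" "a < b" "b < 1"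
    and c: "\<And>p q. p \<in> prob_vecs 2 \<Longrightarrow> q \<in> prob_vecs 2 \<Longrightarrow>
      smoothed \<epsilon> (renyi_div (ereal b)) p q \<le> renyi_div (ereal a) p q + ereal c"
  shows "a / (1 - a) * log 2 s - b / (1 - b) * log 2 (s + \<epsilon>) \<le> c"
proof -
  have p: "two_point s \<in> prob_vecs 2" using s by (intro two_point_prob_vecs) auto
  define h where "h x = - (1 / (1 - b) * log 2 ((s + \<epsilon>) powr b + x powr (1 - b)))
    + (a / (1 - a) * log 2 s + log 2 (1 - x))" for x
  have "h x \<le> c" if x: "0 < x" "x < 1" for x
  proof -
    have q: "two_point (1 - x) \<in> prob_vecs 2" using x by (intro two_point_prob_vecs) auto
    have suppq: "supp_vec (two_point (1 - x)) = {..<2}" using x by (intro supp_two_point) auto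
    have "ereal (- (1 / (1 - b) * log 2 ((s + \<epsilon>) powr b + x powr (1 - b))))
        \<le> smoothed \<epsilon> (renyi_div (ereal b)) (two_point s) (two_point (1 - x))"
    proof (rule smoothed_geI)
      fix r assume r: "r \<in> prob_ball \<epsilon> (two_point s)"
      note r = prob_ball_two_point[OF r]
      have r01: "0 \<le> r $ 0" "0 \<le> r $ 1" "r $ 0 + r $ 1 = 1"
        using prob_vecsD[OF r(1)] by (auto simp: lessThan_2)
      have "supp_vec r \<subseteq> supp_vec (two_point (1 - x))"
        unfolding suppq using prob_vecsD(1)[OF r(1)] by (auto simp: supp_vec_def)
      note int = supp_subset_imp_Int[OF r(1) this]
      have "power_sum b r (two_point (1 - x)) = r $ 0 powr b * (1 - x) powr (1 - b) + r $ 1 powr b * x powr (1 - b)"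
        using prob_vecsD(1)[OF r(1)] by (simp add: power_sum_def lessThan_2)
      \<comment> \<open>The crude bound 1 for the second coordinate suffices, since its factor
        \<open>x powr (1 - b)\<close> tends to 0.\<close>
      also have "\<dots> \<le> (s + \<epsilon>) powr b * 1 + 1 * x powr (1 - b)"
        using r r01 x ab by (intro add_mono mult_mono powr_mono2 powr_le1) auto
      finally have "log 2 (power_sum b r (two_point (1 - x))) \<le> log 2 ((s + \<epsilon>) powr b + x powr (1 - b))"
        using power_sum_pos[OF r(1) q int, of b] by simp
      then have "1 / (1 - b) * log 2 (power_sum b r (two_point (1 - x)))
          \<le> 1 / (1 - b) * log 2 ((s + \<epsilon>) powr b + x powr (1 - b))"
        using ab by (intro mult_left_mono) auto
      moreover have "1 / (b - 1) = - (1 / (1 - b))" by (metis minus_diff_eq minus_divide_right)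
      ultimately show "ereal (- (1 / (1 - b) * log 2 ((s + \<epsilon>) powr b + x powr (1 - b))))
          \<le> renyi_div (ereal b) r (two_point (1 - x))"
        using int ab by (simp add: renyi_div_lt1[OF r(1) q])
    qed
    also have "\<dots> \<le> renyi_div (ereal a) (two_point s) (two_point (1 - x)) + ereal c" by (rule c[OF p q])
    also have "renyi_div (ereal a) (two_point s) (two_point (1 - x))
        \<le> ereal (- (a / (1 - a) * log 2 s + log 2 (1 - x)))"
    proof -
      have supps: "supp_vec (two_point s) = {..<2}" using s by (intro supp_two_point) auto
      have int: "supp_vec (two_point s) \<inter> supp_vec (two_point (1 - x)) \<noteq> {}"
        unfolding supps suppq by (simp add: lessThan_2)
      have "s powr a * (1 - x) powr (1 - a) \<le> power_sum a (two_point s) (two_point (1 - x))"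
        by (simp add: power_sum_def lessThan_2)
      then have "log 2 (s powr a * (1 - x) powr (1 - a)) \<le> log 2 (power_sum a (two_point s) (two_point (1 - x)))"
        using s x power_sum_pos[OF p q int, of a] by simp
      then have "(a * log 2 s + (1 - a) * log 2 (1 - x)) / (1 - a)
          \<le> log 2 (power_sum a (two_point s) (two_point (1 - x))) / (1 - a)"
        using s x ab by (intro divide_right_mono) (auto simp: log_mult log_powr)
      then have "a / (1 - a) * log 2 s + log 2 (1 - x)
          \<le> 1 / (1 - a) * log 2 (power_sum a (two_point s) (two_point (1 - x)))"
        using ab by (simp add: add_divide_distrib)
      moreover have "1 / (a - 1) = - (1 / (1 - a))" by (metis minus_diff_eq minus_divide_right)
      ultimately show ?thesis using int ab by (simp add: renyi_div_lt1[OF p q])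
    qed
    finally show ?thesis by (simp add: h_def add_right_mono)
  qed
  then have "\<forall>\<^sub>F x in at_right 0. h x \<le> c"
    by (intro eventually_at_rightI[of 0 1]) auto
  moreover have "(h \<longlongrightarrow> - (1 / (1 - b) * log 2 ((s + \<epsilon>) powr b + 0))
      + (a / (1 - a) * log 2 s + log 2 (1 - 0))) (at_right 0)"
  proof -
    have "((\<lambda>x::real. x powr (1 - b)) \<longlongrightarrow> 0) (at_right 0)"
      using ab by (intro tendsto_zero_powrI[of _ _ _ "1 - b"]) (auto intro!: tendsto_ident_at eventually_at_rightI[of 0 1])
    then show ?thesis unfolding h_def using s
      by (intro tendsto_intros) auto
  qed
  ultimately have "- (1 / (1 - b) * log 2 ((s + \<epsilon>) powr b + 0)) + (a / (1 - a) * log 2 s + log 2 (1 - 0)) \<le> c"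
    by (intro tendsto_upperbound) auto
  then show ?thesis using s by (simp add: log_powr)
qed

lemma mu_tilde_le_additive_constant:
  assumes \<epsilon>: "0 < \<epsilon>" "\<epsilon> < 1" and \<alpha>\<beta>: "0 \<le> \<alpha>" "0 \<le> \<beta>"
    and c: "\<And>p q. p \<in> prob_vecs 2 \<Longrightarrow> q \<in> prob_vecs 2 \<Longrightarrow>
      smoothed \<epsilon> (renyi_div \<beta>) p q \<le> renyi_div \<alpha> p q + ereal c"
  shows "max 0 (mu_tilde \<epsilon> \<alpha> \<beta>) \<le> ereal c"
proof -
  have c0: "0 \<le> c" using additive_constant_nonneg[OF c \<alpha>\<beta>] .
  have "mu_tilde \<epsilon> \<alpha> \<beta> \<le> ereal c"
  proof -
    consider (mono) "\<beta> \<le> \<alpha>" | (lt1) "\<alpha> < \<beta>" "\<beta> < 1" | (gt1) "1 < \<alpha>" "\<alpha> < \<beta>"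
      | (inf1) "\<alpha> < 1" "1 \<le> \<beta>" | (inf2) "\<alpha> = 1" "1 < \<beta>"
      by fastforce
    then show ?thesis
    proof cases
      case mono
      then show ?thesis using \<alpha>\<beta> c0 by (auto simp: mu_tilde_def Let_def)
    next
      case lt1
      obtain a b where ab: "\<alpha> = ereal a" "\<beta> = ereal b" "0 \<le> a" "a < b" "b < 1"
        using lt1 \<alpha>\<beta> by (cases \<alpha>; cases \<beta>) auto
      define t where "t = theta \<alpha> \<beta>"
      note th = theta_lt1[OF ab(3-5), folded ab(1,2), folded t_def]
      have mu: "mu_tilde \<epsilon> \<alpha> \<beta> = ereal (b / (1 - b) * (t * log 2 (1 / \<epsilon>) - binary_entropy t))"
        using mu_tilde_lt1[OF ab(3-5), of \<epsilon>] by (simp add: ab(1,2) t_def)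
      have ge: "b / (1 - b) * ((1 - t) * log 2 u - log 2 (u + \<epsilon>)) \<le> c" if u: "0 < u" "u + \<epsilon> < 1" for u
      proof -
        have "b / (1 - b) * ((1 - t) * log 2 u - log 2 (u + \<epsilon>))
            = a / (1 - a) * log 2 u - b / (1 - b) * log 2 (u + \<epsilon>)"
          by (simp only: right_diff_distrib mult.assoc[symmetric] th(3)[symmetric])
        also have "\<dots> \<le> c"
          using c unfolding ab(1,2) by (rule additive_constant_lt1_ge[OF u \<epsilon>(1) ab(3-5)])
        finally show ?thesis .
      qed
      have "b / (1 - b) * (t * log 2 (1 / \<epsilon>) - binary_entropy t) \<le> c"
      \<comment> \<open>This is \<open>a = 0\<close>: the bound has no maximiser
        \<open>u > 0\<close>, and its supremum is approached as \<open>u\<close> tends to 0.\<close>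
      proof (cases "t = 1")
        case True
        have "\<forall>\<^sub>F u in at_right 0. b / (1 - b) * ((1 - t) * log 2 u - log 2 (u + \<epsilon>)) \<le> c"
          using ge \<epsilon> by (intro eventually_at_rightI[of 0 "1 - \<epsilon>"]) auto
        then have "\<forall>\<^sub>F u in at_right 0. b / (1 - b) * (- log 2 (u + \<epsilon>)) \<le> c"
          using True by simp
        moreover have "((\<lambda>u. b / (1 - b) * (- log 2 (u + \<epsilon>))) \<longlongrightarrow> b / (1 - b) * (- log 2 (0 + \<epsilon>))) (at_right 0)"
          using \<epsilon> by (intro tendsto_intros) auto
        ultimately have "b / (1 - b) * (- log 2 (0 + \<epsilon>)) \<le> c"
          by (intro tendsto_upperbound) auto
        then show ?thesis using True \<epsilon> by (simp add: binary_entropy_def log_divide)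
      next
        case False
        with th have t: "0 < t" "t < 1" by auto
        show ?thesis
        proof (cases "t \<le> \<epsilon>")
          case True
          have "b / (1 - b) * (t * log 2 (1 / \<epsilon>) - binary_entropy t) \<le> 0"
            using log_binary_entropy_le_0[OF True t] ab
            by (intro mult_nonneg_nonpos) auto
          with c0 show ?thesis by simp
        next
          case False
          \<comment> \<open>The equality case of the entropy bound; it is admissible because
            \<open>u + \<epsilon> = \<epsilon> / t\<close> and
            \<open>\<epsilon> < t\<close>.\<close>
          define u where "u = \<epsilon> * (1 - t) / t"
          have "0 < u" using \<epsilon> t by (simp add: u_def)
          moreover have "u + \<epsilon> = \<epsilon> / t" using t by (simp add: u_def field_simps)
          then have "u + \<epsilon> < 1" using t False by simp
          ultimately show ?thesis
            using ge[of u] log_binary_entropy_attained[OF \<epsilon>(1) t]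
            by (simp add: u_def)
        qed
      qed
      then show ?thesis unfolding mu by simp
    next
      case gt1
      obtain a where a: "\<alpha> = ereal a" "1 < a" using gt1 by (cases \<alpha>) auto
      with gt1 have a\<beta>: "ereal a < \<beta>" by simp
      define t where "t = theta \<alpha> \<beta>"
      define B where "B = (if \<beta> = \<infinity> then 1 else real_of_ereal \<beta> / (real_of_ereal \<beta> - 1))"
      note th = theta_gt1[OF a(2) a\<beta>, folded a(1), folded t_def, folded B_def]
      have mu: "mu_tilde \<epsilon> \<alpha> \<beta> = ereal (a / (a - 1) * (t * log 2 (1 / \<epsilon>) - binary_entropy t))"
        using mu_tilde_gt1[OF a(2) a\<beta>, of \<epsilon>] by (simp add: a(1) t_def)
      have "a / (a - 1) * (t * log 2 (1 / \<epsilon>) - binary_entropy t) \<le> c"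
      proof (cases "t \<le> \<epsilon>")
        case True
        have "a / (a - 1) * (t * log 2 (1 / \<epsilon>) - binary_entropy t) \<le> 0"
          using log_binary_entropy_le_0[OF True th(1,2)] a
          by (intro mult_nonneg_nonpos) auto
        with c0 show ?thesis by simp
      next
        case False
        define u where "u = \<epsilon> * (1 - t) / t"
        have u: "0 < u" using \<epsilon> th by (simp add: u_def)
        have "u + \<epsilon> = \<epsilon> / t" using th by (simp add: u_def field_simps)
        then have u1: "u + \<epsilon> < 1" using th False by simp
        have "a / (a - 1) * (t * log 2 (1 / \<epsilon>) - binary_entropy t)
            = a / (a - 1) * ((1 - t) * log 2 u - log 2 (u + \<epsilon>))"
          using log_binary_entropy_attained[OF \<epsilon>(1) th(1,2)] by (simp add: u_def)
        also have "\<dots> = B * log 2 (u + \<epsilon> - \<epsilon>) - a / (a - 1) * log 2 (u + \<epsilon>)"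
          by (simp add: right_diff_distrib flip: mult.assoc th(3))
        also have "\<dots> \<le> c"
          using u by (intro additive_constant_gt1_ge[OF _ u1 \<epsilon>(1) a(2) a\<beta> B_def c[unfolded a(1)]]) auto
        finally show ?thesis .
      qed
      then show ?thesis unfolding mu by simp
    next
      case inf1
      then show ?thesis using no_additive_constant_lt1[OF \<epsilon> \<alpha>\<beta>(1) _ _ c] by blast
    next
      case inf2
      then show ?thesis using no_additive_constant_KL[OF \<epsilon> _ c[unfolded inf2(1)]] by blast
    qed
  qed
  with c0 show ?thesis by (simp add: max_def zero_ereal_def)
qed

section \<open>Measurements as channels\<close>

definition sesq_form :: "nat \<Rightarrow> (nat \<Rightarrow> nat \<Rightarrow> complex) \<Rightarrow> (nat \<Rightarrow> complex) \<Rightarrow> complex" where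
  "sesq_form n A v = (\<Sum>i<n. cnj (v i) * (\<Sum>j<n. A i j * v j))"

text \<open>The order on complex numbers makes \<open>0 \<le> z\<close> include that
  \<open>z\<close> is real.\<close>

definition psd_form :: "nat \<Rightarrow> (nat \<Rightarrow> nat \<Rightarrow> complex) \<Rightarrow> bool" where
  "psd_form n A \<longleftrightarrow> (\<forall>v. 0 \<le> sesq_form n A v)"

definition trace_prod :: "nat \<Rightarrow> (nat \<Rightarrow> nat \<Rightarrow> complex) \<Rightarrow> (nat \<Rightarrow> nat \<Rightarrow> complex) \<Rightarrow> complex" where
  "trace_prod n A X = (\<Sum>i<n. \<Sum>j<n. A i j * X j i)"

lemma sesq_form_add_unit:
  assumes "k < n"
  shows "sesq_form n A (\<lambda>i. v i + (if i = k then t else 0)) =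
    sesq_form n A v + cnj t * (\<Sum>j<n. A k j * v j) + (\<Sum>i<n. cnj (v i) * A i k) * t + cnj t * A k k * t"
proof -
  have inner: "(\<Sum>j<n. A i j * (v j + (if j = k then t else 0))) = (\<Sum>j<n. A i j * v j) + A i k * t" for i
    using assms by (simp add: distrib_left sum.distrib if_distrib[of "\<lambda>x. _ * x"] cong: if_cong)
  have "sesq_form n A (\<lambda>i. v i + (if i = k then t else 0))
      = (\<Sum>i<n. cnj (v i) * ((\<Sum>j<n. A i j * v j) + A i k * t)
          + (if i = k then cnj t * ((\<Sum>j<n. A k j * v j) + A k k * t) else 0))"
    unfolding sesq_form_def inner by (intro sum.cong) (auto simp: algebra_simps)
  also have "\<dots> = (\<Sum>i<n. cnj (v i) * ((\<Sum>j<n. A i j * v j) + A i k * t))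
      + cnj t * ((\<Sum>j<n. A k j * v j) + A k k * t)"
    using assms by (simp add: sum.distrib)
  also have "(\<Sum>i<n. cnj (v i) * ((\<Sum>j<n. A i j * v j) + A i k * t))
      = sesq_form n A v + (\<Sum>i<n. cnj (v i) * A i k) * t"
    by (simp add: sesq_form_def distrib_left sum.distrib sum_distrib_right mult.assoc)
  finally show ?thesis by (simp add: algebra_simps)
qed

lemma sesq_form_unit:
  assumes "k < n"
  shows "sesq_form n A (\<lambda>i. if i = k then t else 0) = cnj t * A k k * t"
  using sesq_form_add_unit[OF assms, of A "\<lambda>_. 0" t] by (simp add: sesq_form_def)

lemma psd_form_diag: "psd_form n A \<Longrightarrow> k < n \<Longrightarrow> 0 \<le> A k k"
  unfolding psd_form_def using sesq_form_unit[of k n A 1] by (metis mult_1 mult_1_right complex_cnj_one)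

lemma sesq_form_two_units:
  assumes "i < n" "j < n" "i \<noteq> j"
  shows "sesq_form n A (\<lambda>l. (if l = i then x else 0) + (if l = j then t else 0)) =
    cnj x * A i i * x + cnj t * A j i * x + cnj x * A i j * t + cnj t * A j j * t"
proof -
  have "(\<Sum>l<n. A j l * (if l = i then x else 0)) = A j i * x"
    "(\<Sum>l<n. cnj (if l = i then x else 0) * A l j) = cnj x * A i j"
    using assms by (simp_all add: if_distrib[of "\<lambda>x. _ * x"] if_distrib[of "\<lambda>x. x * _"] if_distrib[of cnj] cong: if_cong)
  then show ?thesis
    using sesq_form_add_unit[OF assms(2), of A "\<lambda>l. if l = i then x else 0" t] sesq_form_unit[OF assms(1), of A x]
    by (simp add: mult.assoc)
qed

text \<open>Polarisation: the form is real at the sum of the unit vectors \<open>i\<close> and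
  \<open>j\<close>, and at their sum with coefficient \<open>\<i>\<close> on the second.\<close>

lemma psd_form_hermitian:
  assumes psd: "psd_form n A" and ij: "i < n" "j < n"
  shows "A j i = cnj (A i j)"
proof (cases "i = j")
  case True
  have "0 \<le> A i i" using psd_form_diag[OF psd ij(1)] .
  then show ?thesis using True by (simp add: less_eq_complex_def complex_eq_iff)
next
  case False
  have "Im (A i i) = 0" "Im (A j j) = 0"
    using psd_form_diag[OF psd] ij by (auto simp: less_eq_complex_def)
  moreover have "0 \<le> A i i + A j i + A i j + A j j"
  proof -
    have "0 \<le> sesq_form n A (\<lambda>l. (if l = i then 1 else 0) + (if l = j then 1 else 0))"
      using psd by (auto simp: psd_form_def)
    also have "\<dots> = A i i + A j i + A i j + A j j"
      unfolding sesq_form_two_units[OF ij False] by simp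
    finally show ?thesis .
  qed
  moreover have "0 \<le> A i i - \<i> * A j i + A i j * \<i> + A j j"
  proof -
    have "0 \<le> sesq_form n A (\<lambda>l. (if l = i then 1 else 0) + (if l = j then \<i> else 0))"
      using psd by (auto simp: psd_form_def)
    also have "\<dots> = A i i - \<i> * A j i + A i j * \<i> + A j j"
      unfolding sesq_form_two_units[OF ij False] by (simp add: algebra_simps)
    finally show ?thesis .
  qed
  ultimately show ?thesis by (simp add: less_eq_complex_def complex_eq_iff)
qed

lemma psd_form_zero_diag:
  assumes psd: "psd_form n A" and k: "k < n" "A k k = 0" and j: "j < n"
  shows "A j k = 0" "A k j = 0"
proof -
  show "A j k = 0"
  proof (cases "j = k")
    case False
    show ?thesis
    proof (rule ccontr)
      define z where "z = A j k"
      assume "A j k \<noteq> 0"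
      then have z: "cmod z \<noteq> 0" by (simp add: z_def)
      \<comment> \<open>The form at the test vector below is
        \<open>A j j - 2 * r * (cmod z)\<^sup>2\<close>; this \<open>r\<close> makes it equal to
        -1.\<close>
      define r where "r = (Re (A j j) + 1) / (2 * (cmod z)\<^sup>2)"
      have "A k j = cnj z" using psd_form_hermitian[OF psd j k(1)] by (simp add: z_def)
      have "0 \<le> sesq_form n A (\<lambda>l. (if l = j then 1 else 0) + (if l = k then - of_real r * cnj z else 0))"
        using psd by (auto simp: psd_form_def)
      also have "\<dots> = A j j - of_real r * (z * cnj z) - of_real r * (z * cnj z)"
        unfolding sesq_form_two_units[OF j k(1) False] using k(2) \<open>A k j = cnj z\<close>
        by (simp add: algebra_simps flip: z_def)
      also have "\<dots> = A j j - of_real (2 * r * (cmod z)\<^sup>2)"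
        by (simp flip: complex_norm_square)
      finally have "0 \<le> Re (A j j) - 2 * r * (cmod z)\<^sup>2" by (simp add: less_eq_complex_def)
      also have "2 * r * (cmod z)\<^sup>2 = Re (A j j) + 1" using z by (simp add: r_def)
      finally show False by simp
    qed
  qed (use k in simp)
  then show "A k j = 0" using psd_form_hermitian[OF psd j k(1)] by simp
qed

text \<open>One step of Cholesky elimination.\<close>
lemma psd_form_eliminate:
  assumes psd: "psd_form n A" and k: "k < n" "A k k \<noteq> 0"
  shows "psd_form n (\<lambda>i j. A i j - A i k * cnj (A j k) / A k k)"
  unfolding psd_form_def
proof
  fix v
  define d where "d = A k k"
  define y where "y = (\<Sum>j<n. A k j * v j)"
  have dreal: "cnj d = d" using psd_form_diag[OF psd k(1)] by (simp add: less_eq_complex_def complex_eq_iff d_def)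
  have d: "d \<noteq> 0" using k by (simp add: d_def)
  have y': "(\<Sum>i<n. cnj (v i) * A i k) = cnj y"
    unfolding y_def cnj_sum using psd_form_hermitian[OF psd k(1)]
    by (intro sum.cong) (auto simp: mult.commute)
  \<comment> \<open>Completing the square: this shift minimises the form in direction
    \<open>k\<close>, and the value is the form of the Schur complement at \<open>v\<close>.\<close>
  have "0 \<le> sesq_form n A (\<lambda>i. v i + (if i = k then - y / d else 0))"
    using psd by (auto simp: psd_form_def)
  also have "\<dots> = sesq_form n A v - cnj y * y / d"
    unfolding sesq_form_add_unit[OF k(1)] y' y_def[symmetric] d_def[symmetric]
    using d dreal by (simp add: field_simps)
  also have "\<dots> = sesq_form n (\<lambda>i j. A i j - A i k * cnj (A j k) / A k k) v"
  proof -
    have inner: "(\<Sum>j<n. (A i j - A i k * cnj (A j k) / A k k) * v j) = (\<Sum>j<n. A i j * v j) - A i k * y / d" for i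
    proof -
      have "(\<Sum>j<n. A i k * cnj (A j k) / A k k * v j) = (\<Sum>j<n. A i k / d * (A k j * v j))"
        using psd_form_hermitian[OF psd _ k(1)] by (intro sum.cong) (auto simp: d_def)
      also have "\<dots> = A i k * y / d" by (simp add: y_def sum_distrib_left sum_divide_distrib)
      finally show ?thesis by (simp add: left_diff_distrib sum_subtractf)
    qed
    have "(\<Sum>i<n. cnj (v i) * (A i k * y / d)) = cnj y * y / d"
      unfolding y'[symmetric] sum_distrib_right sum_divide_distrib by (intro sum.cong) auto
    then show ?thesis
      unfolding sesq_form_def inner by (simp add: right_diff_distrib sum_subtractf)
  qed
  finally show "0 \<le> sesq_form n (\<lambda>i j. A i j - A i k * cnj (A j k) / A k k) v" .
qed

text \<open>Induction on the size \<open>k\<close> of the leading block outside which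
  \<open>A\<close> vanishes. Each elimination step splits off a rank-one matrix, the outer square of
  column \<open>k\<close> divided by its diagonal entry, whose trace against \<open>X\<close> is a
  value of the form of \<open>X\<close> divided by a positive number.\<close>

lemma trace_prod_nonneg:
  assumes X: "psd_form n X" and A: "psd_form n A"
  shows "0 \<le> trace_prod n A X"
proof -
  have "0 \<le> trace_prod n A X"
    if "psd_form n A" "\<And>i j. i < n \<Longrightarrow> j < n \<Longrightarrow> k \<le> i \<or> k \<le> j \<Longrightarrow> A i j = 0" "k \<le> n" for k A
    using that
  proof (induction k arbitrary: A)
    case 0
    then have "trace_prod n A X = 0" unfolding trace_prod_def by (intro sum.neutral ballI) auto
    then show ?case by simp
  next
    case (Suc k)
    then have k: "k < n" by simp
    show ?case
    proof (cases "A k k = 0")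
      case True
      show ?thesis
      proof (rule Suc.IH[OF Suc.prems(1)])
        fix i j assume "i < n" "j < n" "k \<le> i \<or> k \<le> j"
        then show "A i j = 0"
          using psd_form_zero_diag[OF Suc.prems(1) k True] Suc.prems(2)[of i j]
          by (cases "i = k"; cases "j = k") auto
      qed (use k in simp)
    next
      case False
      define d where "d = A k k"
      define B where "B i j = A i j - A i k * cnj (A j k) / A k k" for i j
      have "0 \<le> trace_prod n B X"
      proof (rule Suc.IH)
        show "psd_form n B" unfolding B_def by (rule psd_form_eliminate[OF Suc.prems(1) k False])
        have herm: "cnj (A j k) = A k j" if "j < n" for j
          using psd_form_hermitian[OF Suc.prems(1) that k] by simp
        fix i j assume "i < n" "j < n" "k \<le> i \<or> k \<le> j"
        then show "B i j = 0"
          using Suc.prems(2)[of i j] Suc.prems(2)[of i k] Suc.prems(2)[of k j] k herm[of j] False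
          by (cases "i = k"; cases "j = k") (auto simp: B_def)
      qed (use k in simp)
      moreover have "trace_prod n A X = trace_prod n B X + sesq_form n X (\<lambda>i. A i k) / d"
      proof -
        have "sesq_form n X (\<lambda>i. A i k) / d = (\<Sum>j<n. \<Sum>i<n. A i k * cnj (A j k) / d * X j i)"
          by (simp add: sesq_form_def sum_distrib_left sum_divide_distrib mult.left_commute mult.commute)
        also have "\<dots> = (\<Sum>i<n. \<Sum>j<n. A i k * cnj (A j k) / d * X j i)" by (rule sum.swap)
        finally show ?thesis
          by (simp add: trace_prod_def B_def d_def left_diff_distrib sum_subtractf)
      qed
      moreover have "0 \<le> sesq_form n X (\<lambda>i. A i k) / d"
      proof -
        have "0 \<le> d" using psd_form_diag[OF Suc.prems(1) k] by (simp add: d_def)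
        then obtain r where r: "d = of_real r" "0 \<le> r"
          by (intro that[of "Re d"]) (auto simp: less_eq_complex_def complex_eq_iff)
        have "0 \<le> sesq_form n X (\<lambda>i. A i k)" using X by (auto simp: psd_form_def)
        then show ?thesis using r(2) unfolding r(1) by (simp add: less_eq_complex_def)
      qed
      ultimately show ?thesis by simp
    qed
  qed
  from this[OF A, of n] show ?thesis by auto
qed

lemma psd_mats_iff:
  "A \<in> psd_mats n \<longleftrightarrow> A \<in> carrier_mat n n \<and> psd_form n (\<lambda>i j. A $$ (i, j))"
proof (cases "A \<in> carrier_mat n n")
  case True
  have form: "(A *\<^sub>v v) \<bullet>c v = sesq_form n (\<lambda>i j. A $$ (i, j)) (\<lambda>i. v $ i)" if "v \<in> carrier_vec n" for v
    using True that
    by (auto simp: sesq_form_def scalar_prod_def atLeast0LessThan mult.commute intro!: sum.cong)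
  have cong: "sesq_form n B u = sesq_form n B w" if "\<And>i. i < n \<Longrightarrow> u i = w i" for B u w
    using that by (simp add: sesq_form_def)
  have iff: "z \<in> \<real> \<and> 0 \<le> Re z \<longleftrightarrow> 0 \<le> z" for z :: complex
    by (auto simp: less_eq_complex_def complex_is_Real_iff)
  have "A \<in> psd_mats n \<longleftrightarrow> (\<forall>v \<in> carrier_vec n. 0 \<le> sesq_form n (\<lambda>i j. A $$ (i, j)) (\<lambda>i. v $ i))"
    using True form by (simp add: psd_mats_def iff)
  also have "\<dots> \<longleftrightarrow> psd_form n (\<lambda>i j. A $$ (i, j))"
    unfolding psd_form_def
  proof (intro iffI allI ballI)
    fix u
    assume "\<forall>v\<in>carrier_vec n. 0 \<le> sesq_form n (\<lambda>i j. A $$ (i, j)) (\<lambda>i. v $ i)"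
    then have "0 \<le> sesq_form n (\<lambda>i j. A $$ (i, j)) (\<lambda>i. vec n u $ i)" by simp
    then show "0 \<le> sesq_form n (\<lambda>i j. A $$ (i, j)) u" using cong[of "\<lambda>i. vec n u $ i" u] by simp
  qed auto
  finally show ?thesis using True by simp
qed (simp add: psd_mats_def)

lemma mat_trace_mult:
  assumes "A \<in> carrier_mat n n" "B \<in> carrier_mat n n"
  shows "mat_trace (A * B) = trace_prod n (\<lambda>i j. A $$ (i, j)) (\<lambda>i j. B $$ (i, j))"
  using assms by (auto simp: mat_trace_def trace_prod_def scalar_prod_def atLeast0LessThan intro!: sum.cong)

lemma mat_trace_mult_nonneg:
  assumes "A \<in> psd_mats n" "B \<in> psd_mats n"
  shows "0 \<le> mat_trace (A * B)"
  using assms by (simp add: psd_mats_iff mat_trace_mult[where n = n] trace_prod_nonneg)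

section \<open>Measurement channels and data processing\<close>

definition measure_channel :: "nat \<Rightarrow> (nat \<Rightarrow> complex mat) \<Rightarrow> complex mat \<Rightarrow> complex mat" where
  "measure_channel d M X = mat d d (\<lambda>(x, y). if x = y then mat_trace (M x * X) else 0)"

lemma povmD:
  assumes "povm n d M"
  shows "\<And>x. x < d \<Longrightarrow> M x \<in> psd_mats n" "\<And>x. x < d \<Longrightarrow> M x \<in> carrier_mat n n"
    "\<And>i j. i < n \<Longrightarrow> j < n \<Longrightarrow> (\<Sum>x<d. M x $$ (i, j)) = (if i = j then 1 else 0)"
proof -
  show 1: "M x \<in> psd_mats n" if "x < d" for x using assms that by (simp add: povm_def)
  then show "M x \<in> carrier_mat n n" if "x < d" for x using that by (simp add: psd_mats_def)
  fix i j assume ij: "i < n" "j < n"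
  have "mat n n (\<lambda>ij. \<Sum>x<d. M x $$ ij) $$ (i, j) = 1\<^sub>m n $$ (i, j)" using assms by (simp add: povm_def)
  then show "(\<Sum>x<d. M x $$ (i, j)) = (if i = j then 1 else 0)" using ij by simp
qed

lemma sum_povm_trace:
  assumes M: "povm n d M" and A: "A \<in> carrier_mat n n"
  shows "(\<Sum>x<d. mat_trace (M x * A)) = mat_trace A"
proof -
  have "(\<Sum>x<d. mat_trace (M x * A)) = (\<Sum>x<d. \<Sum>i<n. \<Sum>j<n. M x $$ (i, j) * A $$ (j, i))"
    using povmD(2)[OF M] A by (intro sum.cong) (auto simp: mat_trace_mult[where n = n] trace_prod_def)
  also have "\<dots> = (\<Sum>i<n. \<Sum>x<d. \<Sum>j<n. M x $$ (i, j) * A $$ (j, i))" by (rule sum.swap)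
  also have "\<dots> = (\<Sum>i<n. \<Sum>j<n. \<Sum>x<d. M x $$ (i, j) * A $$ (j, i))"
    by (intro sum.cong refl sum.swap)
  also have "\<dots> = (\<Sum>i<n. \<Sum>j<n. (if i = j then 1 else 0) * A $$ (j, i))"
    using povmD(3)[OF M] by (simp flip: sum_distrib_right)
  also have "\<dots> = mat_trace A"
    using A by (simp add: mat_trace_def if_distrib[of "\<lambda>x. x * _"] cong: if_cong)
  finally show ?thesis .
qed

lemma sum_lessThan_mult:
  fixes f :: "nat \<Rightarrow> 'a :: comm_monoid_add"
  shows "sum f {..<k * d} = (\<Sum>a<k. \<Sum>x<d. f (a * d + x))"
proof -
  have "sum f {..<k * d} = (\<Sum>a<k. sum f {a * d..<a * d + d})" by (rule sum.nat_group[symmetric])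
  also have "\<dots> = (\<Sum>a<k. \<Sum>x<d. f (a * d + x))"
  proof (rule sum.cong[OF refl])
    fix a
    show "sum f {a * d..<a * d + d} = (\<Sum>x<d. f (a * d + x))"
      using sum.shift_bounds_nat_ivl[of f 0 "a * d" d] by (simp add: atLeast0LessThan add.commute)
  qed
  finally show ?thesis .
qed

lemma mult_add_less:
  fixes a x k d :: nat
  assumes "a < k" "x < d"
  shows "a * d + x < k * d"
proof -
  have "a * d + x < Suc a * d" using assms by simp
  also have "\<dots> \<le> k * d" using assms by (intro mult_le_mono1) simp
  finally show ?thesis .
qed

text \<open>The quadratic form of the ampliation splits over the outcomes \<open>x\<close> into traces of \<open>M x\<close> against
  the compression of \<open>X\<close> by the \<open>x\<close>-th slice of the vector.\<close>
lemma ampliation_measure_channel_psd: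
  assumes M: "povm n d M" and X: "X \<in> psd_mats (k * n)"
  shows "ampliation k n d (measure_channel d M) X \<in> psd_mats (k * d)"
proof -
  let ?Y = "ampliation k n d (measure_channel d M) X"
  define Z where "Z v x i j = (\<Sum>a<k. \<Sum>b<k. cnj (v (a * d + x)) * X $$ (a * n + i, b * n + j) * v (b * d + x))"
    for v x i j
  have Y: "?Y $$ (a * d + x, b * d + y)
      = (if x = y then \<Sum>i<n. \<Sum>j<n. M x $$ (i, j) * X $$ (a * n + j, b * n + i) else 0)"
    if "a < k" "b < k" "x < d" "y < d" for a b x y
  proof -
    have "mat n n (\<lambda>(i, j). X $$ (a * n + i, b * n + j)) \<in> carrier_mat n n" by simp
    then show ?thesis
      using that mult_add_less[of a k x d] mult_add_less[of b k y d] povmD(2)[OF M]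
      by (simp add: ampliation_def measure_channel_def mat_trace_mult[where n = n] trace_prod_def cong: if_cong)
  qed
  have "psd_form (k * d) (\<lambda>i j. ?Y $$ (i, j))"
    unfolding psd_form_def
  proof
    fix v
    have "sesq_form (k * d) (\<lambda>i j. ?Y $$ (i, j)) v
        = (\<Sum>a<k. \<Sum>x<d. \<Sum>b<k. \<Sum>y<d. cnj (v (a * d + x)) * ?Y $$ (a * d + x, b * d + y) * v (b * d + y))"
      by (simp add: sesq_form_def sum_lessThan_mult sum_distrib_left mult.assoc)
    also have "\<dots> = (\<Sum>a<k. \<Sum>x<d. \<Sum>b<k. \<Sum>i<n. \<Sum>j<n.
        M x $$ (i, j) * (cnj (v (a * d + x)) * X $$ (a * n + j, b * n + i) * v (b * d + x)))"
    proof (rule sum.cong[OF refl], rule sum.cong[OF refl], rule sum.cong[OF refl])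
      fix a x b assume "a \<in> {..<k}" "x \<in> {..<d}" "b \<in> {..<k}"
      then have "(\<Sum>y<d. cnj (v (a * d + x)) * ?Y $$ (a * d + x, b * d + y) * v (b * d + y))
          = (\<Sum>y<d. if x = y then cnj (v (a * d + x)) *
              (\<Sum>i<n. \<Sum>j<n. M x $$ (i, j) * X $$ (a * n + j, b * n + i)) * v (b * d + x) else 0)"
        by (intro sum.cong) (auto simp: Y)
      also have "\<dots> = cnj (v (a * d + x)) *
              (\<Sum>i<n. \<Sum>j<n. M x $$ (i, j) * X $$ (a * n + j, b * n + i)) * v (b * d + x)"
        using \<open>x \<in> {..<d}\<close> by simp
      also have "\<dots> = (\<Sum>i<n. \<Sum>j<n. M x $$ (i, j) * (cnj (v (a * d + x)) * X $$ (a * n + j, b * n + i) * v (b * d + x)))"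
        by (simp add: sum_distrib_left sum_distrib_right mult_ac)
      finally show "(\<Sum>y<d. cnj (v (a * d + x)) * ?Y $$ (a * d + x, b * d + y) * v (b * d + y)) = \<dots>" .
    qed
    also have "\<dots> = (\<Sum>x<d. \<Sum>a<k. \<Sum>b<k. \<Sum>i<n. \<Sum>j<n.
        M x $$ (i, j) * (cnj (v (a * d + x)) * X $$ (a * n + j, b * n + i) * v (b * d + x)))"
      by (rule sum.swap)
    also have "\<dots> = (\<Sum>x<d. trace_prod n (\<lambda>i j. M x $$ (i, j)) (Z v x))"
    proof (rule sum.cong[OF refl])
      fix x
      let ?t = "\<lambda>a b i j. M x $$ (i, j) * (cnj (v (a * d + x)) * X $$ (a * n + j, b * n + i) * v (b * d + x))"
      have "(\<Sum>a<k. \<Sum>b<k. \<Sum>i<n. \<Sum>j<n. ?t a b i j) = (\<Sum>a<k. \<Sum>i<n. \<Sum>b<k. \<Sum>j<n. ?t a b i j)"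
        by (intro sum.cong refl sum.swap)
      also have "\<dots> = (\<Sum>i<n. \<Sum>a<k. \<Sum>b<k. \<Sum>j<n. ?t a b i j)" by (rule sum.swap)
      also have "\<dots> = (\<Sum>i<n. \<Sum>a<k. \<Sum>j<n. \<Sum>b<k. ?t a b i j)"
        by (intro sum.cong refl sum.swap)
      also have "\<dots> = (\<Sum>i<n. \<Sum>j<n. \<Sum>a<k. \<Sum>b<k. ?t a b i j)"
        by (intro sum.cong refl sum.swap)
      also have "\<dots> = trace_prod n (\<lambda>i j. M x $$ (i, j)) (Z v x)"
        by (simp add: trace_prod_def Z_def sum_distrib_left)
      finally show "(\<Sum>a<k. \<Sum>b<k. \<Sum>i<n. \<Sum>j<n. ?t a b i j) = \<dots>" .
    qed
    also have "0 \<le> \<dots>"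
    proof (intro sum_nonneg trace_prod_nonneg)
      fix x assume "x \<in> {..<d}"
      then show "psd_form n (\<lambda>i j. M x $$ (i, j))" using povmD(1)[OF M] by (simp add: psd_mats_iff)
      show "psd_form n (Z v x)"
        unfolding psd_form_def
      proof
        fix u
        have "sesq_form n (Z v x) u = (\<Sum>i<n. \<Sum>j<n. \<Sum>a<k. \<Sum>b<k.
            cnj (v (a * d + x) * u i) * X $$ (a * n + i, b * n + j) * (v (b * d + x) * u j))"
          by (simp add: sesq_form_def Z_def sum_distrib_left sum_distrib_right mult_ac)
        also have "\<dots> = (\<Sum>i<n. \<Sum>a<k. \<Sum>j<n. \<Sum>b<k.
            cnj (v (a * d + x) * u i) * X $$ (a * n + i, b * n + j) * (v (b * d + x) * u j))"
          by (intro sum.cong refl sum.swap)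
        also have "\<dots> = (\<Sum>a<k. \<Sum>i<n. \<Sum>j<n. \<Sum>b<k.
            cnj (v (a * d + x) * u i) * X $$ (a * n + i, b * n + j) * (v (b * d + x) * u j))"
          by (rule sum.swap)
        also have "\<dots> = (\<Sum>a<k. \<Sum>i<n. \<Sum>b<k. \<Sum>j<n.
            cnj (v (a * d + x) * u i) * X $$ (a * n + i, b * n + j) * (v (b * d + x) * u j))"
          by (intro sum.cong refl sum.swap)
        \<comment> \<open>The form of the compression at \<open>u\<close> is the form of
          \<open>X\<close> at the tensor product of the \<open>x\<close>-th slice of
          \<open>v\<close> with \<open>u\<close>; \<open>l div n\<close> is the block index and
          \<open>l mod n\<close> the index inside the block.\<close>
        also have "\<dots> = sesq_form (k * n) (\<lambda>i j. X $$ (i, j)) (\<lambda>l. v (l div n * d + x) * u (l mod n))"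
          by (simp add: sesq_form_def sum_lessThan_mult sum_distrib_left mult.assoc)
        also have "0 \<le> \<dots>" using X by (auto simp: psd_mats_iff psd_form_def)
        finally show "0 \<le> sesq_form n (Z v x) u" .
      qed
    qed
    finally show "0 \<le> sesq_form (k * d) (\<lambda>i j. ?Y $$ (i, j)) v" .
  qed
  then show ?thesis by (simp add: psd_mats_iff ampliation_def)
qed

lemma cptp_measure_channel:
  assumes M: "povm n d M"
  shows "cptp n d (measure_channel d M)"
  unfolding cptp_def
proof (intro conjI ballI allI)
  note Mc = povmD(2)[OF M]
  fix A :: "complex mat" assume A: "A \<in> carrier_mat n n"
  show "measure_channel d M A \<in> carrier_mat d d" by (simp add: measure_channel_def)
  show "measure_channel d M (A + B) = measure_channel d M A + measure_channel d M B"
    if B: "B \<in> carrier_mat n n" for B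
  proof (rule eq_matI)
    fix x y assume "x < dim_row (measure_channel d M A + measure_channel d M B)"
      "y < dim_col (measure_channel d M A + measure_channel d M B)"
    then have xy: "x < d" "y < d" by (auto simp: measure_channel_def)
    have "mat_trace (M x * (A + B)) = mat_trace (M x * A) + mat_trace (M x * B)"
      unfolding mat_trace_mult[OF Mc[OF xy(1)] A] mat_trace_mult[OF Mc[OF xy(1)] B]
        mat_trace_mult[OF Mc[OF xy(1)] add_carrier_mat[OF B]]
      using A B by (simp add: trace_prod_def distrib_left sum.distrib)
    then show "measure_channel d M (A + B) $$ (x, y) = (measure_channel d M A + measure_channel d M B) $$ (x, y)"
      using xy by (cases "x = y") (simp_all add: measure_channel_def)
  qed (auto simp: measure_channel_def)
  show "measure_channel d M (c \<cdot>\<^sub>m A) = c \<cdot>\<^sub>m measure_channel d M A" for c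
  proof (rule eq_matI)
    fix x y assume "x < dim_row (c \<cdot>\<^sub>m measure_channel d M A)" "y < dim_col (c \<cdot>\<^sub>m measure_channel d M A)"
    then have xy: "x < d" "y < d" by (auto simp: measure_channel_def)
    have "mat_trace (M x * (c \<cdot>\<^sub>m A)) = c * mat_trace (M x * A)"
      unfolding mat_trace_mult[OF Mc[OF xy(1)] A] mat_trace_mult[OF Mc[OF xy(1)] smult_carrier_mat[OF A]]
      using A by (simp add: trace_prod_def sum_distrib_left mult.left_commute)
    then show "measure_channel d M (c \<cdot>\<^sub>m A) $$ (x, y) = (c \<cdot>\<^sub>m measure_channel d M A) $$ (x, y)"
      using xy by (cases "x = y") (simp_all add: measure_channel_def)
  qed (auto simp: measure_channel_def)
  have "mat_trace (measure_channel d M A) = (\<Sum>x<d. mat_trace (M x * A))"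
    by (simp add: measure_channel_def mat_trace_def)
  then show "mat_trace (measure_channel d M A) = mat_trace A" using sum_povm_trace[OF M A] by simp
qed (rule ampliation_measure_channel_psd[OF M])

lemma mat_adjoint_one: "mat_adjoint (1\<^sub>m n :: complex mat) = 1\<^sub>m n"
  by (rule eq_matI) (auto simp: mat_adjoint_def mat_of_rows_index)

lemma diag_in_basis_one:
  "diag_in_basis (1\<^sub>m (dim_vec p)) p = mat_diag (dim_vec p) (\<lambda>i. complex_of_real (p $ i))"
proof -
  have "mat_diag (dim_vec p) (\<lambda>i. complex_of_real (p $ i)) \<in> carrier_mat (dim_vec p) (dim_vec p)" by simp
  note left_mult_one_mat[OF this] right_mult_one_mat[OF this]
  then show ?thesis by (simp add: diag_in_basis_def mat_adjoint_one)
qed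

lemma measure_povm_prob_vecs:
  assumes M: "povm n d M" and \<rho>: "\<rho> \<in> density_ops n"
  shows "measure_povm d M \<rho> \<in> prob_vecs d"
    "diag_in_basis (1\<^sub>m d) (measure_povm d M \<rho>) = measure_channel d M \<rho>"
proof -
  have \<rho>p: "\<rho> \<in> psd_mats n" "\<rho> \<in> carrier_mat n n" "mat_trace \<rho> = 1"
    using \<rho> by (auto simp: density_ops_def psd_mats_def)
  have nn: "0 \<le> mat_trace (M x * \<rho>)" if "x < d" for x
    using mat_trace_mult_nonneg povmD(1)[OF M that] \<rho>p by blast
  have "(\<Sum>x<d. Re (mat_trace (M x * \<rho>))) = 1"
    using sum_povm_trace[OF M \<rho>p(2)] \<rho>p(3) by (simp flip: Re_sum)
  with nn show "measure_povm d M \<rho> \<in> prob_vecs d"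
    by (auto simp: prob_vecs_def measure_povm_def less_eq_complex_def)
  have "diag_in_basis (1\<^sub>m d) (measure_povm d M \<rho>) = mat_diag d (\<lambda>i. complex_of_real (measure_povm d M \<rho> $ i))"
    using diag_in_basis_one[of "measure_povm d M \<rho>"] by (simp add: measure_povm_def)
  also have "\<dots> = measure_channel d M \<rho>"
    using nn by (intro eq_matI)
      (auto simp: mat_diag_def measure_channel_def measure_povm_def less_eq_complex_def complex_eq_iff)
  finally show "diag_in_basis (1\<^sub>m d) (measure_povm d M \<rho>) = measure_channel d M \<rho>" .
qed

lemma one_mat_unitary: "1\<^sub>m n * mat_adjoint (1\<^sub>m n) = (1\<^sub>m n :: complex mat)"
  by (simp add: mat_adjoint_one)

lemma quantum_extension_measured_le:
  assumes D: "quantum_extension Dc D" and M: "povm n d M"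
    and \<rho>\<sigma>: "\<rho> \<in> density_ops n" "\<sigma> \<in> density_ops n"
  shows "Dc (measure_povm d M \<rho>) (measure_povm d M \<sigma>) \<le> D \<rho> \<sigma>"
proof -
  have "Dc (measure_povm d M \<rho>) (measure_povm d M \<sigma>) = D (measure_channel d M \<rho>) (measure_channel d M \<sigma>)"
    using D measure_povm_prob_vecs[OF M \<rho>\<sigma>(1)] measure_povm_prob_vecs[OF M \<rho>\<sigma>(2)] one_mat_unitary[of d]
    unfolding quantum_extension_def by (metis one_carrier_mat)
  also have "\<dots> \<le> D \<rho> \<sigma>"
    using D cptp_measure_channel[OF M] \<rho>\<sigma> by (auto simp: quantum_extension_def quantum_divergence_def)
  finally show ?thesis .
qed

section \<open>Diagonal states and the classical reduction\<close>

definition basis_povm :: "nat \<Rightarrow> nat \<Rightarrow> complex mat" where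
  "basis_povm n x = mat_diag n (\<lambda>i. if i = x then 1 else 0)"

lemma mat_diag_psd:
  assumes "\<And>i. i < n \<Longrightarrow> 0 \<le> f i"
  shows "mat_diag n f \<in> psd_mats n"
proof -
  have "sesq_form n (\<lambda>i j. mat_diag n f $$ (i, j)) v = (\<Sum>i<n. f i * of_real ((cmod (v i))\<^sup>2))" for v
  proof -
    have "(\<Sum>j<n. mat_diag n f $$ (i, j) * v j) = f i * v i" if "i < n" for i
      using that by (simp add: mat_diag_def if_distrib[of "\<lambda>x. x * _"] cong: if_cong)
    then show ?thesis by (simp add: sesq_form_def complex_norm_square mult_ac del: of_real_power)
  qed
  moreover have "0 \<le> (\<Sum>i<n. f i * complex_of_real ((cmod (v i))\<^sup>2))" for v
    using assms by (intro sum_nonneg mult_nonneg_nonneg) (auto simp: less_eq_complex_def)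
  ultimately show ?thesis by (simp add: psd_mats_iff psd_form_def)
qed

lemma basis_povm: "povm n n (basis_povm n)"
proof -
  have "mat n n (\<lambda>ij. \<Sum>x<n. basis_povm n x $$ ij) = 1\<^sub>m n"
    by (rule eq_matI) (auto simp: basis_povm_def mat_diag_def intro!: sum.neutral)
  moreover have "basis_povm n x \<in> psd_mats n" for x
    unfolding basis_povm_def by (rule mat_diag_psd) (simp add: less_eq_complex_def)
  ultimately show ?thesis by (simp add: povm_def)
qed

lemma diag_state:
  assumes p: "p \<in> prob_vecs n"
  defines "\<rho> \<equiv> diag_in_basis (1\<^sub>m n) p"
  shows "\<rho> \<in> density_ops n" "dim_row \<rho> = n" "measure_povm n (basis_povm n) \<rho> = p"
proof -
  have dim: "dim_vec p = n" and nn: "\<And>i. i < n \<Longrightarrow> 0 \<le> p $ i" and sum1: "(\<Sum>i<n. p $ i) = 1"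
    using p by (auto simp: prob_vecs_def)
  have \<rho>: "\<rho> = mat_diag n (\<lambda>i. complex_of_real (p $ i))"
    using diag_in_basis_one[of p] by (simp add: \<rho>_def dim)
  have "mat_trace \<rho> = complex_of_real (\<Sum>i<n. p $ i)"
    unfolding \<rho> by (simp add: mat_trace_def mat_diag_def)
  moreover have "\<rho> \<in> psd_mats n"
    unfolding \<rho> using nn by (intro mat_diag_psd) (auto simp: less_eq_complex_def)
  ultimately show "\<rho> \<in> density_ops n" using sum1 by (simp add: density_ops_def)
  show "dim_row \<rho> = n" by (simp add: \<rho> mat_diag_def)
  have "mat_trace (basis_povm n x * \<rho>) = complex_of_real (p $ x)" if "x < n" for x
  proof -
    have "basis_povm n x * \<rho> = mat_diag n (\<lambda>i. (if i = x then 1 else 0) * complex_of_real (p $ i))"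
      unfolding basis_povm_def \<rho> by (rule mat_diag_diag)
    then show ?thesis
      using that by (simp add: mat_trace_def mat_diag_def if_distrib[of "\<lambda>x. x * _"] cong: if_cong)
  qed
  then show "measure_povm n (basis_povm n) \<rho> = p"
    using dim by (intro eq_vecI) (auto simp: measure_povm_def)
qed

text \<open>Measuring a diagonal state in its own basis returns its probability vector, so the bound
  for states contains the classical one. Conversely, the classical bound holds for each measurement
  outcome, and data processing is applied to \<open>D\<close> alone, so that \<open>Dc'\<close> may
  be arbitrary.\<close>

lemma measured_bound_iff_classical_bound:
  assumes D: "quantum_extension Dc D"
  shows "(\<forall>n. \<forall>\<rho> \<in> density_ops n. \<forall>\<sigma> \<in> density_ops n. measured_ext Dc' \<rho> \<sigma> \<le> D \<rho> \<sigma> + ereal c) \<longleftrightarrow>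
    (\<forall>d. \<forall>p \<in> prob_vecs d. \<forall>q \<in> prob_vecs d. Dc' p q \<le> Dc p q + ereal c)" (is "?Q \<longleftrightarrow> ?C")
proof
  assume Q: ?Q
  show ?C
  proof (intro allI ballI)
    fix d p q assume pq: "p \<in> prob_vecs d" "q \<in> prob_vecs d"
    let ?\<rho> = "diag_in_basis (1\<^sub>m d) p" and ?\<sigma> = "diag_in_basis (1\<^sub>m d) q"
    have "Dc' p q = Dc' (measure_povm d (basis_povm d) ?\<rho>) (measure_povm d (basis_povm d) ?\<sigma>)"
      using diag_state[OF pq(1)] diag_state[OF pq(2)] by simp
    also have "\<dots> \<le> measured_ext Dc' ?\<rho> ?\<sigma>"
      unfolding measured_ext_def using basis_povm diag_state(2)[OF pq(1)]
      by (intro SUP_upper2[of "(d, basis_povm d)"]) auto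
    also have "\<dots> \<le> D ?\<rho> ?\<sigma> + ereal c" using Q diag_state(1)[OF pq(1)] diag_state(1)[OF pq(2)] by blast
    also have "D ?\<rho> ?\<sigma> = Dc p q"
      using D pq one_mat_unitary[of d] unfolding quantum_extension_def by (metis one_carrier_mat)
    finally show "Dc' p q \<le> Dc p q + ereal c" .
  qed
next
  assume C: ?C
  show ?Q
  proof (intro allI ballI)
    fix n \<rho> \<sigma> assume \<rho>\<sigma>: "\<rho> \<in> density_ops n" "\<sigma> \<in> density_ops n"
    then have n: "dim_row \<rho> = n" by (auto simp: density_ops_def psd_mats_def)
    show "measured_ext Dc' \<rho> \<sigma> \<le> D \<rho> \<sigma> + ereal c"
      unfolding measured_ext_def n
    proof (rule SUP_least)
      fix dM assume "dM \<in> {(d, M). povm n d M}"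
      then obtain d M where dM: "dM = (d, M)" and M: "povm n d M" by auto
      have "Dc' (measure_povm d M \<rho>) (measure_povm d M \<sigma>)
          \<le> Dc (measure_povm d M \<rho>) (measure_povm d M \<sigma>) + ereal c"
        using C measure_povm_prob_vecs(1)[OF M] \<rho>\<sigma> by blast
      also have "\<dots> \<le> D \<rho> \<sigma> + ereal c"
        by (intro add_right_mono quantum_extension_measured_le[OF D M \<rho>\<sigma>])
      finally show "(case dM of (d, M) \<Rightarrow> Dc' (measure_povm d M \<rho>) (measure_povm d M \<sigma>)) \<le> D \<rho> \<sigma> + ereal c"
        by (simp add: dM)
    qed
  qed
qed

section \<open>The optimal constant\<close>

theorem theorem1:
  fixes \<epsilon> :: real and \<alpha> \<beta> :: ereal and D :: "complex mat \<Rightarrow> complex mat \<Rightarrow> ereal"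
  assumes "0 < \<epsilon>" and "\<epsilon> < 1"
    and "0 \<le> \<alpha>" and "0 \<le> \<beta>"
    and "quantum_extension (renyi_div \<alpha>) D"
  shows "opt_const \<epsilon> \<beta> D = max 0 (mu_tilde \<epsilon> \<alpha> \<beta>)"
proof -
  define c where "c = max 0 (mu_tilde \<epsilon> \<alpha> \<beta>)"
  let ?bound = "\<lambda>c. \<forall>d. \<forall>p \<in> prob_vecs d. \<forall>q \<in> prob_vecs d.
    smoothed \<epsilon> (renyi_div \<beta>) p q \<le> renyi_div \<alpha> p q + ereal c"
  have "opt_const \<epsilon> \<beta> D = Inf (ereal ` {c. ?bound c})"
    unfolding opt_const_def measured_bound_iff_classical_bound[OF assms(5)] ..
  also have "\<dots> = c"
  proof (rule antisym)
    \<comment> \<open>The infimum ranges over real constants, so \<open>c\<close> can be exhibited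
      as one of them only when it is finite; an infinite \<open>c\<close> bounds everything.\<close>
    have "c \<noteq> -\<infinity>" by (auto simp: c_def max_def)
    then consider "c = \<infinity>" | r where "c = ereal r" by (cases c) auto
    then show "Inf (ereal ` {c. ?bound c}) \<le> c"
    proof cases
      case 2
      then have "?bound r"
        using smoothed_renyi_div_le[OF _ _ assms(1,3,4)] by (simp add: c_def)
      then show ?thesis unfolding 2 by (intro Inf_lower) auto
    qed simp
    show "c \<le> Inf (ereal ` {c. ?bound c})"
      using mu_tilde_le_additive_constant[OF assms(1-4)] unfolding c_def
      by (intro Inf_greatest) blast
  qed
  finally show ?thesis by (simp add: c_def)
qed

end
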